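(* Over $\mathsf{RCA}_0$: if the discrete order $\mathbf 3$ on $\{0,1,2\}$ is $\mathsf{BQO}$, then $\Omega\oplus\Omega$ is $\mathsf{BQO}$ for every well order $\Omega$.
   Context: Finite subsets of $\mathbb N$ are identified with their increasing enumerations. For finite $s,t\subseteq\mathbb N$, $s\vartriangleleft t$ means there is an infinite $X\subseteq\mathbb N$ such that $s$ is an initial segment of $X$ and $t$ is an initial segment of $X$ minus its least element. A block is a set $B$ of finite subsets of $\mathbb N$ whose base $\bigcup B$ is infinite, such that every infinite $X\subseteq\bigcup B$ has an initial segment in $B$ and no element of $B$ is a proper initial segment of another; a barrier is a block in which no element is a proper subset of another. A quasi order $Q$ is $\mathsf{BQO}$ if for every barrier $B$ and every $f:B\to Q$ there are $s\vartriangleleft t$ in $B$ with $f(s)\leq_Q f(t)$. For quasi orders $Q_0,Q_1$, $Q_0\oplus Q_1$ is the disjoint union $\{\langle i,q\rangle\mid i\in\{0,1\},q\in Q_i\}$ with $\langle i,p\rangle\leq\langle j,q\rangle$ iff $i=j$ and $p\leq_{Q_i}q$. *)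

theory Defs
  imports Main
begin

text \<open>
  A statement ``over \<open>RCA\<^sub>0\<close>'' is read as: it holds in every model of \<open>RCA\<^sub>0\<close> for the
  two-sorted language of second order arithmetic. The numbers of a model form an arbitrary type,
  so they may be nonstandard, and the set variables range over an arbitrary collection of sets of
  numbers. From \<open>models_RCA0\<close> on, every quantifier ranges over the numbers or over
  the sets of the model, so that all notions are evaluated inside the model.
\<close>

record 'a l2_structure =
  nzero :: 'a ("\<zero>\<index>")
  none :: 'a ("\<one>\<index>")
  nadd :: "'a \<Rightarrow> 'a \<Rightarrow> 'a" (infixl "\<oplus>\<index>" 65)
  nmul :: "'a \<Rightarrow> 'a \<Rightarrow> 'a" (infixl "\<otimes>\<index>" 70)
  nless :: "'a \<Rightarrow> 'a \<Rightarrow> bool" (infix "\<prec>\<index>" 50)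
  Sets :: "'a set set"


section \<open>The axiom system\<close>

datatype tm = Var nat | Zero | One | Add tm tm | Mul tm tm

text \<open>
  Bounded quantifier formulas. In \<open>BAll x t \<phi>\<close> and \<open>BEx x t \<phi>\<close> the bound \<open>t\<close> lies outside the
  scope of \<open>x\<close>. The second argument of \<open>Mem\<close> is the index of a set variable.
\<close>

datatype bfm =
    Eq tm tm | Less tm tm | Mem tm nat
  | Neg bfm | And bfm bfm | Or bfm bfm | Imp bfm bfm
  | BAll nat tm bfm | BEx nat tm bfm

primrec tval :: "'a l2_structure \<Rightarrow> (nat \<Rightarrow> 'a) \<Rightarrow> tm \<Rightarrow> 'a" where
  "tval M e (Var x) = e x"
| "tval M e Zero = \<zero>\<^bsub>M\<^esub>"
| "tval M e One = \<one>\<^bsub>M\<^esub>"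
| "tval M e (Add s t) = tval M e s \<oplus>\<^bsub>M\<^esub> tval M e t"
| "tval M e (Mul s t) = tval M e s \<otimes>\<^bsub>M\<^esub> tval M e t"

primrec bsat :: "'a l2_structure \<Rightarrow> (nat \<Rightarrow> 'a set) \<Rightarrow> (nat \<Rightarrow> 'a) \<Rightarrow> bfm \<Rightarrow> bool" where
  "bsat M E e (Eq s t) \<longleftrightarrow> tval M e s = tval M e t"
| "bsat M E e (Less s t) \<longleftrightarrow> tval M e s \<prec>\<^bsub>M\<^esub> tval M e t"
| "bsat M E e (Mem t X) \<longleftrightarrow> tval M e t \<in> E X"
| "bsat M E e (Neg \<phi>) \<longleftrightarrow> \<not> bsat M E e \<phi>"
| "bsat M E e (And \<phi> \<psi>) \<longleftrightarrow> bsat M E e \<phi> \<and> bsat M E e \<psi>"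
| "bsat M E e (Or \<phi> \<psi>) \<longleftrightarrow> bsat M E e \<phi> \<or> bsat M E e \<psi>"
| "bsat M E e (Imp \<phi> \<psi>) \<longleftrightarrow> (bsat M E e \<phi> \<longrightarrow> bsat M E e \<psi>)"
| "bsat M E e (BAll x t \<phi>) \<longleftrightarrow> (\<forall>a. a \<prec>\<^bsub>M\<^esub> tval M e t \<longrightarrow> bsat M E (e(x := a)) \<phi>)"
| "bsat M E e (BEx x t \<phi>) \<longleftrightarrow> (\<exists>a. a \<prec>\<^bsub>M\<^esub> tval M e t \<and> bsat M E (e(x := a)) \<phi>)"

text \<open>The \<open>\<Sigma>\<^sup>0\<^sub>1\<close>-formula \<open>\<exists>y. \<phi>\<close> and the \<open>\<Pi>\<^sup>0\<^sub>1\<close>-formula \<open>\<forall>y. \<phi>\<close>.\<close>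

definition sigma_sat ::
    "'a l2_structure \<Rightarrow> (nat \<Rightarrow> 'a set) \<Rightarrow> (nat \<Rightarrow> 'a) \<Rightarrow> nat \<Rightarrow> bfm \<Rightarrow> bool" where
  "sigma_sat M E e y \<phi> \<longleftrightarrow> (\<exists>a. bsat M E (e(y := a)) \<phi>)"

definition pi_sat ::
    "'a l2_structure \<Rightarrow> (nat \<Rightarrow> 'a set) \<Rightarrow> (nat \<Rightarrow> 'a) \<Rightarrow> nat \<Rightarrow> bfm \<Rightarrow> bool" where
  "pi_sat M E e y \<phi> \<longleftrightarrow> (\<forall>a. bsat M E (e(y := a)) \<phi>)"

definition basic_axioms :: "'a l2_structure \<Rightarrow> bool" where
  "basic_axioms M \<longleftrightarrow>
     (\<forall>n. n \<oplus>\<^bsub>M\<^esub> \<one>\<^bsub>M\<^esub> \<noteq> \<zero>\<^bsub>M\<^esub>) \<and>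
     (\<forall>m n. m \<oplus>\<^bsub>M\<^esub> \<one>\<^bsub>M\<^esub> = n \<oplus>\<^bsub>M\<^esub> \<one>\<^bsub>M\<^esub> \<longrightarrow> m = n) \<and>
     (\<forall>m. m \<oplus>\<^bsub>M\<^esub> \<zero>\<^bsub>M\<^esub> = m) \<and>
     (\<forall>m n. m \<oplus>\<^bsub>M\<^esub> (n \<oplus>\<^bsub>M\<^esub> \<one>\<^bsub>M\<^esub>) = (m \<oplus>\<^bsub>M\<^esub> n) \<oplus>\<^bsub>M\<^esub> \<one>\<^bsub>M\<^esub>) \<and>
     (\<forall>m. m \<otimes>\<^bsub>M\<^esub> \<zero>\<^bsub>M\<^esub> = \<zero>\<^bsub>M\<^esub>) \<and>
     (\<forall>m n. m \<otimes>\<^bsub>M\<^esub> (n \<oplus>\<^bsub>M\<^esub> \<one>\<^bsub>M\<^esub>) = (m \<otimes>\<^bsub>M\<^esub> n) \<oplus>\<^bsub>M\<^esub> m) \<and>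
     (\<forall>m. \<not> m \<prec>\<^bsub>M\<^esub> \<zero>\<^bsub>M\<^esub>) \<and>
     (\<forall>m n. m \<prec>\<^bsub>M\<^esub> n \<oplus>\<^bsub>M\<^esub> \<one>\<^bsub>M\<^esub> \<longleftrightarrow> m \<prec>\<^bsub>M\<^esub> n \<or> m = n)"

definition sigma_induction :: "'a l2_structure \<Rightarrow> bool" where
  "sigma_induction M \<longleftrightarrow>
     (\<forall>\<phi> x y E e. range E \<subseteq> Sets M \<longrightarrow>
        sigma_sat M E (e(x := \<zero>\<^bsub>M\<^esub>)) y \<phi> \<longrightarrow>
        (\<forall>n. sigma_sat M E (e(x := n)) y \<phi> \<longrightarrow> sigma_sat M E (e(x := n \<oplus>\<^bsub>M\<^esub> \<one>\<^bsub>M\<^esub>)) y \<phi>) \<longrightarrow>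
        (\<forall>n. sigma_sat M E (e(x := n)) y \<phi>))"

definition delta_comprehension :: "'a l2_structure \<Rightarrow> bool" where
  "delta_comprehension M \<longleftrightarrow>
     (\<forall>\<phi> \<psi> x y z E e. range E \<subseteq> Sets M \<longrightarrow>
        (\<forall>n. sigma_sat M E (e(x := n)) y \<phi> \<longleftrightarrow> pi_sat M E (e(x := n)) z \<psi>) \<longrightarrow>
        {n. sigma_sat M E (e(x := n)) y \<phi>} \<in> Sets M)"

definition models_RCA0 :: "'a l2_structure \<Rightarrow> bool" where
  "models_RCA0 M \<longleftrightarrow>
     Sets M \<noteq> {} \<and> basic_axioms M \<and> sigma_induction M \<and> delta_comprehension M"

lemma standard_models_RCA0:
  "models_RCA0 \<lparr>nzero = 0, none = 1, nadd = (+), nmul = (*), nless = (<), Sets = (UNIV :: nat set set)\<rparr>"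
proof -
  let ?M = "\<lparr>nzero = 0, none = 1, nadd = (+), nmul = (*), nless = (<), Sets = (UNIV :: nat set set)\<rparr>"
  have "basic_axioms ?M"
    unfolding basic_axioms_def by auto
  moreover have "sigma_induction ?M"
    unfolding sigma_induction_def
  proof (intro allI impI)
    fix \<phi> x y and E :: "nat \<Rightarrow> nat set" and e n
    assume "sigma_sat ?M E (e(x := \<zero>\<^bsub>?M\<^esub>)) y \<phi>"
      and "\<forall>n. sigma_sat ?M E (e(x := n)) y \<phi> \<longrightarrow>
             sigma_sat ?M E (e(x := n \<oplus>\<^bsub>?M\<^esub> \<one>\<^bsub>?M\<^esub>)) y \<phi>"
    then show "sigma_sat ?M E (e(x := n)) y \<phi>"
      by (induction n) simp_all
  qed
  moreover have "delta_comprehension ?M"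
    unfolding delta_comprehension_def by simp
  ultimately show ?thesis
    unfolding models_RCA0_def by simp
qed


section \<open>Coding\<close>

definition pair :: "'a l2_structure \<Rightarrow> 'a \<Rightarrow> 'a \<Rightarrow> 'a" where
  "pair M i j = ((i \<oplus>\<^bsub>M\<^esub> j) \<otimes>\<^bsub>M\<^esub> (i \<oplus>\<^bsub>M\<^esub> j)) \<oplus>\<^bsub>M\<^esub> i"

text \<open>
  The usual coding of finite sets in \<open>RCA\<^sub>0\<close>: a number of the form \<open>\<langle>k, \<langle>m, n\<rangle>\<rangle>\<close>
  represents \<open>{i < k. m(i + 1) + 1 divides n}\<close>, and the code of a finite set is the least number
  that represents it. Numbers not of this form get \<open>elts M c = {}\<close>; they are not codes,
  since the empty set has the code \<open>0 = \<langle>0, \<langle>0, 0\<rangle>\<rangle>\<close>.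
\<close>

definition elts :: "'a l2_structure \<Rightarrow> 'a \<Rightarrow> 'a set" where
  "elts M c = {i. \<exists>k m n. c = pair M k (pair M m n) \<and> i \<prec>\<^bsub>M\<^esub> k \<and>
     (\<exists>q. n = ((m \<otimes>\<^bsub>M\<^esub> (i \<oplus>\<^bsub>M\<^esub> \<one>\<^bsub>M\<^esub>)) \<oplus>\<^bsub>M\<^esub> \<one>\<^bsub>M\<^esub>) \<otimes>\<^bsub>M\<^esub> q)}"

definition is_fincode :: "'a l2_structure \<Rightarrow> 'a \<Rightarrow> bool" where
  "is_fincode M c \<longleftrightarrow> (\<forall>d. d \<prec>\<^bsub>M\<^esub> c \<longrightarrow> elts M d \<noteq> elts M c)"

definition is_fun :: "'a l2_structure \<Rightarrow> 'a set \<Rightarrow> 'a set \<Rightarrow> 'a set \<Rightarrow> bool" where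
  "is_fun M f A B \<longleftrightarrow> f \<in> Sets M \<and>
     f \<subseteq> {pair M x y | x y. x \<in> A \<and> y \<in> B} \<and>
     (\<forall>x\<in>A. \<exists>!y. pair M x y \<in> f)"


section \<open>Barriers\<close>

definition infin :: "'a l2_structure \<Rightarrow> 'a set \<Rightarrow> bool" where
  "infin M X \<longleftrightarrow> (\<forall>n. \<exists>m\<in>X. n \<prec>\<^bsub>M\<^esub> m)"

text \<open>
  For sets of numbers, the increasing enumeration of \<open>S\<close> is an initial segment of that of \<open>X\<close>
  precisely if \<open>S\<close> is a downward closed part of \<open>X\<close>.
\<close>

definition init_seg :: "'a l2_structure \<Rightarrow> 'a set \<Rightarrow> 'a set \<Rightarrow> bool" where
  "init_seg M S X \<longleftrightarrow> S \<subseteq> X \<and> (\<forall>x\<in>X. \<forall>y\<in>S. x \<prec>\<^bsub>M\<^esub> y \<longrightarrow> x \<in> S)"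

definition minus_least :: "'a l2_structure \<Rightarrow> 'a set \<Rightarrow> 'a set" where
  "minus_least M X = {x \<in> X. \<exists>y\<in>X. y \<prec>\<^bsub>M\<^esub> x}"

definition tri :: "'a l2_structure \<Rightarrow> 'a \<Rightarrow> 'a \<Rightarrow> bool" where
  "tri M s t \<longleftrightarrow> (\<exists>X\<in>Sets M. infin M X \<and>
     init_seg M (elts M s) X \<and> init_seg M (elts M t) (minus_least M X))"

text \<open>The base need not be a set of the model; it only occurs through its elements.\<close>

definition base :: "'a l2_structure \<Rightarrow> 'a set \<Rightarrow> 'a set" where
  "base M B = (\<Union>s\<in>B. elts M s)"

definition is_block :: "'a l2_structure \<Rightarrow> 'a set \<Rightarrow> bool" where
  "is_block M B \<longleftrightarrow> B \<in> Sets M \<and> (\<forall>s\<in>B. is_fincode M s) \<and> infin M (base M B) \<and>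
     (\<forall>X\<in>Sets M. infin M X \<and> X \<subseteq> base M B \<longrightarrow> (\<exists>s\<in>B. init_seg M (elts M s) X)) \<and>
     (\<forall>s\<in>B. \<forall>t\<in>B. \<not> (init_seg M (elts M s) (elts M t) \<and> elts M s \<noteq> elts M t))"

definition is_barrier :: "'a l2_structure \<Rightarrow> 'a set \<Rightarrow> bool" where
  "is_barrier M B \<longleftrightarrow> is_block M B \<and> (\<forall>s\<in>B. \<forall>t\<in>B. \<not> elts M s \<subset> elts M t)"


section \<open>Orders\<close>

text \<open>An order is given by its field and by the set of coded pairs \<open>\<langle>p, q\<rangle>\<close> with \<open>p \<le> q\<close>.\<close>

type_synonym 'a ord = "'a set \<times> 'a set"

definition ord_le :: "'a l2_structure \<Rightarrow> 'a ord \<Rightarrow> 'a \<Rightarrow> 'a \<Rightarrow> bool" where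
  "ord_le M Q p q \<longleftrightarrow> pair M p q \<in> snd Q"

definition is_quasi_order :: "'a l2_structure \<Rightarrow> 'a ord \<Rightarrow> bool" where
  "is_quasi_order M Q \<longleftrightarrow> fst Q \<in> Sets M \<and> snd Q \<in> Sets M \<and>
     snd Q \<subseteq> {pair M p q | p q. p \<in> fst Q \<and> q \<in> fst Q} \<and>
     (\<forall>p\<in>fst Q. ord_le M Q p p) \<and>
     (\<forall>p\<in>fst Q. \<forall>q\<in>fst Q. \<forall>r\<in>fst Q. ord_le M Q p q \<and> ord_le M Q q r \<longrightarrow> ord_le M Q p r)"

definition is_linear_order :: "'a l2_structure \<Rightarrow> 'a ord \<Rightarrow> bool" where
  "is_linear_order M Q \<longleftrightarrow> is_quasi_order M Q \<and>
     (\<forall>p\<in>fst Q. \<forall>q\<in>fst Q. ord_le M Q p q \<and> ord_le M Q q p \<longrightarrow> p = q) \<and>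
     (\<forall>p\<in>fst Q. \<forall>q\<in>fst Q. ord_le M Q p q \<or> ord_le M Q q p)"

definition is_well_order :: "'a l2_structure \<Rightarrow> 'a ord \<Rightarrow> bool" where
  "is_well_order M Q \<longleftrightarrow> is_linear_order M Q \<and>
     \<not> (\<exists>f. is_fun M f UNIV (fst Q) \<and>
          (\<forall>n p q. pair M n p \<in> f \<and> pair M (n \<oplus>\<^bsub>M\<^esub> \<one>\<^bsub>M\<^esub>) q \<in> f \<longrightarrow> ord_le M Q q p \<and> q \<noteq> p))"

definition is_bqo :: "'a l2_structure \<Rightarrow> 'a ord \<Rightarrow> bool" where
  "is_bqo M Q \<longleftrightarrow> is_quasi_order M Q \<and>
     (\<forall>B f. is_barrier M B \<and> is_fun M f B (fst Q) \<longrightarrow>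
        (\<exists>s\<in>B. \<exists>t\<in>B. tri M s t \<and>
           (\<exists>p q. pair M s p \<in> f \<and> pair M t q \<in> f \<and> ord_le M Q p q)))"

definition discrete3 :: "'a l2_structure \<Rightarrow> 'a ord" where
  "discrete3 M = (let T = {\<zero>\<^bsub>M\<^esub>, \<one>\<^bsub>M\<^esub>, \<one>\<^bsub>M\<^esub> \<oplus>\<^bsub>M\<^esub> \<one>\<^bsub>M\<^esub>} in (T, {pair M i i | i. i \<in> T}))"

definition ord_sum :: "'a l2_structure \<Rightarrow> 'a ord \<Rightarrow> 'a ord \<Rightarrow> 'a ord" where
  "ord_sum M Q0 Q1 =
     ({pair M \<zero>\<^bsub>M\<^esub> q | q. q \<in> fst Q0} \<union> {pair M \<one>\<^bsub>M\<^esub> q | q. q \<in> fst Q1},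
      {pair M (pair M \<zero>\<^bsub>M\<^esub> p) (pair M \<zero>\<^bsub>M\<^esub> q) | p q. p \<in> fst Q0 \<and> q \<in> fst Q0 \<and> ord_le M Q0 p q} \<union>
      {pair M (pair M \<one>\<^bsub>M\<^esub> p) (pair M \<one>\<^bsub>M\<^esub> q) | p q. p \<in> fst Q1 \<and> q \<in> fst Q1 \<and> ord_le M Q1 p q})"

end

theory Submission
  imports Defs
begin

text \<open>
  Everything takes place inside a model of \<open>RCA\<^sub>0\<close>. Suppose that \<open>I\<close> is a set of finite sets such
  that, along every infinite \<open>X\<close>, infinitely many final segments of \<open>X\<close> have an initial segment in
  \<open>I\<close>, but never two consecutive ones. Colouring \<open>X\<close> by the parity of the number of steps to the
  first such final segment, with a third colour if that number is \<open>0\<close>, gives consecutive final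
  segments different colours. The initial segments of \<open>X\<close> on which this colour is first determined
  for every \<open>Y\<close> that is pointwise at most \<open>X\<close> form a barrier, provided that this happens at some
  point. In that case \<open>\<^bold>3\<close> is not a better quasi order.

  If the projection of a set \<open>Z\<close> does not exist, this applies to the local maxima of the least
  number that is enumerated by \<open>Z\<close> between two consecutive members of \<open>X\<close>: a sequence without such
  maxima decreases and then increases strictly, so it bounds the stages of the enumeration. Hence
  arithmetical comprehension holds if \<open>\<^bold>3\<close> is a better quasi order. It makes the tree argument
  available by which the construction also applies to a bad function into \<open>\<Omega> \<oplus> \<Omega>\<close>, with \<open>I\<close>
  given by the changes from the first to the second summand: an infinite \<open>X\<close> without such
  changes is eventually mapped into one summand, where its values descend.
\<close>

text \<open>The colour has to be read off finite initial segments, and these have to form a barrier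
  and not merely a block. Stopping as soon as an infinite set itself meets \<open>I\<close> may give
  segments that are properly contained in one another. Asking instead that every finite set that
  keeps pace with it meets \<open>I\<close> makes the stopping condition monotone under thinning,
  and this yields the antichain property. The price is a compactness condition: if it fails at
  \<open>X\<close>, the base theory provides finite sets free of \<open>I\<close> of every length
  that keep pace with \<open>X\<close>, but no infinite one. This is why the construction is used
  twice. For an enumeration the bound on the stages depends on \<open>X\<close> alone and is
  verified on finite free sets, so a failure of compactness already makes the projection Delta01.
  Only after arithmetical comprehension has been gained in this way can the finite free sets be
  assembled into an infinite one, as the second use requires. Three colours suffice because parity
  separates consecutive counts, except that after count zero the counting starts afresh.\<close>

section \<open>Definability with parameters\<close>

text \<open>
  Bounded formulas with de Bruijn indices in which numbers and sets of the model occur as constants,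
  so that parameters need no names.
\<close>

datatype 'a ptm = PVar nat | PConst 'a | PAdd "'a ptm" "'a ptm" | PMul "'a ptm" "'a ptm"

datatype 'a pfm =
    PEq "'a ptm" "'a ptm" | PLess "'a ptm" "'a ptm" | PMem "'a ptm" "'a set"
  | PNeg "'a pfm" | PAnd "'a pfm" "'a pfm" | PAll "'a ptm" "'a pfm"

abbreviation econs :: "'a \<Rightarrow> (nat \<Rightarrow> 'a) \<Rightarrow> nat \<Rightarrow> 'a" (infixr "##" 65) where
  "a ## e \<equiv> case_nat a e"

primrec pval :: "'a l2_structure \<Rightarrow> (nat \<Rightarrow> 'a) \<Rightarrow> 'a ptm \<Rightarrow> 'a" where
  "pval M e (PVar x) = e x"
| "pval M e (PConst c) = c"
| "pval M e (PAdd s t) = pval M e s \<oplus>\<^bsub>M\<^esub> pval M e t"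
| "pval M e (PMul s t) = pval M e s \<otimes>\<^bsub>M\<^esub> pval M e t"

primrec psat :: "'a l2_structure \<Rightarrow> (nat \<Rightarrow> 'a) \<Rightarrow> 'a pfm \<Rightarrow> bool" where
  "psat M e (PEq s t) \<longleftrightarrow> pval M e s = pval M e t"
| "psat M e (PLess s t) \<longleftrightarrow> pval M e s \<prec>\<^bsub>M\<^esub> pval M e t"
| "psat M e (PMem t X) \<longleftrightarrow> pval M e t \<in> X"
| "psat M e (PNeg \<phi>) \<longleftrightarrow> \<not> psat M e \<phi>"
| "psat M e (PAnd \<phi> \<psi>) \<longleftrightarrow> psat M e \<phi> \<and> psat M e \<psi>"
| "psat M e (PAll t \<phi>) \<longleftrightarrow> (\<forall>a. a \<prec>\<^bsub>M\<^esub> pval M e t \<longrightarrow> psat M (a ## e) \<phi>)"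

primrec tconsts :: "'a ptm \<Rightarrow> 'a set" where
  "tconsts (PVar x) = {}"
| "tconsts (PConst c) = {c}"
| "tconsts (PAdd s t) = tconsts s \<union> tconsts t"
| "tconsts (PMul s t) = tconsts s \<union> tconsts t"

primrec fconsts :: "'a pfm \<Rightarrow> 'a set" where
  "fconsts (PEq s t) = tconsts s \<union> tconsts t"
| "fconsts (PLess s t) = tconsts s \<union> tconsts t"
| "fconsts (PMem t X) = tconsts t"
| "fconsts (PNeg \<phi>) = fconsts \<phi>"
| "fconsts (PAnd \<phi> \<psi>) = fconsts \<phi> \<union> fconsts \<psi>"
| "fconsts (PAll t \<phi>) = tconsts t \<union> fconsts \<phi>"

primrec fsets :: "'a pfm \<Rightarrow> 'a set set" where
  "fsets (PEq s t) = {}"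
| "fsets (PLess s t) = {}"
| "fsets (PMem t X) = {X}"
| "fsets (PNeg \<phi>) = fsets \<phi>"
| "fsets (PAnd \<phi> \<psi>) = fsets \<phi> \<union> fsets \<psi>"
| "fsets (PAll t \<phi>) = fsets \<phi>"

lemma finite_tconsts: "finite (tconsts t)"
  by (induction t) auto

lemma finite_fconsts: "finite (fconsts \<phi>)"
  by (induction \<phi>) (auto simp: finite_tconsts)

lemma finite_fsets: "finite (fsets \<phi>)"
  by (induction \<phi>) auto

text \<open>
  Under \<open>d\<close> binders the variables bound at level \<open>l\<close>, the free variables and the constants get the
  names \<open>3 l\<close>, \<open>3 k + 1\<close> and \<open>3 j + 2\<close>, respectively.
\<close>

definition vname :: "nat \<Rightarrow> nat \<Rightarrow> nat" where
  "vname d i = (if i < d then 3 * (d - 1 - i) else 3 * (i - d) + 1)"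

primrec ttrans :: "('a \<Rightarrow> nat) \<Rightarrow> nat \<Rightarrow> 'a ptm \<Rightarrow> tm" where
  "ttrans ci d (PVar x) = Var (vname d x)"
| "ttrans ci d (PConst c) = Var (3 * ci c + 2)"
| "ttrans ci d (PAdd s t) = Add (ttrans ci d s) (ttrans ci d t)"
| "ttrans ci d (PMul s t) = Mul (ttrans ci d s) (ttrans ci d t)"

primrec ftrans :: "('a \<Rightarrow> nat) \<Rightarrow> ('a set \<Rightarrow> nat) \<Rightarrow> nat \<Rightarrow> 'a pfm \<Rightarrow> bfm" where
  "ftrans ci si d (PEq s t) = Eq (ttrans ci d s) (ttrans ci d t)"
| "ftrans ci si d (PLess s t) = Less (ttrans ci d s) (ttrans ci d t)"
| "ftrans ci si d (PMem t X) = Mem (ttrans ci d t) (si X)"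
| "ftrans ci si d (PNeg \<phi>) = Neg (ftrans ci si d \<phi>)"
| "ftrans ci si d (PAnd \<phi> \<psi>) = And (ftrans ci si d \<phi>) (ftrans ci si d \<psi>)"
| "ftrans ci si d (PAll t \<phi>) = BAll (3 * d) (ttrans ci d t) (ftrans ci si (Suc d) \<phi>)"

lemma tval_ttrans:
  "\<forall>c\<in>tconsts t. v (3 * ci c + 2) = c \<Longrightarrow>
     tval M v (ttrans ci d t) = pval M (\<lambda>i. v (vname d i)) t"
  by (induction t) auto

text \<open>Bound variables are named by level and not by index, so entering a binder renames
  nothing. Only the fresh name \<open>3 * d\<close> is assigned; the names in use are smaller
  multiples of 3 or lie in other residue classes.\<close>

lemma vname_Suc: "(\<lambda>i. (v(3 * d := a)) (vname (Suc d) i)) = a ## (\<lambda>i. v (vname d i))"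
proof
  fix i
  show "(v(3 * d := a)) (vname (Suc d) i) = (a ## (\<lambda>i. v (vname d i))) i"
  proof (cases i)
    case (Suc j)
    have "3 * (j - d) + 1 \<noteq> 3 * d" "j < d \<Longrightarrow> 3 * (d - 1 - j) \<noteq> 3 * d"
      by presburger+
    with Suc show ?thesis
      by (auto simp: vname_def)
  qed (simp add: vname_def)
qed

lemma bsat_ftrans:
  "\<forall>c\<in>fconsts \<phi>. v (3 * ci c + 2) = c \<Longrightarrow> \<forall>X\<in>fsets \<phi>. E (si X) = X \<Longrightarrow>
     bsat M E v (ftrans ci si d \<phi>) \<longleftrightarrow> psat M (\<lambda>i. v (vname d i)) \<phi>"
proof (induction \<phi> arbitrary: d v)
  case (PAll t \<phi>)
  have "bsat M E (v(3 * d := a)) (ftrans ci si (Suc d) \<phi>) \<longleftrightarrow>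
      psat M (a ## (\<lambda>i. v (vname d i))) \<phi>" for a
  proof -
    have "3 * ci c + 2 \<noteq> 3 * d" for c
      by presburger
    with PAll.prems(1) have 1: "\<forall>c\<in>fconsts \<phi>. (v(3 * d := a)) (3 * ci c + 2) = c"
      by auto
    show ?thesis
      using PAll.IH[OF 1, of "Suc d"] PAll.prems(2) unfolding vname_Suc by (simp only: fsets.simps)
  qed
  with PAll.prems show ?case
    by (simp add: tval_ttrans)
qed (auto simp: tval_ttrans)

text \<open>The finitely many constants and sets of both formulas are numbered injectively and
  absorbed into one assignment, since comprehension asks for the same \<open>E\<close> and
  \<open>e\<close> in its Sigma01 and its Pi01 formula. The names 1 and 4 are those of the free
  variables 0 and 1.\<close>

lemma pfm_bfm:
  assumes "fsets \<phi> \<subseteq> \<S>" and "fsets \<psi> \<subseteq> \<S>" and "\<S> \<noteq> {}"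
  obtains E v \<phi>' \<psi>' where "range E \<subseteq> \<S>"
    "\<And>a b. bsat M E (v(4 := b, 1 := a)) \<phi>' \<longleftrightarrow> psat M (a ## b ## e) \<phi>"
    "\<And>a b. bsat M E (v(4 := b, 1 := a)) \<psi>' \<longleftrightarrow> psat M (a ## b ## e) \<psi>"
proof -
  let ?C = "fconsts \<phi> \<union> fconsts \<psi>" and ?S = "fsets \<phi> \<union> fsets \<psi>"
  have "finite ?C" "finite ?S"
    by (simp_all add: finite_fconsts finite_fsets)
  obtain ci :: "'a \<Rightarrow> nat" where ci: "inj_on ci ?C"
    using finite_imp_inj_to_nat_seg[OF \<open>finite ?C\<close>] by blast
  obtain si :: "'a set \<Rightarrow> nat" where si: "inj_on si ?S"
    using finite_imp_inj_to_nat_seg[OF \<open>finite ?S\<close>] by blast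
  obtain Z where "Z \<in> \<S>"
    using assms(3) by blast
  \<comment> \<open>\<open>Z\<close> fills the set variables that do not occur, since every value of
    \<open>E\<close> must belong to the given collection.\<close>
  define E where "E j = (if j \<in> si ` ?S then inv_into ?S si j else Z)" for j
  \<comment> \<open>The environment \<open>e\<close> starts at free variable 2, hence the shift by
    2.\<close>
  define v where "v i = (if i mod 3 = 2 then inv_into ?C ci (i div 3) else e (i div 3 - 2))" for i
  have E: "\<forall>X\<in>?S. E (si X) = X"
    using si by (simp add: E_def)
  have "range E \<subseteq> \<S>"
    using assms \<open>Z \<in> \<S>\<close> inv_into_into[of _ si ?S] unfolding E_def by auto
  have cv: "\<forall>c\<in>?C. (v(4 := b, 1 := a)) (3 * ci c + 2) = c" for a b
  proof
    fix c assume "c \<in> ?C"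
    moreover have "3 * ci c + 2 \<noteq> 4" "3 * ci c + 2 \<noteq> 1" "(3 * ci c + 2) mod 3 = 2"
      "(3 * ci c + 2) div 3 = ci c"
      by presburger+
    ultimately show "(v(4 := b, 1 := a)) (3 * ci c + 2) = c"
      using ci by (simp add: v_def)
  qed
  have ev: "(\<lambda>i. (v(4 := b, 1 := a)) (vname 0 i)) = a ## b ## e" for a b
  proof
    fix i :: nat
    have "(3 * k + 7) mod 3 \<noteq> 2" "(3 * k + 7) div 3 - 2 = k" for k :: nat
      by presburger+
    then show "(v(4 := b, 1 := a)) (vname 0 i) = (a ## b ## e) i"
      by (auto simp: vname_def v_def split: nat.split)
  qed
  have "bsat M E (v(4 := b, 1 := a)) (ftrans ci si 0 \<phi>) \<longleftrightarrow> psat M (a ## b ## e) \<phi>"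
    "bsat M E (v(4 := b, 1 := a)) (ftrans ci si 0 \<psi>) \<longleftrightarrow> psat M (a ## b ## e) \<psi>" for a b
    using bsat_ftrans[of _ "v(4 := b, 1 := a)" ci E si M 0] cv[of b a] E unfolding ev by auto
  with \<open>range E \<subseteq> \<S>\<close> show ?thesis
    by (rule that)
qed

section \<open>Renaming and substitution in formulas with parameters\<close>

primrec tren :: "(nat \<Rightarrow> nat) \<Rightarrow> 'a ptm \<Rightarrow> 'a ptm" where
  "tren f (PVar x) = PVar (f x)"
| "tren f (PConst c) = PConst c"
| "tren f (PAdd s t) = PAdd (tren f s) (tren f t)"
| "tren f (PMul s t) = PMul (tren f s) (tren f t)"

primrec tsub :: "(nat \<Rightarrow> 'a ptm) \<Rightarrow> 'a ptm \<Rightarrow> 'a ptm" where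
  "tsub \<sigma> (PVar x) = \<sigma> x"
| "tsub \<sigma> (PConst c) = PConst c"
| "tsub \<sigma> (PAdd s t) = PAdd (tsub \<sigma> s) (tsub \<sigma> t)"
| "tsub \<sigma> (PMul s t) = PMul (tsub \<sigma> s) (tsub \<sigma> t)"

primrec fsub :: "(nat \<Rightarrow> 'a ptm) \<Rightarrow> 'a pfm \<Rightarrow> 'a pfm" where
  "fsub \<sigma> (PEq s t) = PEq (tsub \<sigma> s) (tsub \<sigma> t)"
| "fsub \<sigma> (PLess s t) = PLess (tsub \<sigma> s) (tsub \<sigma> t)"
| "fsub \<sigma> (PMem t X) = PMem (tsub \<sigma> t) X"
| "fsub \<sigma> (PNeg \<phi>) = PNeg (fsub \<sigma> \<phi>)"
| "fsub \<sigma> (PAnd \<phi> \<psi>) = PAnd (fsub \<sigma> \<phi>) (fsub \<sigma> \<psi>)"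
| "fsub \<sigma> (PAll t \<phi>) = PAll (tsub \<sigma> t) (fsub (case_nat (PVar 0) (\<lambda>i. tren Suc (\<sigma> i))) \<phi>)"

lemma pval_tren: "pval M e (tren f t) = pval M (\<lambda>i. e (f i)) t"
  by (induction t) auto

lemma pval_tsub: "pval M e (tsub \<sigma> t) = pval M (\<lambda>i. pval M e (\<sigma> i)) t"
  by (induction t) auto

lemma psat_fsub: "psat M e (fsub \<sigma> \<phi>) \<longleftrightarrow> psat M (\<lambda>i. pval M e (\<sigma> i)) \<phi>"
proof (induction \<phi> arbitrary: e \<sigma>)
  case (PAll t \<phi>)
  have "(\<lambda>i. pval M (a ## e) (case_nat (PVar 0) (\<lambda>i. tren Suc (\<sigma> i)) i)) =
      a ## (\<lambda>i. pval M e (\<sigma> i))" for a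
    by (auto simp: pval_tren split: nat.split)
  with PAll show ?case
    by (simp add: pval_tsub)
qed (auto simp: pval_tsub)

lemma fsets_fsub [simp]: "fsets (fsub \<sigma> \<phi>) = fsets \<phi>"
  by (induction \<phi> arbitrary: \<sigma>) auto

section \<open>Bounded, Sigma01 and Delta01 relations of a model\<close>

locale rca =
  fixes M :: "'a l2_structure" (structure)
  assumes rca: "models_RCA0 M"
begin

text \<open>
  The arguments of a definable relation form an environment \<open>e\<close>. A quantified variable becomes
  argument \<open>0\<close>, hence the shift \<open>\<lambda>i. e (Suc i)\<close> in the premises of the closure rules.
\<close>

definition T0 :: "((nat \<Rightarrow> 'a) \<Rightarrow> 'a) \<Rightarrow> bool" where
  "T0 t \<longleftrightarrow> (\<exists>u. \<forall>e. t e = pval M e u)"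

definition D0 :: "((nat \<Rightarrow> 'a) \<Rightarrow> bool) \<Rightarrow> bool" where
  "D0 P \<longleftrightarrow> (\<exists>\<phi>. fsets \<phi> \<subseteq> Sets M \<and> (\<forall>e. P e \<longleftrightarrow> psat M e \<phi>))"

definition S1 :: "((nat \<Rightarrow> 'a) \<Rightarrow> bool) \<Rightarrow> bool" where
  "S1 P \<longleftrightarrow> (\<exists>Q. D0 Q \<and> (\<forall>e. P e \<longleftrightarrow> (\<exists>a. Q (a ## e))))"

definition D1 :: "((nat \<Rightarrow> 'a) \<Rightarrow> bool) \<Rightarrow> bool" where
  "D1 P \<longleftrightarrow> S1 P \<and> S1 (\<lambda>e. \<not> P e)"

text \<open>Functions given by a Sigma01 graph. By totality, both a relation and its negation at
  \<open>t e\<close> can be expressed by the existence of a value, so substituting such functions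
  preserves Delta01.\<close>

definition F1 :: "((nat \<Rightarrow> 'a) \<Rightarrow> 'a) \<Rightarrow> bool" where
  "F1 t \<longleftrightarrow> S1 (\<lambda>e. e 0 = t (\<lambda>i. e (Suc i)))"

lemma T0_var: "T0 (\<lambda>e. e i)"
  unfolding T0_def by (rule exI[of _ "PVar i"]) simp

lemma T0_const: "T0 (\<lambda>e. c)"
  unfolding T0_def by (rule exI[of _ "PConst c"]) simp

lemma T0_add:
  assumes "T0 s" and "T0 t"
  shows "T0 (\<lambda>e. s e \<oplus> t e)"
proof -
  obtain u v where "\<forall>e. s e = pval M e u" "\<forall>e. t e = pval M e v"
    using assms unfolding T0_def by blast
  then show ?thesis
    unfolding T0_def by (intro exI[of _ "PAdd u v"]) simp
qed

lemma T0_mul: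
  assumes "T0 s" and "T0 t"
  shows "T0 (\<lambda>e. s e \<otimes> t e)"
proof -
  obtain u v where "\<forall>e. s e = pval M e u" "\<forall>e. t e = pval M e v"
    using assms unfolding T0_def by blast
  then show ?thesis
    unfolding T0_def by (intro exI[of _ "PMul u v"]) simp
qed

lemma D0_eq:
  assumes "T0 s" and "T0 t"
  shows "D0 (\<lambda>e. s e = t e)"
proof -
  obtain u v where "\<forall>e. s e = pval M e u" "\<forall>e. t e = pval M e v"
    using assms unfolding T0_def by blast
  then show ?thesis
    unfolding D0_def by (intro exI[of _ "PEq u v"]) simp
qed

lemma D0_less:
  assumes "T0 s" and "T0 t"
  shows "D0 (\<lambda>e. s e \<prec> t e)"
proof -
  obtain u v where "\<forall>e. s e = pval M e u" "\<forall>e. t e = pval M e v"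
    using assms unfolding T0_def by blast
  then show ?thesis
    unfolding D0_def by (intro exI[of _ "PLess u v"]) simp
qed

lemma D0_mem:
  assumes "T0 t" and "X \<in> Sets M"
  shows "D0 (\<lambda>e. t e \<in> X)"
proof -
  obtain u where "\<forall>e. t e = pval M e u"
    using assms unfolding T0_def by blast
  with assms(2) show ?thesis
    unfolding D0_def by (intro exI[of _ "PMem u X"]) simp
qed

lemma D0_not:
  assumes "D0 P"
  shows "D0 (\<lambda>e. \<not> P e)"
proof -
  obtain \<phi> where "fsets \<phi> \<subseteq> Sets M" "\<forall>e. P e \<longleftrightarrow> psat M e \<phi>"
    using assms unfolding D0_def by blast
  then show ?thesis
    unfolding D0_def by (intro exI[of _ "PNeg \<phi>"]) simp
qed

lemma D0_and:
  assumes "D0 P" and "D0 Q"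
  shows "D0 (\<lambda>e. P e \<and> Q e)"
proof -
  obtain \<phi> \<psi> where "fsets \<phi> \<subseteq> Sets M" "\<forall>e. P e \<longleftrightarrow> psat M e \<phi>"
    "fsets \<psi> \<subseteq> Sets M" "\<forall>e. Q e \<longleftrightarrow> psat M e \<psi>"
    using assms unfolding D0_def by blast
  then show ?thesis
    unfolding D0_def by (intro exI[of _ "PAnd \<phi> \<psi>"]) simp
qed

lemma D0_or:
  assumes "D0 P" and "D0 Q"
  shows "D0 (\<lambda>e. P e \<or> Q e)"
proof -
  have "D0 (\<lambda>e. \<not> (\<not> P e \<and> \<not> Q e))"
    by (intro D0_not D0_and assms)
  then show ?thesis
    by simp
qed

lemma D0_imp:
  assumes "D0 P" and "D0 Q"
  shows "D0 (\<lambda>e. P e \<longrightarrow> Q e)"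
proof -
  have "D0 (\<lambda>e. \<not> P e \<or> Q e)"
    by (intro D0_not D0_or assms)
  then show ?thesis
    unfolding imp_conv_disj .
qed

lemma D0_ball:
  assumes "T0 t" and "D0 (\<lambda>e. P (\<lambda>i. e (Suc i)) (e 0))"
  shows "D0 (\<lambda>e. \<forall>a. a \<prec> t e \<longrightarrow> P e a)"
proof -
  obtain u \<phi> where "\<And>e. t e = pval M e u" "fsets \<phi> \<subseteq> Sets M"
    "\<And>e. P (\<lambda>i. e (Suc i)) (e 0) \<longleftrightarrow> psat M e \<phi>"
    using assms unfolding T0_def D0_def by blast
  note * = this
  have "P e a \<longleftrightarrow> psat M (a ## e) \<phi>" for a e
    using *(3)[of "a ## e"] by simp
  with * show ?thesis
    unfolding D0_def by (intro exI[of _ "PAll u \<phi>"]) auto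
qed

lemma D0_bex:
  assumes "T0 t" and "D0 (\<lambda>e. P (\<lambda>i. e (Suc i)) (e 0))"
  shows "D0 (\<lambda>e. \<exists>a. a \<prec> t e \<and> P e a)"
proof -
  have "D0 (\<lambda>e. \<not> (\<forall>a. a \<prec> t e \<longrightarrow> \<not> P e a))"
    by (intro D0_not D0_ball assms)
  then show ?thesis
    by simp
qed

lemma D0_subst:
  assumes "D0 P" and "\<And>i. T0 (\<sigma> i)"
  shows "D0 (\<lambda>e. P (\<lambda>i. \<sigma> i e))"
proof -
  obtain \<phi> where "fsets \<phi> \<subseteq> Sets M" "\<forall>e. P e \<longleftrightarrow> psat M e \<phi>"
    using assms(1) unfolding D0_def by blast
  moreover obtain u where "\<forall>i e. \<sigma> i e = pval M e (u i)"
    using assms(2) unfolding T0_def by metis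
  ultimately show ?thesis
    unfolding D0_def by (intro exI[of _ "fsub u \<phi>"]) (simp add: psat_fsub)
qed

lemma T0_subst:
  assumes "T0 t" and "\<And>i. T0 (\<sigma> i)"
  shows "T0 (\<lambda>e. t (\<lambda>i. \<sigma> i e))"
proof -
  obtain v where "\<forall>e. t e = pval M e v"
    using assms(1) unfolding T0_def by blast
  moreover obtain u where "\<forall>i e. \<sigma> i e = pval M e (u i)"
    using assms(2) unfolding T0_def by metis
  ultimately show ?thesis
    unfolding T0_def by (intro exI[of _ "tsub u v"]) (simp add: pval_tsub)
qed

lemma S1I: "D0 (\<lambda>e. Q (\<lambda>i. e (Suc i)) (e 0)) \<Longrightarrow> S1 (\<lambda>e. \<exists>a. Q e a)"
  unfolding S1_def by (rule exI, rule conjI, assumption) simp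

lemma S1E:
  assumes "S1 P"
  obtains Q where "D0 (\<lambda>e. Q (\<lambda>i. e (Suc i)) (e 0))" "P = (\<lambda>e. \<exists>a. Q e a)"
proof -
  obtain Q where Q: "D0 Q" "\<And>e. P e \<longleftrightarrow> (\<exists>a. Q (a ## e))"
    using assms unfolding S1_def by blast
  have eta: "e 0 ## (\<lambda>i. e (Suc i)) = e" for e :: "nat \<Rightarrow> 'a"
    by (auto split: nat.split)
  show ?thesis
  proof (rule that[of "\<lambda>e a. Q (a ## e)"])
    show "D0 (\<lambda>e. Q (e 0 ## (\<lambda>i. e (Suc i))))"
      unfolding eta by (rule Q(1))
    show "P = (\<lambda>e. \<exists>a. Q (a ## e))"
      by (rule ext) (rule Q(2))
  qed
qed

lemma S1_subst:
  assumes "S1 P" and "\<And>i. T0 (\<sigma> i)"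
  shows "S1 (\<lambda>e. P (\<lambda>i. \<sigma> i e))"
proof -
  obtain Q where Q: "D0 (\<lambda>e. Q (\<lambda>i. e (Suc i)) (e 0))" "P = (\<lambda>e. \<exists>a. Q e a)"
    using S1E[OF assms(1)] .
  let ?\<sigma> = "case_nat (\<lambda>e. e 0) (\<lambda>i e. \<sigma> i (\<lambda>j. e (Suc j)))"
  have "T0 (?\<sigma> i)" for i
    using T0_subst[OF assms(2), of "\<lambda>j e. e (Suc j)"] by (cases i) (auto intro: T0_var)
  from D0_subst[where \<sigma>="?\<sigma>", OF Q(1) this] show ?thesis
    unfolding Q(2) by (intro S1I) simp
qed

lemma S1_ren: "S1 P \<Longrightarrow> S1 (\<lambda>e. P (\<lambda>i. e (f i)))"
  using S1_subst[of P "\<lambda>i e. e (f i)"] T0_var by blast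

lemma D0_S1: "D0 P \<Longrightarrow> S1 P"
  using S1I[of "\<lambda>e a. P e"] D0_subst[of P "\<lambda>i e. e (Suc i)"] T0_var by simp

section \<open>Induction and comprehension for definable relations\<close>

lemma Sets_nonempty: "Sets M \<noteq> {}"
  using rca unfolding models_RCA0_def by blast

lemma induct_S1:
  assumes "S1 (\<lambda>e. P (e 0))" and "P \<zero>" and "\<And>n. P n \<Longrightarrow> P (n \<oplus> \<one>)"
  shows "P n"
proof -
  obtain Q where Q: "D0 (\<lambda>e. Q (\<lambda>i. e (Suc i)) (e 0))" "(\<lambda>e. P (e 0)) = (\<lambda>e. \<exists>a. Q e a)"
    using S1E[OF assms(1)] .
  obtain \<phi> where \<phi>: "fsets \<phi> \<subseteq> Sets M" "\<And>e. Q (\<lambda>i. e (Suc i)) (e 0) \<longleftrightarrow> psat M e \<phi>"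
    using Q(1) unfolding D0_def by blast
  \<comment> \<open>\<open>P\<close> looks at argument 0 only, so the rest of the environment may be
    \<open>undefined\<close>. Argument 0 becomes variable 4 and the witness becomes variable
    1.\<close>
  obtain E v \<phi>' where E: "range E \<subseteq> Sets M"
    "\<And>a b. bsat M E (v(4 := b, 1 := a)) \<phi>' \<longleftrightarrow> psat M (a ## b ## undefined) \<phi>"
    using pfm_bfm[OF \<phi>(1) \<phi>(1) Sets_nonempty] by metis
  have P: "P b \<longleftrightarrow> sigma_sat M E (v(4 := b)) 1 \<phi>'" for b
    using fun_cong[OF Q(2), of "b ## undefined"] \<phi>(2)[of "_ ## b ## undefined"] unfolding sigma_sat_def E(2) by simp
  have "sigma_induction M"
    using rca unfolding models_RCA0_def by blast
  then show ?thesis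
    using assms E(1) unfolding sigma_induction_def P by blast
qed

lemma comprehension:
  assumes "D1 (\<lambda>e. P (e 0))"
  shows "{n. P n} \<in> Sets M"
proof -
  obtain Q where Q: "D0 (\<lambda>e. Q (\<lambda>i. e (Suc i)) (e 0))" "(\<lambda>e. P (e 0)) = (\<lambda>e. \<exists>a. Q e a)"
    using assms S1E unfolding D1_def by blast
  obtain R where R: "D0 (\<lambda>e. R (\<lambda>i. e (Suc i)) (e 0))" "(\<lambda>e. \<not> P (e 0)) = (\<lambda>e. \<exists>a. R e a)"
    using assms S1E unfolding D1_def by blast
  obtain \<phi> where \<phi>: "fsets \<phi> \<subseteq> Sets M" "\<And>e. Q (\<lambda>i. e (Suc i)) (e 0) \<longleftrightarrow> psat M e \<phi>"
    using Q(1) unfolding D0_def by blast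
  \<comment> \<open>The Pi01 form of \<open>P\<close> arises by negating the matrix of its Sigma01
    complement.\<close>
  obtain \<psi> where \<psi>: "fsets \<psi> \<subseteq> Sets M" "\<And>e. \<not> R (\<lambda>i. e (Suc i)) (e 0) \<longleftrightarrow> psat M e \<psi>"
    using D0_not[OF R(1)] unfolding D0_def by blast
  obtain E v \<phi>' \<psi>' where E: "range E \<subseteq> Sets M"
    "\<And>a b. bsat M E (v(4 := b, 1 := a)) \<phi>' \<longleftrightarrow> psat M (a ## b ## undefined) \<phi>"
    "\<And>a b. bsat M E (v(4 := b, 1 := a)) \<psi>' \<longleftrightarrow> psat M (a ## b ## undefined) \<psi>"
    using pfm_bfm[OF \<phi>(1) \<psi>(1) Sets_nonempty] by metis
  have P: "P b \<longleftrightarrow> sigma_sat M E (v(4 := b)) 1 \<phi>'" for b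
    using fun_cong[OF Q(2), of "b ## undefined"] \<phi>(2)[of "_ ## b ## undefined"] unfolding sigma_sat_def E(2) by simp
  have "P b \<longleftrightarrow> pi_sat M E (v(4 := b)) 1 \<psi>'" for b
    using fun_cong[OF R(2), of "b ## undefined"] \<psi>(2)[of "_ ## b ## undefined"] unfolding pi_sat_def E(3) by auto
  then have eq: "\<forall>b. sigma_sat M E (v(4 := b)) 1 \<phi>' \<longleftrightarrow> pi_sat M E (v(4 := b)) 1 \<psi>'"
    using P by blast
  have "delta_comprehension M"
    using rca unfolding models_RCA0_def by blast
  then show ?thesis
    using eq E(1) unfolding delta_comprehension_def P by blast
qed

section \<open>Arithmetic in a model\<close>

lemmas T0_intros = T0_var T0_const T0_add T0_mul

lemma plus_zero: "m \<oplus> \<zero> = m"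
  and plus_Suc: "m \<oplus> (n \<oplus> \<one>) = (m \<oplus> n) \<oplus> \<one>"
  and times_zero: "m \<otimes> \<zero> = \<zero>"
  and times_Suc: "m \<otimes> (n \<oplus> \<one>) = m \<otimes> n \<oplus> m"
  and Suc_inject: "m \<oplus> \<one> = n \<oplus> \<one> \<Longrightarrow> m = n"
  and Suc_not_zero: "n \<oplus> \<one> \<noteq> \<zero>"
  and not_less_zero: "\<not> m \<prec> \<zero>"
  and less_Suc: "m \<prec> n \<oplus> \<one> \<longleftrightarrow> m \<prec> n \<or> m = n"
  using rca unfolding models_RCA0_def basic_axioms_def by blast+

lemma zero_plus: "\<zero> \<oplus> n = n"
  by (rule induct_S1[where P="\<lambda>n. \<zero> \<oplus> n = n"], intro D0_S1 D0_eq T0_intros) (simp_all add: plus_zero plus_Suc)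

lemma Suc_plus: "(m \<oplus> \<one>) \<oplus> n = (m \<oplus> n) \<oplus> \<one>"
  by (rule induct_S1[where P="\<lambda>n. (m \<oplus> \<one>) \<oplus> n = (m \<oplus> n) \<oplus> \<one>"], intro D0_S1 D0_eq T0_intros) (simp_all add: plus_zero plus_Suc)

lemma plus_commute: "m \<oplus> n = n \<oplus> m"
  by (rule induct_S1[where P="\<lambda>n. m \<oplus> n = n \<oplus> m"], intro D0_S1 D0_eq T0_intros) (simp_all add: plus_zero zero_plus plus_Suc Suc_plus)

lemma plus_assoc: "(k \<oplus> m) \<oplus> n = k \<oplus> (m \<oplus> n)"
  by (rule induct_S1[where P="\<lambda>n. (k \<oplus> m) \<oplus> n = k \<oplus> (m \<oplus> n)"], intro D0_S1 D0_eq T0_intros) (simp_all add: plus_zero plus_Suc)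

lemma plus_left_commute: "k \<oplus> (m \<oplus> n) = m \<oplus> (k \<oplus> n)"
  by (metis plus_assoc plus_commute)

lemma plus_cancel: "m \<oplus> k = n \<oplus> k \<Longrightarrow> m = n"
proof -
  have "m \<oplus> k = n \<oplus> k \<longrightarrow> m = n"
  proof (rule induct_S1[where P="\<lambda>k. m \<oplus> k = n \<oplus> k \<longrightarrow> m = n"])
    show "S1 (\<lambda>e. m \<oplus> e 0 = n \<oplus> e 0 \<longrightarrow> m = n)"
      by (intro D0_S1 D0_eq D0_imp T0_intros)
  qed (auto simp: plus_zero plus_Suc dest: Suc_inject)
  then show "m \<oplus> k = n \<oplus> k \<Longrightarrow> m = n"
    by blast
qed

lemma zero_times: "\<zero> \<otimes> n = \<zero>"
  by (rule induct_S1[where P="\<lambda>n. \<zero> \<otimes> n = \<zero>"], intro D0_S1 D0_eq T0_intros) (simp_all add: plus_zero times_zero times_Suc)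

lemma Suc_times: "(m \<oplus> \<one>) \<otimes> n = m \<otimes> n \<oplus> n"
proof (rule induct_S1[where P="\<lambda>n. (m \<oplus> \<one>) \<otimes> n = m \<otimes> n \<oplus> n"])
  show "S1 (\<lambda>e. (m \<oplus> \<one>) \<otimes> e 0 = m \<otimes> e 0 \<oplus> e 0)"
    by (intro D0_S1 D0_eq T0_intros)
  show "(m \<oplus> \<one>) \<otimes> (n \<oplus> \<one>) = m \<otimes> (n \<oplus> \<one>) \<oplus> (n \<oplus> \<one>)"
    if "(m \<oplus> \<one>) \<otimes> n = m \<otimes> n \<oplus> n" for n
    using that by (simp add: times_Suc) (metis plus_assoc plus_commute)
qed (simp add: plus_zero times_zero)

lemma times_commute: "m \<otimes> n = n \<otimes> m"
  by (rule induct_S1[where P="\<lambda>n. m \<otimes> n = n \<otimes> m"], intro D0_S1 D0_eq T0_intros) (simp_all add: times_zero zero_times times_Suc Suc_times)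

lemma plus_times: "(k \<oplus> m) \<otimes> n = k \<otimes> n \<oplus> m \<otimes> n"
proof (rule induct_S1[where P="\<lambda>n. (k \<oplus> m) \<otimes> n = k \<otimes> n \<oplus> m \<otimes> n"])
  show "S1 (\<lambda>e. (k \<oplus> m) \<otimes> e 0 = k \<otimes> e 0 \<oplus> m \<otimes> e 0)"
    by (intro D0_S1 D0_eq T0_intros)
  show "(k \<oplus> m) \<otimes> (n \<oplus> \<one>) = k \<otimes> (n \<oplus> \<one>) \<oplus> m \<otimes> (n \<oplus> \<one>)"
    if "(k \<oplus> m) \<otimes> n = k \<otimes> n \<oplus> m \<otimes> n" for n
    using that by (simp add: times_Suc) (metis plus_assoc plus_commute)
qed (simp add: plus_zero times_zero)

lemma times_assoc: "(k \<otimes> m) \<otimes> n = k \<otimes> (m \<otimes> n)"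
proof (rule induct_S1[where P="\<lambda>n. (k \<otimes> m) \<otimes> n = k \<otimes> (m \<otimes> n)"])
  show "S1 (\<lambda>e. (k \<otimes> m) \<otimes> e 0 = k \<otimes> (m \<otimes> e 0))"
    by (intro D0_S1 D0_eq T0_intros)
  show "(k \<otimes> m) \<otimes> (n \<oplus> \<one>) = k \<otimes> (m \<otimes> (n \<oplus> \<one>))"
    if "(k \<otimes> m) \<otimes> n = k \<otimes> (m \<otimes> n)" for n
    using that plus_times[of "m \<otimes> n" m k] times_commute by (simp add: times_Suc)
qed (simp add: times_zero)

text \<open>The axioms determine the order by recursion on its right argument. This additive form
  opens it to algebra; the difference is found by Sigma01 induction.\<close>

lemma less_iff: "x \<prec> y \<longleftrightarrow> (\<exists>z. x \<oplus> (z \<oplus> \<one>) = y)"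
proof
  have "x \<prec> y \<longrightarrow> (\<exists>z. x \<oplus> (z \<oplus> \<one>) = y)"
  proof (rule induct_S1[where P="\<lambda>y. x \<prec> y \<longrightarrow> (\<exists>z. x \<oplus> (z \<oplus> \<one>) = y)"])
    have "S1 (\<lambda>e. \<exists>z. x \<prec> e 0 \<longrightarrow> x \<oplus> (z \<oplus> \<one>) = e 0)"
      by (intro S1I D0_eq D0_less D0_imp T0_intros)
    then show "S1 (\<lambda>e. x \<prec> e 0 \<longrightarrow> (\<exists>z. x \<oplus> (z \<oplus> \<one>) = e 0))"
      by simp
    show "x \<prec> n \<oplus> \<one> \<longrightarrow> (\<exists>z. x \<oplus> (z \<oplus> \<one>) = n \<oplus> \<one>)"
      if "x \<prec> n \<longrightarrow> (\<exists>z. x \<oplus> (z \<oplus> \<one>) = n)" for n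
      using that by (metis less_Suc plus_Suc plus_zero)
  qed (simp add: not_less_zero)
  then show "x \<prec> y \<Longrightarrow> \<exists>z. x \<oplus> (z \<oplus> \<one>) = y"
    by blast
  have "x \<prec> x \<oplus> (z \<oplus> \<one>)" for z
  proof (rule induct_S1[where P="\<lambda>z. x \<prec> x \<oplus> (z \<oplus> \<one>)"])
    show "S1 (\<lambda>e. x \<prec> x \<oplus> (e 0 \<oplus> \<one>))"
      by (intro D0_S1 D0_less T0_intros)
  qed (simp_all add: zero_plus plus_zero plus_Suc less_Suc)
  then show "\<exists>z. x \<oplus> (z \<oplus> \<one>) = y \<Longrightarrow> x \<prec> y"
    by blast
qed

definition nle :: "'a \<Rightarrow> 'a \<Rightarrow> bool" (infix "\<preceq>" 50) where
  "x \<preceq> y \<longleftrightarrow> x \<prec> y \<or> x = y"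

definition nminus :: "'a \<Rightarrow> 'a \<Rightarrow> 'a" where
  "nminus x y = (if y \<preceq> x then THE z. z \<oplus> y = x else \<zero>)"

lemma zero_or_Suc: "x = \<zero> \<or> (\<exists>z. x = z \<oplus> \<one>)"
proof (rule induct_S1[where P="\<lambda>x. x = \<zero> \<or> (\<exists>z. x = z \<oplus> \<one>)"])
  have "S1 (\<lambda>e. \<exists>z. e 0 = \<zero> \<or> e 0 = z \<oplus> \<one>)"
    by (intro S1I D0_eq D0_or T0_intros)
  then show "S1 (\<lambda>e. e 0 = \<zero> \<or> (\<exists>z. e 0 = z \<oplus> \<one>))"
    by simp
qed auto

lemma nle_iff: "x \<preceq> y \<longleftrightarrow> (\<exists>z. z \<oplus> x = y)"
proof
  assume "\<exists>z. z \<oplus> x = y"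
  then obtain z where z: "z \<oplus> x = y"
    by blast
  then show "x \<preceq> y"
    using zero_or_Suc[of z] unfolding nle_def less_iff by (metis plus_commute plus_zero)
qed (metis nle_def less_iff plus_commute plus_zero)

lemma plus_eq_zero: "x \<oplus> y = \<zero> \<Longrightarrow> x = \<zero>"
  by (metis zero_or_Suc Suc_plus Suc_not_zero)

lemma nle_refl: "x \<preceq> x"
  by (simp add: nle_def)

lemma nle_trans: "x \<preceq> y \<Longrightarrow> y \<preceq> z \<Longrightarrow> x \<preceq> z"
  unfolding nle_iff by (metis plus_assoc)

lemma nle_antisym:
  assumes "x \<preceq> y" and "y \<preceq> x"
  shows "x = y"
proof -
  obtain a b where ab: "a \<oplus> x = y" "b \<oplus> y = x"
    using assms unfolding nle_iff by blast
  then have "(b \<oplus> a) \<oplus> x = \<zero> \<oplus> x"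
    by (simp add: plus_assoc zero_plus)
  then have "b \<oplus> a = \<zero>"
    by (rule plus_cancel)
  then have "b = \<zero>"
    by (rule plus_eq_zero)
  with ab show ?thesis
    by (simp add: zero_plus)
qed

lemma less_irrefl: "\<not> x \<prec> x"
proof
  assume "x \<prec> x"
  then obtain z where "x \<oplus> (z \<oplus> \<one>) = x"
    unfolding less_iff by blast
  then have "(z \<oplus> \<one>) \<oplus> x = \<zero> \<oplus> x"
    by (metis zero_plus plus_commute)
  then show False
    using plus_cancel Suc_not_zero by blast
qed

lemma nle_linear: "x \<preceq> y \<or> y \<preceq> x"
proof (rule induct_S1[where P="\<lambda>x. x \<preceq> y \<or> y \<preceq> x"])
  show "S1 (\<lambda>e. e 0 \<preceq> y \<or> y \<preceq> e 0)"
    unfolding nle_def by (intro D0_S1 D0_eq D0_less D0_or T0_intros)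
  show "\<zero> \<preceq> y \<or> y \<preceq> \<zero>"
    unfolding nle_iff using plus_zero by blast
  show "n \<oplus> \<one> \<preceq> y \<or> y \<preceq> n \<oplus> \<one>" if "n \<preceq> y \<or> y \<preceq> n" for n
  proof (cases "y \<preceq> n")
    case True
    then show ?thesis
      unfolding nle_iff by (metis Suc_plus plus_Suc plus_commute)
  next
    case False
    with that have "n \<prec> y"
      using nle_def nle_refl by blast
    then show ?thesis
      unfolding less_iff nle_iff by (metis plus_assoc plus_commute)
  qed
qed

lemma nle_plus: "x \<preceq> y \<Longrightarrow> z \<oplus> x \<preceq> z \<oplus> y"
  unfolding nle_iff by (metis plus_left_commute)

lemma nminus_eq: "nminus (z \<oplus> y) y = z"
  unfolding nminus_def using nle_iff plus_cancel by auto

lemma nless_nle: "x \<prec> y \<longleftrightarrow> x \<preceq> y \<and> \<not> y \<preceq> x"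
  using nle_antisym less_irrefl unfolding nle_def by blast

lemma times_less:
  assumes "x \<prec> y" and "\<zero> \<prec> z"
  shows "z \<otimes> x \<prec> z \<otimes> y"
proof -
  obtain a where a: "x \<oplus> (a \<oplus> \<one>) = y"
    using assms(1) unfolding less_iff by blast
  obtain b where b: "\<zero> \<oplus> (b \<oplus> \<one>) = z"
    using assms(2) unfolding less_iff by blast
  have "z \<otimes> y = z \<otimes> x \<oplus> z \<otimes> (a \<oplus> \<one>)"
    unfolding a[symmetric] times_commute[of z] plus_times ..
  also have "z \<otimes> (a \<oplus> \<one>) = (z \<otimes> a \<oplus> b) \<oplus> \<one>"
    unfolding times_Suc plus_assoc using b by (simp only: zero_plus)
  finally show ?thesis
    unfolding less_iff by metis
qed

lemma times_plus: "k \<otimes> (m \<oplus> n) = k \<otimes> m \<oplus> k \<otimes> n"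
  unfolding times_commute[of k] by (rule plus_times)

lemma times_nminus: "a \<otimes> nminus b c = nminus (a \<otimes> b) (a \<otimes> c)"
proof (cases "c \<preceq> b")
  case True
  then obtain z where z: "b = z \<oplus> c"
    unfolding nle_iff by metis
  show ?thesis
    unfolding z times_plus nminus_eq ..
next
  case False
  then have "b \<prec> c"
    using nle_linear nle_def by blast
  then have "\<not> a \<otimes> c \<preceq> a \<otimes> b \<or> a = \<zero>"
    using times_less[of b c a] nless_nle zero_or_Suc[of a] less_Suc
    by (metis nle_def nle_iff plus_zero)
  moreover have "nminus \<zero> \<zero> = \<zero>"
    using nminus_eq[of \<zero> \<zero>] by (simp add: zero_plus)
  ultimately show ?thesis
    using False by (auto simp: nminus_def zero_times times_zero)
qed

text \<open>Makes the library's theory of ordered semirings available for the possibly nonstandard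
  numbers of the model, under the prefix \<open>N\<close>.\<close>

sublocale N: linordered_semidom "(\<oplus>)" nminus "(\<preceq>)" "(\<prec>)" "\<zero>" "(\<otimes>)" "\<one>"
proof
  show "a \<oplus> b \<oplus> c = a \<oplus> (b \<oplus> c)" for a b c
    by (rule plus_assoc)
  show "a \<oplus> b = b \<oplus> a" for a b
    by (rule plus_commute)
  show "\<zero> \<oplus> a = a" for a
    by (rule zero_plus)
  show "a \<otimes> b \<otimes> c = a \<otimes> (b \<otimes> c)" for a b c
    by (rule times_assoc)
  show "a \<otimes> b = b \<otimes> a" for a b
    by (rule times_commute)
  show "(a \<oplus> b) \<otimes> c = a \<otimes> c \<oplus> b \<otimes> c" for a b c
    by (rule plus_times)
  show "\<zero> \<otimes> a = \<zero>" for a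
    by (rule zero_times)
  show "a \<otimes> \<zero> = \<zero>" for a
    by (rule times_zero)
  show "\<zero> \<noteq> \<one>"
    using Suc_not_zero[of \<zero>] zero_plus by metis
  show "\<one> \<otimes> a = a" for a
    using Suc_times[of \<zero> a] by (simp add: zero_plus zero_times)
  show "nminus (a \<oplus> b) a = b" for a b
    using nminus_eq plus_commute by metis
  show "nminus (nminus a b) c = nminus a (b \<oplus> c)" for a b c
  proof (cases "b \<oplus> c \<preceq> a")
    case True
    then obtain z where "a = (z \<oplus> c) \<oplus> b"
      unfolding nle_iff by (metis plus_assoc plus_commute)
    moreover then have "a = z \<oplus> (b \<oplus> c)"
      by (metis plus_assoc plus_commute)
    ultimately show ?thesis
      by (metis nminus_eq)
  next
    case False
    show ?thesis
    proof (cases "b \<preceq> a")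
      case True
      then obtain z where z: "a = z \<oplus> b"
        unfolding nle_iff by metis
      then have "\<not> c \<preceq> z"
        using False unfolding nle_iff by (metis plus_assoc plus_commute)
      with z False show ?thesis
        by (simp add: nminus_eq) (simp add: nminus_def)
    next
      case b: False
      have "nminus \<zero> c = \<zero>"
        unfolding nminus_def using plus_zero plus_eq_zero
        by (auto simp: nle_iff intro!: the_equality)
      with False b show ?thesis
        by (simp add: nminus_def)
    qed
  qed
  show "x \<prec> y \<longleftrightarrow> x \<preceq> y \<and> \<not> y \<preceq> x" for x y
    by (rule nless_nle)
  show "x \<preceq> x" for x
    by (rule nle_refl)
  show "x \<preceq> y \<Longrightarrow> y \<preceq> z \<Longrightarrow> x \<preceq> z" for x y z
    by (rule nle_trans)
  show "x \<preceq> y \<Longrightarrow> y \<preceq> x \<Longrightarrow> x = y" for x y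
    by (rule nle_antisym)
  show "x \<preceq> y \<Longrightarrow> z \<oplus> x \<preceq> z \<oplus> y" for x y z
    by (rule nle_plus)
  show "x \<preceq> y \<or> y \<preceq> x" for x y
    by (rule nle_linear)
  show "a \<prec> b \<Longrightarrow> \<zero> \<prec> c \<Longrightarrow> c \<otimes> a \<prec> c \<otimes> b" for a b c
    by (rule times_less)
  show "a \<otimes> nminus b c = nminus (a \<otimes> b) (a \<otimes> c)" for a b c
    by (rule times_nminus)
  show "a \<otimes> (b \<oplus> c) = a \<otimes> b \<oplus> a \<otimes> c" for a b c
    by (rule times_plus)
  show "a \<otimes> b \<noteq> \<zero>" if "a \<noteq> \<zero>" "b \<noteq> \<zero>" for a b
  proof -
    have pos: "\<zero> \<prec> x" if "x \<noteq> \<zero>" for x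
      using that nle_iff[of \<zero> x] plus_zero nle_def by metis
    show ?thesis
      using times_less[OF pos[OF that(2)] pos[OF that(1)]] less_irrefl times_zero by metis
  qed
  show "\<zero> \<prec> \<one>"
    using less_Suc[of \<zero> \<zero>] by (simp add: zero_plus)
  show "nminus a b \<oplus> b = a" if "b \<preceq> a" for a b
    using that nminus_eq unfolding nle_iff by metis
qed

section \<open>Closure properties of definable relations\<close>

lemma nle_Suc: "x \<preceq> y \<longleftrightarrow> x \<prec> y \<oplus> \<one>"
  by (simp add: nle_def less_Suc)

lemma le_plus1: "x \<preceq> x \<oplus> y"
  unfolding nle_iff using plus_commute by blast

lemma le_plus2: "x \<preceq> y \<oplus> x"
  unfolding nle_iff by blast

lemma less_plus1: "x \<prec> x \<oplus> y \<oplus> \<one>"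
  using le_plus1 by (simp add: nle_Suc)

lemma less_plus2: "y \<prec> x \<oplus> y \<oplus> \<one>"
  using le_plus2 by (simp add: nle_Suc)

lemma T0_cons: "T0 s \<Longrightarrow> (\<And>j. T0 (\<lambda>e. r e j)) \<Longrightarrow> T0 (\<lambda>e. (s e ## r e) i)"
  by (cases i) simp_all

lemma S1_D0: "D0 (\<lambda>e. Q (\<lambda>i. e (Suc i)) (e 0)) \<Longrightarrow> D0 (\<lambda>e. Q (\<lambda>i. e (Suc (Suc i))) (e 0))"
  using D0_subst[of "\<lambda>e. Q (\<lambda>i. e (Suc i)) (e 0)" "\<lambda>i e. e (case i of 0 \<Rightarrow> 0 | Suc j \<Rightarrow> Suc (Suc j))"]
  by (simp add: T0_var)

text \<open>A single unbounded quantifier has to serve two witnesses: it bounds both of them, and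
  the witnesses themselves become bounded quantifiers. The same device contracts two unbounded
  quantifiers in \<open>S1_ex\<close>.\<close>

lemma S1_and:
  assumes "S1 P" and "S1 Q"
  shows "S1 (\<lambda>e. P e \<and> Q e)"
proof -
  obtain P' where P: "D0 (\<lambda>e. P' (\<lambda>i. e (Suc i)) (e 0))" "P = (\<lambda>e. \<exists>a. P' e a)"
    using S1E[OF assms(1)] .
  obtain Q' where Q: "D0 (\<lambda>e. Q' (\<lambda>i. e (Suc i)) (e 0))" "Q = (\<lambda>e. \<exists>a. Q' e a)"
    using S1E[OF assms(2)] .
  have "S1 (\<lambda>e. \<exists>c. (\<exists>a. a \<prec> c \<and> P' e a) \<and> (\<exists>a. a \<prec> c \<and> Q' e a))"
    by (intro S1I D0_and D0_bex T0_var S1_D0[of P', OF P(1)] S1_D0[of Q', OF Q(1)])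
  also have "(\<lambda>e. \<exists>c. (\<exists>a. a \<prec> c \<and> P' e a) \<and> (\<exists>a. a \<prec> c \<and> Q' e a)) = (\<lambda>e. P e \<and> Q e)"
  proof -
    have "(\<exists>c. (\<exists>a. a \<prec> c \<and> P' e a) \<and> (\<exists>a. a \<prec> c \<and> Q' e a))" if "P' e a" "Q' e b" for e a b
      using that by (metis less_plus1 less_plus2)
    then show ?thesis
      unfolding P(2) Q(2) by fast
  qed
  finally show ?thesis .
qed

lemma S1_or:
  assumes "S1 P" and "S1 Q"
  shows "S1 (\<lambda>e. P e \<or> Q e)"
proof -
  obtain P' where P: "D0 (\<lambda>e. P' (\<lambda>i. e (Suc i)) (e 0))" "P = (\<lambda>e. \<exists>a. P' e a)"
    using S1E[OF assms(1)] .
  obtain Q' where Q: "D0 (\<lambda>e. Q' (\<lambda>i. e (Suc i)) (e 0))" "Q = (\<lambda>e. \<exists>a. Q' e a)"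
    using S1E[OF assms(2)] .
  have "S1 (\<lambda>e. \<exists>a. P' e a \<or> Q' e a)"
    by (intro S1I D0_or P Q)
  then show ?thesis
    unfolding P(2) Q(2) by (simp add: ex_disj_distrib)
qed

lemma S1_ex:
  assumes "S1 (\<lambda>e. P (\<lambda>i. e (Suc i)) (e 0))"
  shows "S1 (\<lambda>e. \<exists>a. P e a)"
proof -
  obtain Q where Q: "D0 (\<lambda>e. Q (\<lambda>i. e (Suc i)) (e 0))"
    "(\<lambda>e. P (\<lambda>i. e (Suc i)) (e 0)) = (\<lambda>e. \<exists>a. Q e a)"
    using S1E[OF assms] .
  have P: "P e a \<longleftrightarrow> (\<exists>b. Q (a ## e) b)" for e a
    using fun_cong[OF Q(2), of "a ## e"] by simp
  have D: "D0 (\<lambda>e. Q (e (Suc 0) ## (\<lambda>i. e (Suc (Suc (Suc i))))) (e 0))"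
    using D0_subst[where \<sigma>="\<lambda>i e. (e 0 ## e (Suc 0) ## (\<lambda>i. e (Suc (Suc (Suc i))))) i", OF Q(1)
      T0_cons[OF T0_var T0_cons[OF T0_var T0_var]]]
    by simp
  have "S1 (\<lambda>e. \<exists>c. \<exists>a. a \<prec> c \<and> (\<exists>b. b \<prec> c \<and> Q (a ## e) b))"
    by (intro S1I D0_bex T0_var D)
  also have "(\<lambda>e. \<exists>c. \<exists>a. a \<prec> c \<and> (\<exists>b. b \<prec> c \<and> Q (a ## e) b)) = (\<lambda>e. \<exists>a. P e a)"
  proof -
    have "(\<exists>c. \<exists>a. a \<prec> c \<and> (\<exists>b. b \<prec> c \<and> Q (a ## e) b))" if "Q (a ## e) b" for e a b
      using that by (metis less_plus1 less_plus2)
    then show ?thesis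
      unfolding P by fast
  qed
  finally show ?thesis .
qed

text \<open>Sigma01 induction on the part of \<open>t\<close> whose witnesses already have a common
  bound. The guard \<open>n \<preceq> t\<close> confines the induction to the range where witnesses
  are given.\<close>

lemma collection:
  assumes "D0 (\<lambda>e. Q (e (Suc 0)) (e 0))" and "\<And>a. a \<prec> t \<Longrightarrow> \<exists>b. Q a b"
  shows "\<exists>c. \<forall>a. a \<prec> t \<longrightarrow> (\<exists>b. b \<prec> c \<and> Q a b)"
proof -
  have "t \<preceq> t \<longrightarrow> (\<exists>c. \<forall>a. a \<prec> t \<longrightarrow> (\<exists>b. b \<prec> c \<and> Q a b))"
  proof (rule induct_S1[where P="\<lambda>n. n \<preceq> t \<longrightarrow> (\<exists>c. \<forall>a. a \<prec> n \<longrightarrow> (\<exists>b. b \<prec> c \<and> Q a b))"])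
    have "S1 (\<lambda>e. \<exists>c. e 0 \<preceq> t \<longrightarrow> (\<forall>a. a \<prec> e 0 \<longrightarrow> (\<exists>b. b \<prec> c \<and> Q a b)))"
      unfolding nle_def
      by (intro S1I D0_imp D0_or D0_eq D0_less D0_ball D0_bex T0_var T0_const assms(1))
    then show "S1 (\<lambda>e. e 0 \<preceq> t \<longrightarrow> (\<exists>c. \<forall>a. a \<prec> e 0 \<longrightarrow> (\<exists>b. b \<prec> c \<and> Q a b)))"
      by simp
    show "n \<oplus> \<one> \<preceq> t \<longrightarrow> (\<exists>c. \<forall>a. a \<prec> n \<oplus> \<one> \<longrightarrow> (\<exists>b. b \<prec> c \<and> Q a b))"
      if "n \<preceq> t \<longrightarrow> (\<exists>c. \<forall>a. a \<prec> n \<longrightarrow> (\<exists>b. b \<prec> c \<and> Q a b))" for n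
    proof
      assume "n \<oplus> \<one> \<preceq> t"
      then have n: "n \<prec> t"
        using less_Suc[of n n] N.less_le_trans by blast
      then have "n \<preceq> t"
        by (rule N.less_imp_le)
      with that obtain c where c: "\<forall>a. a \<prec> n \<longrightarrow> (\<exists>b. b \<prec> c \<and> Q a b)"
        by blast
      obtain b where b: "Q n b"
        using assms(2) n by blast
      have "\<exists>b'. b' \<prec> c \<oplus> b \<oplus> \<one> \<and> Q a b'" if "a \<prec> n \<oplus> \<one>" for a
      proof (cases "a = n")
        case True
        with b less_plus2 show ?thesis
          by blast
      next
        case False
        with that c obtain b' where "b' \<prec> c" "Q a b'"
          unfolding less_Suc by blast
        with less_plus1 show ?thesis
          using N.less_trans by blast
      qed
      then show "\<exists>c. \<forall>a. a \<prec> n \<oplus> \<one> \<longrightarrow> (\<exists>b. b \<prec> c \<and> Q a b)"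
        by blast
    qed
  qed (simp add: not_less_zero)
  then show ?thesis
    by (simp add: nle_refl)
qed

text \<open>Collection replaces the witnesses by a common bound, so the unbounded quantifier can be
  moved in front of the bounded one.\<close>

lemma S1_ball_T0:
  assumes "T0 t" and "S1 (\<lambda>e. P (\<lambda>i. e (Suc i)) (e 0))"
  shows "S1 (\<lambda>e. \<forall>a. a \<prec> t e \<longrightarrow> P e a)"
proof -
  obtain Q where Q: "D0 (\<lambda>e. Q (\<lambda>i. e (Suc i)) (e 0))"
    "(\<lambda>e. P (\<lambda>i. e (Suc i)) (e 0)) = (\<lambda>e. \<exists>a. Q e a)"
    using S1E[OF assms(2)] .
  have P: "P e a \<longleftrightarrow> (\<exists>b. Q (a ## e) b)" for e a
    using fun_cong[OF Q(2), of "a ## e"] by simp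
  have D: "D0 (\<lambda>e. Q (e (Suc 0) ## (\<lambda>i. e (Suc (Suc (Suc i))))) (e 0))"
    using D0_subst[where \<sigma>="\<lambda>i e. (e 0 ## e (Suc 0) ## (\<lambda>i. e (Suc (Suc (Suc i))))) i", OF Q(1)
      T0_cons[OF T0_var T0_cons[OF T0_var T0_var]]]
    by simp
  have "S1 (\<lambda>e. \<exists>c. \<forall>a. a \<prec> t e \<longrightarrow> (\<exists>b. b \<prec> c \<and> Q (a ## e) b))"
    by (intro S1I D0_ball D0_bex T0_var D T0_subst[OF assms(1), of "\<lambda>i e. e (Suc i)"])
  also have "(\<lambda>e. \<exists>c. \<forall>a. a \<prec> t e \<longrightarrow> (\<exists>b. b \<prec> c \<and> Q (a ## e) b)) = (\<lambda>e. \<forall>a. a \<prec> t e \<longrightarrow> P e a)"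
  proof
    fix e
    have "D0 (\<lambda>e'. Q (e' (Suc 0) ## e) (e' 0))"
      using D0_subst[where \<sigma>="\<lambda>i e'. (e' 0 ## e' (Suc 0) ## e) i", OF Q(1)
        T0_cons[OF T0_var T0_cons[OF T0_var T0_const]]]
      by simp
    from collection[where Q="\<lambda>a. Q (a ## e)", OF this, of "t e"]
    show "(\<exists>c. \<forall>a. a \<prec> t e \<longrightarrow> (\<exists>b. b \<prec> c \<and> Q (a ## e) b)) \<longleftrightarrow> (\<forall>a. a \<prec> t e \<longrightarrow> P e a)"
      unfolding P by blast
  qed
  finally show ?thesis .
qed

section \<open>Substitution of functions with Sigma01 graph, and closure of Delta01\<close>

lemma F1_T0:
  assumes "T0 t"
  shows "F1 t"
  unfolding F1_def
  by (intro D0_S1 D0_eq T0_var T0_subst[OF assms, of "\<lambda>i e. e (Suc i)"])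

lemma F1_ren: 
  assumes "F1 t"
  shows "F1 (\<lambda>e. t (\<lambda>i. e (f i)))"
  using S1_ren[OF assms[unfolded F1_def], of "\<lambda>i. case i of 0 \<Rightarrow> 0 | Suc j \<Rightarrow> Suc (f j)"]
  unfolding F1_def by simp

lemma S1_subst_F1:
  assumes "S1 (\<lambda>e. P (\<lambda>i. e (Suc i)) (e 0))" and "F1 t"
  shows "S1 (\<lambda>e. P e (t e))"
proof -
  have "S1 (\<lambda>e. \<exists>a. a = t e \<and> P e a)"
    by (intro S1_ex S1_and assms(1) assms(2)[unfolded F1_def])
  then show ?thesis
    by simp
qed

lemma S1_sub1:
  assumes "S1 (\<lambda>e. R (e 0))" and "F1 s"
  shows "S1 (\<lambda>e. R (s e))"
  by (rule S1_subst_F1[where P="\<lambda>e. R"]) (fact assms)+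

lemma S1_sub2:
  assumes "S1 (\<lambda>e. R (e 0) (e 1))" and "F1 s" and "F1 t"
  shows "S1 (\<lambda>e. R (s e) (t e))"
proof (rule S1_subst_F1[where t=s, OF _ assms(2)], rule S1_subst_F1[where t="\<lambda>e. t (\<lambda>i. e (Suc i))"])
  show "S1 (\<lambda>e. R (e (Suc 0)) (e 0))"
    using S1_ren[OF assms(1), of "\<lambda>i. 1 - i"] by simp
qed (rule F1_ren[OF assms(3)])

lemma S1_sub3:
  assumes "S1 (\<lambda>e. R (e 0) (e 1) (e 2))" and "F1 s" and "F1 t" and "F1 u"
  shows "S1 (\<lambda>e. R (s e) (t e) (u e))"
proof (rule S1_subst_F1[where t=s, OF _ assms(2)],
    rule S1_subst_F1[where t="\<lambda>e. t (\<lambda>i. e (Suc i))", OF _ F1_ren[OF assms(3)]],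
    rule S1_subst_F1[where t="\<lambda>e. u (\<lambda>i. e (Suc (Suc i)))", OF _ F1_ren[OF assms(4)]])
  show "S1 (\<lambda>e. R (e (Suc (Suc 0))) (e (Suc 0)) (e 0))"
    using S1_ren[OF assms(1), of "\<lambda>i. 2 - i"] by (simp add: numeral_2_eq_2)
qed

lemma D1_sub1: "D1 (\<lambda>e. R (e 0)) \<Longrightarrow> F1 s \<Longrightarrow> D1 (\<lambda>e. R (s e))"
  unfolding D1_def using S1_sub1[of R] S1_sub1[of "\<lambda>x. \<not> R x"] by blast

lemma D1_sub2: "D1 (\<lambda>e. R (e 0) (e 1)) \<Longrightarrow> F1 s \<Longrightarrow> F1 t \<Longrightarrow> D1 (\<lambda>e. R (s e) (t e))"
  unfolding D1_def using S1_sub2[of R] S1_sub2[of "\<lambda>x y. \<not> R x y"] by blast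

lemma F1_sub1:
  assumes "F1 (\<lambda>e. G (e 0))" and "F1 s"
  shows "F1 (\<lambda>e. G (s e))"
  unfolding F1_def
proof (rule S1_sub2[where R="\<lambda>y x. y = G x" and s="\<lambda>e. e 0"])
  show "S1 (\<lambda>e. e 0 = G (e 1))"
    using assms(1) unfolding F1_def by simp
qed (rule F1_T0[OF T0_var] F1_ren[OF assms(2)])+

lemma F1_sub2:
  assumes "F1 (\<lambda>e. G (e 0) (e 1))" and "F1 s" and "F1 t"
  shows "F1 (\<lambda>e. G (s e) (t e))"
  unfolding F1_def
proof (rule S1_sub3[where R="\<lambda>y x z. y = G x z" and s="\<lambda>e. e 0"])
  show "S1 (\<lambda>e. e 0 = G (e 1) (e 2))"
    using assms(1) unfolding F1_def by (simp add: numeral_2_eq_2)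
qed (rule F1_T0[OF T0_var] F1_ren[OF assms(2)] F1_ren[OF assms(3)])+

lemma F1_var: "F1 (\<lambda>e. e i)"
  by (intro F1_T0 T0_var)

lemma F1_const: "F1 (\<lambda>e. c)"
  by (intro F1_T0 T0_const)

lemma F1_plus: "F1 s \<Longrightarrow> F1 t \<Longrightarrow> F1 (\<lambda>e. s e \<oplus> t e)"
  by (rule F1_sub2[OF F1_T0]) (intro T0_add T0_var)

lemma F1_times: "F1 s \<Longrightarrow> F1 t \<Longrightarrow> F1 (\<lambda>e. s e \<otimes> t e)"
  by (rule F1_sub2[OF F1_T0]) (intro T0_mul T0_var)

lemma F1_pair: "F1 s \<Longrightarrow> F1 t \<Longrightarrow> F1 (\<lambda>e. pair M (s e) (t e))"
  unfolding pair_def by (intro F1_plus F1_times)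

lemma D1_D0: "D0 P \<Longrightarrow> D1 P"
  unfolding D1_def using D0_S1 D0_not by blast

lemma D1_S1: "D1 P \<Longrightarrow> S1 P"
  unfolding D1_def by blast

lemma D1I: "S1 P \<Longrightarrow> S1 (\<lambda>e. \<not> P e) \<Longrightarrow> D1 P"
  unfolding D1_def by blast

lemma D1_eq: "F1 s \<Longrightarrow> F1 t \<Longrightarrow> D1 (\<lambda>e. s e = t e)"
  by (rule D1_sub2[OF D1_D0]) (intro D0_eq T0_var)

lemma D1_less: "F1 s \<Longrightarrow> F1 t \<Longrightarrow> D1 (\<lambda>e. s e \<prec> t e)"
  by (rule D1_sub2[OF D1_D0]) (intro D0_less T0_var)

lemma D1_le: "F1 s \<Longrightarrow> F1 t \<Longrightarrow> D1 (\<lambda>e. s e \<preceq> t e)"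
  unfolding nle_Suc by (intro D1_less F1_plus F1_const)

lemma D1_mem: "X \<in> Sets M \<Longrightarrow> F1 t \<Longrightarrow> D1 (\<lambda>e. t e \<in> X)"
  by (rule D1_sub1[OF D1_D0]) (intro D0_mem T0_var)

lemma D1_not: "D1 P \<Longrightarrow> D1 (\<lambda>e. \<not> P e)"
  unfolding D1_def by simp

lemma D1_and: "D1 P \<Longrightarrow> D1 Q \<Longrightarrow> D1 (\<lambda>e. P e \<and> Q e)"
  unfolding D1_def de_Morgan_conj by (intro conjI S1_and S1_or; elim conjE; assumption)

lemma D1_or: "D1 P \<Longrightarrow> D1 Q \<Longrightarrow> D1 (\<lambda>e. P e \<or> Q e)"
  unfolding D1_def de_Morgan_disj by (intro conjI S1_and S1_or; elim conjE; assumption)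

lemma D1_imp: "D1 P \<Longrightarrow> D1 Q \<Longrightarrow> D1 (\<lambda>e. P e \<longrightarrow> Q e)"
  unfolding imp_conv_disj by (intro D1_or D1_not)

lemma D1_iff: "D1 P \<Longrightarrow> D1 Q \<Longrightarrow> D1 (\<lambda>e. P e \<longleftrightarrow> Q e)"
  unfolding iff_conv_conj_imp by (intro D1_and D1_imp)

lemma D1_const: "D1 (\<lambda>e. c)"
proof -
  have "D1 (\<lambda>e. \<zero> = \<zero>)" "D1 (\<lambda>e. \<zero> \<noteq> \<zero>)"
    by (intro D1_eq D1_not F1_const)+
  then show ?thesis
    by (cases c) simp_all
qed

lemma S1_bex_all:
  assumes "F1 t" and "S1 (\<lambda>e. P (\<lambda>i. e (Suc i)) (e 0))"
  shows "S1 (\<lambda>e. \<exists>a. a \<prec> t e \<and> P e a)"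
  by (intro S1_ex S1_and assms(2) D1_S1[OF D1_less] F1_var F1_ren[OF assms(1)])

lemma S1_ball:
  assumes "F1 t" and "S1 (\<lambda>e. P (\<lambda>i. e (Suc i)) (e 0))"
  shows "S1 (\<lambda>e. \<forall>a. a \<prec> t e \<longrightarrow> P e a)"
proof (rule S1_subst_F1[OF S1_ball_T0 assms(1)])
  show "S1 (\<lambda>e. P (\<lambda>i. e (Suc (Suc i))) (e 0))"
    using S1_ren[OF assms(2), of "\<lambda>i. case i of 0 \<Rightarrow> 0 | Suc j \<Rightarrow> Suc (Suc j)"] by simp
qed (rule T0_var)

lemma D1_ball:
  assumes "F1 t" and "D1 (\<lambda>e. P (\<lambda>i. e (Suc i)) (e 0))"
  shows "D1 (\<lambda>e. \<forall>a. a \<prec> t e \<longrightarrow> P e a)"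
  using S1_ball[OF assms(1), of P] S1_bex_all[OF assms(1), of "\<lambda>e a. \<not> P e a"] assms(2)
  unfolding D1_def by simp

lemma D1_bex:
  assumes "F1 t" and "D1 (\<lambda>e. P (\<lambda>i. e (Suc i)) (e 0))"
  shows "D1 (\<lambda>e. \<exists>a. a \<prec> t e \<and> P e a)"
  using S1_ball[OF assms(1), of "\<lambda>e a. \<not> P e a"] S1_bex_all[OF assms(1), of P] assms(2)
  unfolding D1_def by simp

lemma D1_ball_le:
  assumes "F1 t" and "D1 (\<lambda>e. P (\<lambda>i. e (Suc i)) (e 0))"
  shows "D1 (\<lambda>e. \<forall>a. a \<preceq> t e \<longrightarrow> P e a)"
  unfolding nle_Suc by (intro D1_ball F1_plus F1_const assms)

lemma D1_bex_le:
  assumes "F1 t" and "D1 (\<lambda>e. P (\<lambda>i. e (Suc i)) (e 0))"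
  shows "D1 (\<lambda>e. \<exists>a. a \<preceq> t e \<and> P e a)"
  unfolding nle_Suc by (intro D1_bex F1_plus F1_const assms)

lemma F1I:
  assumes "S1 (\<lambda>e. R (\<lambda>i. e (Suc i)) (e 0))" and "\<And>e y. y = t e \<longleftrightarrow> R e y"
  shows "F1 t"
  unfolding F1_def assms(2) by (rule assms(1))

lemma F1_if:
  assumes "D1 P" and "F1 s" and "F1 t"
  shows "F1 (\<lambda>e. if P e then s e else t e)"
proof (rule F1I)
  show "S1 (\<lambda>e. P (\<lambda>i. e (Suc i)) \<and> e 0 = s (\<lambda>i. e (Suc i)) \<or>
      \<not> P (\<lambda>i. e (Suc i)) \<and> e 0 = t (\<lambda>i. e (Suc i)))"
    using assms unfolding D1_def F1_def
    by (intro S1_or S1_and S1_ren[of P Suc] S1_ren[of "\<lambda>e. \<not> P e" Suc]) simp_all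
qed auto

lemmas D1_intros = D1_eq D1_less D1_le D1_mem D1_not D1_and D1_or D1_imp D1_iff
  D1_ball D1_bex D1_ball_le D1_bex_le

lemmas F1_intros = F1_var F1_const F1_plus F1_times F1_pair F1_if

section \<open>Induction and extremal elements for Delta01 relations\<close>

lemma induct_D1:
  assumes "D1 (\<lambda>e. P (e 0))" and "P \<zero>" and "\<And>n. P n \<Longrightarrow> P (n \<oplus> \<one>)"
  shows "P n"
  using induct_S1 assms unfolding D1_def by blast

lemma least_D1:
  assumes "D1 (\<lambda>e. P (e 0))" and "P n"
  obtains m where "P m" "\<And>k. k \<prec> m \<Longrightarrow> \<not> P k"
proof -
  have "\<exists>m. P m \<and> (\<forall>k. k \<prec> m \<longrightarrow> \<not> P k)"
  proof (rule ccontr)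
    assume no: "\<nexists>m. P m \<and> (\<forall>k. k \<prec> m \<longrightarrow> \<not> P k)"
    have "\<forall>k. k \<prec> n \<oplus> \<one> \<longrightarrow> \<not> P k"
    proof (rule induct_D1[where P="\<lambda>n. \<forall>k. k \<prec> n \<longrightarrow> \<not> P k"])
      show "D1 (\<lambda>e. \<forall>k. k \<prec> e 0 \<longrightarrow> \<not> P k)"
        by (intro D1_intros F1_intros assms)
      show "\<forall>k. k \<prec> n \<oplus> \<one> \<longrightarrow> \<not> P k" if "\<forall>k. k \<prec> n \<longrightarrow> \<not> P k" for n
        unfolding less_Suc using no that by blast
    qed (simp add: not_less_zero)
    with assms(2) show False
      by (simp add: less_Suc)
  qed
  with that show ?thesis
    by blast
qed

text \<open>The least upper bound is attained: otherwise its predecessor would be an upper bound as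
  well.\<close>

lemma greatest_D1:
  assumes "D1 (\<lambda>e. P (e 0))" and "P n" and "\<And>k. P k \<Longrightarrow> k \<prec> b"
  obtains m where "P m" "\<And>k. P k \<Longrightarrow> k \<preceq> m"
proof -
  have "D1 (\<lambda>e. \<forall>k. k \<prec> b \<longrightarrow> P k \<longrightarrow> k \<preceq> e 0)"
    by (intro D1_intros F1_intros assms)
  moreover have "\<forall>k. k \<prec> b \<longrightarrow> P k \<longrightarrow> k \<preceq> b"
    by (simp add: nle_def)
  ultimately obtain m where m: "\<forall>k. k \<prec> b \<longrightarrow> P k \<longrightarrow> k \<preceq> m"
    and least: "\<And>k. k \<prec> m \<Longrightarrow> \<not> (\<forall>j. j \<prec> b \<longrightarrow> P j \<longrightarrow> j \<preceq> k)"
    by (rule least_D1) blast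
  have "P m"
  proof (rule ccontr)
    assume "\<not> P m"
    with m have "\<forall>k. k \<prec> b \<longrightarrow> P k \<longrightarrow> k \<prec> m"
      unfolding nle_def by blast
    moreover then have "m \<noteq> \<zero>"
      using assms(2,3) not_less_zero by blast
    then obtain k where "m = k \<oplus> \<one>"
      using zero_or_Suc by blast
    ultimately have "\<forall>j. j \<prec> b \<longrightarrow> P j \<longrightarrow> j \<preceq> k"
      by (simp add: nle_Suc)
    moreover have "k \<prec> m"
      unfolding \<open>m = k \<oplus> \<one>\<close> less_Suc by simp
    ultimately show False
      using least by blast
  qed
  with m assms(3) that show ?thesis
    by blast
qed

section \<open>Coding of finite sets\<close>

text \<open>With sum \<open>s\<close>, the code lies between the square of \<open>s\<close> and that
  square plus \<open>s\<close>, which is below the square of \<open>s \<oplus> \<one>\<close>. Thus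
  codes are ordered by the sum first.\<close>

lemma pair_less:
  assumes "i \<oplus> j \<prec> k \<oplus> l"
  shows "pair M i j \<prec> pair M k l"
proof -
  let ?s = "i \<oplus> j" and ?t = "k \<oplus> l"
  have "?s \<otimes> ?s \<oplus> i \<preceq> ?s \<otimes> ?s \<oplus> ?s"
    by (rule nle_plus) (rule le_plus1)
  also have "?s \<otimes> ?s \<oplus> ?s = ?s \<otimes> (?s \<oplus> \<one>)"
    by (simp only: times_Suc)
  also have "?s \<otimes> (?s \<oplus> \<one>) \<preceq> ?s \<otimes> ?t"
  proof (rule N.mult_left_mono)
    show "?s \<oplus> \<one> \<preceq> ?t"
      using assms by (metis less_iff nle_iff N.add.assoc N.add.commute)
    show "\<zero> \<preceq> ?s"
      using le_plus1[of \<zero> ?s] by (simp only: zero_plus)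
  qed
  also have "?s \<otimes> ?t \<prec> ?t \<otimes> ?t"
  proof (rule N.mult_strict_right_mono[OF assms])
    show "\<zero> \<prec> ?t"
      using assms not_less_zero zero_or_Suc[of ?t] by (metis less_Suc nle_Suc nle_iff plus_zero)
  qed
  also have "?t \<otimes> ?t \<preceq> ?t \<otimes> ?t \<oplus> k"
    by (rule le_plus1)
  finally show ?thesis
    unfolding pair_def .
qed

lemma pair_inject: "pair M i j = pair M k l \<longleftrightarrow> i = k \<and> j = l"
proof
  assume eq: "pair M i j = pair M k l"
  then have "i \<oplus> j = k \<oplus> l"
    using pair_less[of i j k l] pair_less[of k l i j] N.less_irrefl N.less_linear by metis
  with eq have "i = k"
    unfolding pair_def by (metis plus_cancel plus_commute)
  with \<open>i \<oplus> j = k \<oplus> l\<close> show "i = k \<and> j = l"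
    by (metis plus_cancel plus_commute)
qed simp

lemma zero_le: "\<zero> \<preceq> x"
  using le_plus1[of \<zero> x] by (simp only: zero_plus)

lemma one_le: "x \<noteq> \<zero> \<Longrightarrow> \<one> \<preceq> x"
  using zero_or_Suc[of x] le_plus2 by auto

lemma pos_iff: "\<zero> \<prec> x \<longleftrightarrow> x \<noteq> \<zero>"
  using zero_le[of x] less_irrefl unfolding nle_def by metis

lemma le_times: "y \<noteq> \<zero> \<Longrightarrow> x \<preceq> y \<otimes> x"
  using N.mult_right_mono[OF one_le zero_le] by fastforce

lemma le_pair1: "i \<preceq> pair M i j"
  unfolding pair_def by (rule le_plus2)

lemma le_pair2: "j \<preceq> pair M i j"
proof -
  have "j \<preceq> i \<oplus> j"
    by (rule le_plus2)
  also have "i \<oplus> j \<preceq> (i \<oplus> j) \<otimes> (i \<oplus> j)"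
    using le_times[of "i \<oplus> j" "i \<oplus> j"] by (cases "i \<oplus> j = \<zero>") (simp_all add: nle_refl zero_le)
  also have "\<dots> \<preceq> pair M i j"
    unfolding pair_def by (rule le_plus1)
  finally show ?thesis .
qed

lemma pair_mono: "j \<preceq> l \<Longrightarrow> pair M i j \<preceq> pair M i l"
  using pair_less[of i j i l] by (auto simp: nle_def)

section \<open>Divisibility in the model\<close>

definition mdvd :: "'a \<Rightarrow> 'a \<Rightarrow> bool" where
  "mdvd a b \<longleftrightarrow> (\<exists>q. b = a \<otimes> q)"

text \<open>A bounded quotient makes divisibility Delta01. For \<open>a = \<zero>\<close> every
  quotient works, so zero is taken.\<close>

lemma mdvd_le: "mdvd a b \<longleftrightarrow> (\<exists>q. q \<preceq> b \<and> b = a \<otimes> q)"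
proof
  assume "mdvd a b"
  then obtain q where q: "b = a \<otimes> q"
    unfolding mdvd_def by blast
  show "\<exists>q. q \<preceq> b \<and> b = a \<otimes> q"
  proof (cases "a = \<zero>")
    case True
    with q show ?thesis
      by (intro exI[of _ \<zero>]) (simp add: zero_le)
  next
    case False
    with q le_times show ?thesis
      by blast
  qed
qed (auto simp: mdvd_def)

lemma D1_mdvd: "F1 s \<Longrightarrow> F1 t \<Longrightarrow> D1 (\<lambda>e. mdvd (s e) (t e))"
proof (rule D1_sub2)
  show "D1 (\<lambda>e. mdvd (e 0) (e 1))"
    unfolding mdvd_le by (intro D1_intros F1_intros)
qed

lemma mdvd_times: "mdvd a b \<Longrightarrow> mdvd a (b \<otimes> c)" "mdvd a b \<Longrightarrow> mdvd a (c \<otimes> b)"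
  unfolding mdvd_def using times_assoc times_commute by metis+

lemma mdvd_refl: "mdvd a a"
  unfolding mdvd_def by (rule exI[of _ \<one>]) simp

lemma mdvd_plus_cancel:
  assumes "mdvd a b" and "mdvd a (b \<oplus> c)"
  shows "mdvd a c"
proof -
  obtain q r where q: "b = a \<otimes> q" and r: "b \<oplus> c = a \<otimes> r"
    using assms unfolding mdvd_def by blast
  then have "a \<otimes> nminus r q = c"
    using nminus_eq[of c b] by (simp only: times_nminus plus_commute)
  then show ?thesis
    unfolding mdvd_def by blast
qed

text \<open>\<open>m\<close> is invertible modulo \<open>m \<otimes> k \<oplus> \<one>\<close>: the
  number \<open>z\<close> is the difference of
  \<open>(m \<otimes> k \<oplus> \<one>) \<otimes> z\<close> and
  \<open>k \<otimes> (m \<otimes> z)\<close>.\<close>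

lemma mdvd_cancel_coprime:
  assumes "mdvd (m \<otimes> k \<oplus> \<one>) (m \<otimes> z)"
  shows "mdvd (m \<otimes> k \<oplus> \<one>) z"
proof (rule mdvd_plus_cancel[where b="m \<otimes> k \<otimes> z"])
  show "mdvd (m \<otimes> k \<oplus> \<one>) (m \<otimes> k \<otimes> z)"
    using mdvd_times(2)[OF assms, of k] by (simp only: times_assoc times_commute N.mult.left_commute)
  show "mdvd (m \<otimes> k \<oplus> \<one>) (m \<otimes> k \<otimes> z \<oplus> z)"
    using mdvd_times(1)[OF mdvd_refl, of "m \<otimes> k \<oplus> \<one>" z] by (simp only: Suc_times)
qed

section \<open>Pairwise coprime moduli, as in Goedel's beta function\<close>

definition divisors_upto :: "'a \<Rightarrow> 'a \<Rightarrow> bool" where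
  "divisors_upto b m \<longleftrightarrow> (\<forall>i. i \<prec> b \<longrightarrow> mdvd (i \<oplus> \<one>) m)"

definition gmod :: "'a \<Rightarrow> 'a \<Rightarrow> 'a" where
  "gmod m i = m \<otimes> (i \<oplus> \<one>) \<oplus> \<one>"

text \<open>The moduli \<open>gmod m i\<close> for \<open>i < b\<close> are pairwise coprime, since their differences divide a power of \<open>m\<close>.\<close>

lemma gmod_coprime:
  assumes "divisors_upto b m" and "i \<prec> b" and "j \<prec> b" and "i \<noteq> j"
    and "mdvd (gmod m j) (gmod m i \<otimes> l)"
  shows "mdvd (gmod m j) l"
proof -
  have "\<exists>k. k \<prec> b \<and> mdvd (gmod m j) (m \<otimes> (k \<oplus> \<one>) \<otimes> l)"
  proof (cases "i \<prec> j")
    case True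
    then obtain k where k: "j = i \<oplus> (k \<oplus> \<one>)"
      unfolding less_iff by blast
    then have "k \<prec> b"
      using \<open>j \<prec> b\<close> N.le_less_trans[OF le_plus2[of k "i \<oplus> \<one>"]] by (simp only: N.add.commute N.add.left_commute N.add.assoc)
    have "gmod m j = gmod m i \<oplus> m \<otimes> (k \<oplus> \<one>)"
      unfolding gmod_def k times_plus by (simp only: N.add.commute N.add.left_commute N.add.assoc)
    then have "gmod m j \<otimes> l = gmod m i \<otimes> l \<oplus> m \<otimes> (k \<oplus> \<one>) \<otimes> l"
      by (simp only: plus_times)
    with assms(5) mdvd_plus_cancel mdvd_times(1)[OF mdvd_refl] have "mdvd (gmod m j) (m \<otimes> (k \<oplus> \<one>) \<otimes> l)"
      by metis
    with \<open>k \<prec> b\<close> show ?thesis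
      by blast
  next
    case False
    with \<open>i \<noteq> j\<close> obtain k where k: "i = j \<oplus> (k \<oplus> \<one>)"
      using N.less_linear unfolding less_iff by metis
    then have "k \<prec> b"
      using \<open>i \<prec> b\<close> N.le_less_trans[OF le_plus2[of k "j \<oplus> \<one>"]] by (simp only: N.add.commute N.add.left_commute N.add.assoc)
    have "gmod m i = gmod m j \<oplus> m \<otimes> (k \<oplus> \<one>)"
      unfolding gmod_def k times_plus by (simp only: N.add.commute N.add.left_commute N.add.assoc)
    then have "gmod m i \<otimes> l = gmod m j \<otimes> l \<oplus> m \<otimes> (k \<oplus> \<one>) \<otimes> l"
      by (simp only: plus_times)
    with assms(5) mdvd_plus_cancel mdvd_times(1)[OF mdvd_refl] have "mdvd (gmod m j) (m \<otimes> (k \<oplus> \<one>) \<otimes> l)"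
      by metis
    with \<open>k \<prec> b\<close> show ?thesis
      by blast
  qed
  then obtain k where "k \<prec> b" and k: "mdvd (gmod m j) (m \<otimes> (k \<oplus> \<one>) \<otimes> l)"
    by blast
  then obtain r where r: "m = (k \<oplus> \<one>) \<otimes> r"
    using assms(1) unfolding divisors_upto_def mdvd_def by blast
  have "r \<otimes> (m \<otimes> (k \<oplus> \<one>) \<otimes> l) = m \<otimes> (((k \<oplus> \<one>) \<otimes> r) \<otimes> l)"
    by (simp only: N.mult.commute N.mult.left_commute N.mult.assoc)
  then have "r \<otimes> (m \<otimes> (k \<oplus> \<one>) \<otimes> l) = m \<otimes> (m \<otimes> l)"
    by (simp only: r[symmetric])
  then show ?thesis
    using mdvd_times(2)[OF k, of r] mdvd_cancel_coprime unfolding gmod_def by metis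
qed

definition gproduct :: "'a \<Rightarrow> 'a \<Rightarrow> 'a \<Rightarrow> bool" where
  "gproduct b m n \<longleftrightarrow> (\<forall>i. i \<prec> b \<longrightarrow> mdvd (gmod m i) n)"

text \<open>A stand-in for the factorial, built by Sigma01 induction. It has to be nonzero because
  everything divides zero.\<close>

lemma ex_divisors_upto: "\<exists>m. m \<noteq> \<zero> \<and> divisors_upto b m"
proof (rule induct_S1[where P="\<lambda>b. \<exists>m. m \<noteq> \<zero> \<and> divisors_upto b m"])
  show "S1 (\<lambda>e. \<exists>m. m \<noteq> \<zero> \<and> divisors_upto (e 0) m)"
    unfolding divisors_upto_def by (intro S1_ex D1_S1 D1_intros D1_mdvd F1_intros)
  show "\<exists>m. m \<noteq> \<zero> \<and> divisors_upto \<zero> m"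
    using Suc_not_zero by (auto simp: divisors_upto_def not_less_zero)
  show "\<exists>m. m \<noteq> \<zero> \<and> divisors_upto (n \<oplus> \<one>) m" if ih: "\<exists>m. m \<noteq> \<zero> \<and> divisors_upto n m" for n
  proof -
    obtain m where m: "m \<noteq> \<zero>" "divisors_upto n m"
      using ih by blast
    then have "divisors_upto (n \<oplus> \<one>) (m \<otimes> (n \<oplus> \<one>))"
      using mdvd_refl mdvd_times unfolding divisors_upto_def less_Suc by blast
    with m(1) Suc_not_zero show ?thesis
      using N.mult_eq_0_iff by blast
  qed
qed

lemma ex_gproduct: "\<exists>n. n \<noteq> \<zero> \<and> gproduct b m n"
proof (rule induct_S1[where P="\<lambda>b. \<exists>n. n \<noteq> \<zero> \<and> gproduct b m n"])
  show "S1 (\<lambda>e. \<exists>n. n \<noteq> \<zero> \<and> gproduct (e 0) m n)"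
    unfolding gproduct_def gmod_def by (intro S1_ex D1_S1 D1_intros D1_mdvd F1_intros)
  show "\<exists>n. n \<noteq> \<zero> \<and> gproduct \<zero> m n"
    using Suc_not_zero by (auto simp: gproduct_def not_less_zero)
  show "\<exists>k. k \<noteq> \<zero> \<and> gproduct (n \<oplus> \<one>) m k" if ih: "\<exists>k. k \<noteq> \<zero> \<and> gproduct n m k" for n
  proof -
    obtain k where k: "k \<noteq> \<zero>" "gproduct n m k"
      using ih by blast
    then have "gproduct (n \<oplus> \<one>) m (k \<otimes> gmod m n)"
      using mdvd_refl mdvd_times unfolding gproduct_def less_Suc by blast
    moreover have "gmod m n \<noteq> \<zero>"
      unfolding gmod_def by (rule Suc_not_zero)
    ultimately show ?thesis
      using k(1) N.mult_eq_0_iff by blast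
  qed
qed

lemma elts_pair: "elts M (pair M b (pair M m n)) = {i. i \<prec> b \<and> mdvd (gmod m i) n}"
  unfolding elts_def mdvd_def gmod_def pair_inject by auto

text \<open>\<open>l\<close> is the least nonzero common multiple of the moduli with index in
  \<open>S\<close>. If a further modulus divided \<open>l\<close>, then by coprimality the quotient
  would be a smaller common multiple.\<close>

lemma ex_lcm:
  assumes "S \<in> Sets M" and "m \<noteq> \<zero>" and "divisors_upto b m" and "n \<noteq> \<zero>" and "gproduct b m n"
  shows "\<exists>l. l \<preceq> n \<and> (\<forall>i. i \<prec> b \<longrightarrow> (mdvd (gmod m i) l \<longleftrightarrow> i \<in> S))"
proof -
  let ?P = "\<lambda>l. l \<noteq> \<zero> \<and> (\<forall>i. i \<prec> b \<longrightarrow> i \<in> S \<longrightarrow> mdvd (gmod m i) l)"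
  have "D1 (\<lambda>e. ?P (e 0))"
    unfolding gmod_def by (intro D1_intros D1_mdvd F1_intros assms)
  moreover have "?P n"
    using assms(4,5) unfolding gproduct_def by blast
  ultimately obtain l where l: "?P l" and least: "\<And>k. k \<prec> l \<Longrightarrow> \<not> ?P k"
    by (rule least_D1) blast
  have "l \<preceq> n"
    using least[of n] \<open>?P n\<close> N.not_less by blast
  moreover have "i \<in> S" if i: "i \<prec> b" "mdvd (gmod m i) l" for i
  proof (rule ccontr)
    assume "i \<notin> S"
    obtain l' where l': "l = gmod m i \<otimes> l'"
      using i(2) unfolding mdvd_def by blast
    then have "l' \<noteq> \<zero>"
      using l times_zero by metis
    have "m \<otimes> (i \<oplus> \<one>) \<noteq> \<zero>"
      using N.mult_eq_0_iff assms(2) Suc_not_zero by metis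
    then have "m \<otimes> (i \<oplus> \<one>) \<otimes> l' \<noteq> \<zero>"
      using N.mult_eq_0_iff \<open>l' \<noteq> \<zero>\<close> by metis
    moreover have "l = l' \<oplus> m \<otimes> (i \<oplus> \<one>) \<otimes> l'"
      unfolding l' gmod_def Suc_times by (rule plus_commute)
    ultimately have "l' \<prec> l"
      by (metis less_iff zero_or_Suc)
    moreover have "mdvd (gmod m j) l'" if "j \<prec> b" "j \<in> S" for j
      using that \<open>i \<notin> S\<close> l i(1) assms(3) gmod_coprime[of b m i j l'] unfolding l' by blast
    ultimately show False
      using least \<open>l' \<noteq> \<zero>\<close> by blast
  qed
  ultimately show ?thesis
    using l by blast
qed

text \<open>Such a \<open>c\<close> bounds a code of every subset of the numbers below
  \<open>b\<close>: with \<open>m\<close> fixed, subsets are obtained by replacing \<open>n\<close>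
  by a number that is at most \<open>n\<close>. This takes the place of an exponential bound and is
  itself a Delta01 condition.\<close>

definition code_bound :: "'a \<Rightarrow> 'a \<Rightarrow> bool" where
  "code_bound b c \<longleftrightarrow> (\<exists>m. m \<preceq> c \<and> (\<exists>n. n \<preceq> c \<and> c = pair M b (pair M m n) \<and> m \<noteq> \<zero> \<and> n \<noteq> \<zero> \<and>
     divisors_upto b m \<and> gproduct b m n))"

lemma D1_code_bound: "F1 s \<Longrightarrow> F1 t \<Longrightarrow> D1 (\<lambda>e. code_bound (s e) (t e))"
proof (rule D1_sub2)
  show "D1 (\<lambda>e. code_bound (e 0) (e 1))"
    unfolding code_bound_def divisors_upto_def gproduct_def gmod_def
    by (intro D1_intros D1_mdvd F1_intros)
qed

lemma ex_code_bound: "\<exists>c. code_bound b c"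
proof -
  obtain m where "m \<noteq> \<zero>" "divisors_upto b m"
    using ex_divisors_upto by blast
  moreover obtain n where "n \<noteq> \<zero>" "gproduct b m n"
    using ex_gproduct by blast
  moreover have "m \<preceq> pair M b (pair M m n)" "n \<preceq> pair M b (pair M m n)"
    using le_pair1 le_pair2 N.order_trans by blast+
  ultimately show ?thesis
    unfolding code_bound_def by blast
qed

lemma ex_code_le:
  assumes "S \<in> Sets M" and "\<And>x. x \<in> S \<Longrightarrow> x \<prec> b" and "code_bound b c"
  shows "\<exists>d. d \<preceq> c \<and> elts M d = S"
proof -
  obtain m n where c: "c = pair M b (pair M m n)" "m \<noteq> \<zero>" "n \<noteq> \<zero>" "divisors_upto b m" "gproduct b m n"
    using assms(3) unfolding code_bound_def by blast
  obtain l where "l \<preceq> n" "\<forall>i. i \<prec> b \<longrightarrow> (mdvd (gmod m i) l \<longleftrightarrow> i \<in> S)"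
    using ex_lcm[OF assms(1) c(2,4,3,5)] by blast
  then show ?thesis
    using assms(2) unfolding c(1) by (intro exI[of _ "pair M b (pair M m l)"]) (auto simp: elts_pair pair_mono)
qed

section \<open>Definability of finite codes\<close>

lemma in_elts_iff:
  "x \<in> elts M c \<longleftrightarrow> (\<exists>k. k \<preceq> c \<and> (\<exists>m. m \<preceq> c \<and> (\<exists>n. n \<preceq> c \<and> c = pair M k (pair M m n) \<and>
     x \<prec> k \<and> mdvd (gmod m x) n)))"
proof -
  have "k \<preceq> pair M k (pair M m n)" "m \<preceq> pair M k (pair M m n)" "n \<preceq> pair M k (pair M m n)" for k m n
    using le_pair1 le_pair2 N.order_trans by blast+
  then show ?thesis
    unfolding elts_def mdvd_def gmod_def by blast
qed

lemma D1_elts: "F1 s \<Longrightarrow> F1 t \<Longrightarrow> D1 (\<lambda>e. s e \<in> elts M (t e))"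
proof (rule D1_sub2[where R="\<lambda>x c. x \<in> elts M c"])
  show "D1 (\<lambda>e. e 0 \<in> elts M (e 1))"
    unfolding in_elts_iff gmod_def by (intro D1_intros D1_mdvd F1_intros)
qed

lemma elts_less: "x \<in> elts M c \<Longrightarrow> x \<prec> c"
  unfolding in_elts_iff using N.less_le_trans by blast

lemma elts_Sets: "elts M c \<in> Sets M"
  using comprehension[of "\<lambda>x. x \<in> elts M c"] D1_elts[OF F1_var F1_const] by simp

lemma D1_ball_elts:
  assumes "F1 t" and "D1 (\<lambda>e. P (\<lambda>i. e (Suc i)) (e 0))"
  shows "D1 (\<lambda>e. \<forall>x\<in>elts M (t e). P e x)"
proof -
  have "D1 (\<lambda>e. \<forall>x. x \<prec> t e \<longrightarrow> x \<in> elts M (t e) \<longrightarrow> P e x)"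
    by (intro D1_intros D1_elts F1_var F1_ren[OF assms(1)] assms)
  also have "(\<lambda>e. \<forall>x. x \<prec> t e \<longrightarrow> x \<in> elts M (t e) \<longrightarrow> P e x) = (\<lambda>e. \<forall>x\<in>elts M (t e). P e x)"
    using elts_less by blast
  finally show ?thesis .
qed

lemma D1_bex_elts:
  assumes "F1 t" and "D1 (\<lambda>e. P (\<lambda>i. e (Suc i)) (e 0))"
  shows "D1 (\<lambda>e. \<exists>x\<in>elts M (t e). P e x)"
proof -
  have "D1 (\<lambda>e. \<not> (\<forall>x\<in>elts M (t e). \<not> P e x))"
    by (intro D1_not D1_ball_elts assms)
  then show ?thesis
    by simp
qed

lemma D1_elts_subset: "F1 s \<Longrightarrow> F1 t \<Longrightarrow> D1 (\<lambda>e. elts M (s e) \<subseteq> elts M (t e))"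
  by (rule D1_sub2[where R="\<lambda>c d. elts M c \<subseteq> elts M d"])
    (unfold subset_eq, intro D1_ball_elts D1_elts F1_intros)

lemma D1_elts_eq: "F1 s \<Longrightarrow> F1 t \<Longrightarrow> D1 (\<lambda>e. elts M (s e) = elts M (t e))"
  unfolding set_eq_subset by (intro D1_and D1_elts_subset)

lemma D1_fincode: "F1 s \<Longrightarrow> D1 (\<lambda>e. is_fincode M (s e))"
proof (rule D1_sub1)
  show "D1 (\<lambda>e. is_fincode M (e 0))"
    unfolding is_fincode_def by (intro D1_intros D1_elts_eq F1_intros)
qed

section \<open>Canonical codes and bounded quantification over finite sets\<close>

definition Fin :: "'a set \<Rightarrow> bool" where
  "Fin S \<longleftrightarrow> S \<in> Sets M \<and> (\<exists>b. \<forall>x\<in>S. x \<prec> b)"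

lemma Fin_elts: "Fin (elts M c)"
  unfolding Fin_def using elts_Sets elts_less by blast

lemma fincode_unique:
  "is_fincode M c \<Longrightarrow> is_fincode M d \<Longrightarrow> elts M c = elts M d \<Longrightarrow> c = d"
  unfolding is_fincode_def using N.less_linear by metis

lemma ex_fincode:
  assumes "Fin S"
  shows "\<exists>c. is_fincode M c \<and> elts M c = S"
proof -
  obtain b where b: "S \<in> Sets M" "\<And>x. x \<in> S \<Longrightarrow> x \<prec> b"
    using assms unfolding Fin_def by blast
  obtain c where "elts M c = S"
    using ex_code_le[OF b] ex_code_bound by blast
  moreover have "D1 (\<lambda>e. elts M (e 0) = elts M c)"
    by (intro D1_elts_eq F1_intros)
  ultimately obtain d where "elts M d = S" "\<And>k. k \<prec> d \<Longrightarrow> elts M k \<noteq> S"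
    using least_D1[of "\<lambda>d. elts M d = elts M c" c] by metis
  then show ?thesis
    unfolding is_fincode_def by metis
qed

definition code :: "'a set \<Rightarrow> 'a" where
  "code S = (THE c. is_fincode M c \<and> elts M c = S)"

lemma code_props: 
  assumes "Fin S"
  shows "is_fincode M (code S)" "elts M (code S) = S"
proof -
  have "\<exists>!c. is_fincode M c \<and> elts M c = S"
    using ex_fincode[OF assms] fincode_unique by blast
  from theI'[OF this] show "is_fincode M (code S)" "elts M (code S) = S"
    unfolding code_def by auto
qed

lemma fincode_le_bound:
  assumes "is_fincode M u" and "\<forall>x\<in>elts M u. x \<prec> b" and "code_bound b c"
  shows "u \<preceq> c"
proof -
  obtain d where "d \<preceq> c" "elts M d = elts M u"
    using ex_code_le[OF elts_Sets _ assms(3), of u] assms(2) by blast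
  moreover then have "u \<preceq> d"
    using assms(1) N.not_less unfolding is_fincode_def by blast
  ultimately show ?thesis
    using N.order_trans by blast
qed

text \<open>The complement is Sigma01 as well: there is a code bound up to which every candidate
  fails. Hence quantification over the finite subsets of an initial segment behaves like a bounded
  quantifier.\<close>

lemma D1_bex_fin:
  assumes "F1 t" and "D1 (\<lambda>e. P (\<lambda>i. e (Suc i)) (e 0))"
  shows "D1 (\<lambda>e. \<exists>u. is_fincode M u \<and> (\<forall>x\<in>elts M u. x \<prec> t e) \<and> P e u)"
proof (rule D1I)
  let ?R = "\<lambda>e u. is_fincode M u \<and> (\<forall>x\<in>elts M u. x \<prec> t e) \<and> P e u"
  have R: "D1 (\<lambda>e. ?R (\<lambda>i. e (Suc i)) (e 0))"
    by (intro D1_intros D1_fincode D1_ball_elts F1_var F1_ren[OF assms(1)] assms)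
  then show "S1 (\<lambda>e. \<exists>u. ?R e u)"
    by (intro S1_ex D1_S1)
  have R': "S1 (\<lambda>e. \<not> ?R (\<lambda>i. e (Suc (Suc i))) (e 0))"
    using S1_ren[OF D1_S1[OF D1_not[OF R]], of "\<lambda>i. case i of 0 \<Rightarrow> 0 | Suc j \<Rightarrow> Suc (Suc j)"]
    by simp
  have "S1 (\<lambda>e. \<exists>c. code_bound (t e) c \<and> (\<forall>u. u \<prec> c \<oplus> \<one> \<longrightarrow> \<not> ?R e u))"
    by (rule S1_ex, rule S1_and, intro D1_S1 D1_code_bound F1_ren[OF assms(1)] F1_var,
        rule S1_ball, intro F1_intros, rule R')
  also have "(\<lambda>e. \<exists>c. code_bound (t e) c \<and> (\<forall>u. u \<prec> c \<oplus> \<one> \<longrightarrow> \<not> ?R e u)) = (\<lambda>e. \<not> (\<exists>u. ?R e u))"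
  proof
    fix e
    obtain c where "code_bound (t e) c"
      using ex_code_bound by blast
    then show "(\<exists>c. code_bound (t e) c \<and> (\<forall>u. u \<prec> c \<oplus> \<one> \<longrightarrow> \<not> ?R e u)) \<longleftrightarrow> \<not> (\<exists>u. ?R e u)"
      using fincode_le_bound unfolding nle_Suc by blast
  qed
  finally show "S1 (\<lambda>e. \<not> (\<exists>u. ?R e u))" .
qed

lemmas D1_code_intros = D1_intros D1_elts D1_ball_elts D1_bex_elts D1_elts_subset D1_elts_eq D1_fincode D1_bex_fin

section \<open>Counting the elements of a set below a number\<close>

definition cnt_step :: "'a set \<Rightarrow> 'a \<Rightarrow> 'a \<Rightarrow> 'a" where
  "cnt_step S z c = (if z \<in> S then c \<oplus> \<one> else c)"

text \<open>A coded computation: every pair in it is the starting pair or is justified by a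
  predecessor that also belongs to it. Membership of one pair thus forces the whole chain below it,
  and this certifies the value.\<close>

definition cnt_graph :: "'a set \<Rightarrow> 'a \<Rightarrow> bool" where
  "cnt_graph S p \<longleftrightarrow> (\<forall>z. z \<prec> p \<longrightarrow> (\<forall>c. c \<prec> p \<longrightarrow> pair M z c \<in> elts M p \<longrightarrow> z = \<zero> \<and> c = \<zero> \<or>
     (\<exists>z'. z' \<prec> p \<and> (\<exists>c'. c' \<prec> p \<and> z = z' \<oplus> \<one> \<and> pair M z' c' \<in> elts M p \<and> c = cnt_step S z' c'))))"

definition cnt :: "'a set \<Rightarrow> 'a \<Rightarrow> 'a" where
  "cnt S x = (THE c. \<exists>p. cnt_graph S p \<and> pair M x c \<in> elts M p)"

lemma pair_elts_less: "pair M x c \<in> elts M p \<Longrightarrow> x \<prec> p \<and> c \<prec> p"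
  using elts_less N.le_less_trans le_pair1 le_pair2 by metis

lemma cnt_graph_unique:
  assumes "cnt_graph S p" and "cnt_graph S q"
  shows "pair M x c \<in> elts M p \<Longrightarrow> pair M x d \<in> elts M q \<Longrightarrow> c = d"
proof -
  \<comment> \<open>The bounds \<open>p\<close> and \<open>q\<close> on the values keep the
    induction formula Delta01.\<close>
  have "\<forall>c. c \<prec> p \<longrightarrow> (\<forall>d. d \<prec> q \<longrightarrow> pair M x c \<in> elts M p \<longrightarrow> pair M x d \<in> elts M q \<longrightarrow> c = d)"
  proof (rule induct_D1[where P="\<lambda>x. \<forall>c. c \<prec> p \<longrightarrow> (\<forall>d. d \<prec> q \<longrightarrow>
      pair M x c \<in> elts M p \<longrightarrow> pair M x d \<in> elts M q \<longrightarrow> c = d)"])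
    show "D1 (\<lambda>e. \<forall>c. c \<prec> p \<longrightarrow> (\<forall>d. d \<prec> q \<longrightarrow>
        pair M (e 0) c \<in> elts M p \<longrightarrow> pair M (e 0) d \<in> elts M q \<longrightarrow> c = d))"
      by (intro D1_code_intros F1_intros)
    show "\<forall>c. c \<prec> p \<longrightarrow> (\<forall>d. d \<prec> q \<longrightarrow> pair M \<zero> c \<in> elts M p \<longrightarrow> pair M \<zero> d \<in> elts M q \<longrightarrow> c = d)"
      using assms Suc_not_zero pair_elts_less unfolding cnt_graph_def by metis
    fix n
    assume ih: "\<forall>c. c \<prec> p \<longrightarrow> (\<forall>d. d \<prec> q \<longrightarrow> pair M n c \<in> elts M p \<longrightarrow> pair M n d \<in> elts M q \<longrightarrow> c = d)"
    show "\<forall>c. c \<prec> p \<longrightarrow> (\<forall>d. d \<prec> q \<longrightarrow>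
        pair M (n \<oplus> \<one>) c \<in> elts M p \<longrightarrow> pair M (n \<oplus> \<one>) d \<in> elts M q \<longrightarrow> c = d)"
    proof (intro allI impI)
      fix c d
      assume c: "pair M (n \<oplus> \<one>) c \<in> elts M p" and d: "pair M (n \<oplus> \<one>) d \<in> elts M q"
      obtain c' where "pair M n c' \<in> elts M p" "c = cnt_step S n c'"
        using assms(1) c pair_elts_less[OF c] Suc_not_zero Suc_inject unfolding cnt_graph_def by metis
      moreover obtain d' where "pair M n d' \<in> elts M q" "d = cnt_step S n d'"
        using assms(2) d pair_elts_less[OF d] Suc_not_zero Suc_inject unfolding cnt_graph_def by metis
      ultimately show "c = d"
        using ih pair_elts_less by metis
    qed
  qed
  then show "pair M x c \<in> elts M p \<Longrightarrow> pair M x d \<in> elts M q \<Longrightarrow> c = d"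
    using pair_elts_less by blast
qed

lemma D1_cnt_graph:
  assumes "S \<in> Sets M" and "F1 t"
  shows "D1 (\<lambda>e. cnt_graph S (t e))"
proof (rule D1_sub1[OF _ assms(2)])
  show "D1 (\<lambda>e. cnt_graph S (e 0))"
    unfolding cnt_graph_def cnt_step_def by (intro D1_code_intros F1_intros assms)
qed

lemma D1_cnt_graph_elts:
  assumes "F1 s" and "F1 t"
  shows "D1 (\<lambda>e. cnt_graph (elts M (s e)) (t e))"
proof (rule D1_sub2[where R="\<lambda>s. cnt_graph (elts M s)", OF _ assms])
  show "D1 (\<lambda>e. cnt_graph (elts M (e 0)) (e 1))"
    unfolding cnt_graph_def cnt_step_def by (intro D1_code_intros F1_intros)
qed

lemma Fin_insert: "Fin (insert a (elts M c))"
proof -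
  have "{x. x = a \<or> x \<in> elts M c} \<in> Sets M"
    by (intro comprehension D1_code_intros F1_intros)
  moreover have "{x. x = a \<or> x \<in> elts M c} = insert a (elts M c)"
    by blast
  moreover have "\<forall>x\<in>insert a (elts M c). x \<prec> a \<oplus> c \<oplus> \<one>"
    using less_plus1 less_plus2 elts_less N.less_trans by blast
  ultimately show ?thesis
    unfolding Fin_def by auto
qed

lemma cnt_graph_iff:
  "cnt_graph S p \<longleftrightarrow> (\<forall>z c. pair M z c \<in> elts M p \<longrightarrow> z = \<zero> \<and> c = \<zero> \<or>
     (\<exists>z' c'. z = z' \<oplus> \<one> \<and> pair M z' c' \<in> elts M p \<and> c = cnt_step S z' c'))"
  unfolding cnt_graph_def using pair_elts_less by meson

lemma elts_zero: "elts M \<zero> = {}"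
  using elts_less not_less_zero by blast

lemma cnt_graph_zero: "\<exists>p. cnt_graph S p \<and> pair M \<zero> \<zero> \<in> elts M p"
proof -
  obtain p where "elts M p = {pair M \<zero> \<zero>}"
    using ex_fincode[OF Fin_insert[of "pair M \<zero> \<zero>" \<zero>]] unfolding elts_zero by blast
  then have "cnt_graph S p \<and> pair M \<zero> \<zero> \<in> elts M p"
    unfolding cnt_graph_iff by (simp add: pair_inject)
  then show ?thesis
    by blast
qed

lemma cnt_graph_Suc:
  assumes "cnt_graph S p" and "pair M n c \<in> elts M p"
  shows "\<exists>q. cnt_graph S q \<and> pair M (n \<oplus> \<one>) (cnt_step S n c) \<in> elts M q"
proof -
  obtain q where q: "elts M q = insert (pair M (n \<oplus> \<one>) (cnt_step S n c)) (elts M p)"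
    using ex_fincode[OF Fin_insert] by blast
  have "cnt_graph S q"
    using assms unfolding cnt_graph_iff q by (fastforce simp: pair_inject)
  with q show ?thesis
    by blast
qed

lemma cnt_eqI: "cnt_graph S p \<Longrightarrow> pair M x c \<in> elts M p \<Longrightarrow> cnt S x = c"
  unfolding cnt_def using cnt_graph_unique by blast

lemma ex_cnt_graph:
  assumes "S \<in> Sets M"
  shows "\<exists>p. cnt_graph S p \<and> pair M x (cnt S x) \<in> elts M p"
proof -
  have "\<exists>c p. cnt_graph S p \<and> pair M x c \<in> elts M p"
  proof (rule induct_S1[where P="\<lambda>x. \<exists>c p. cnt_graph S p \<and> pair M x c \<in> elts M p"])
    show "S1 (\<lambda>e. \<exists>c p. cnt_graph S p \<and> pair M (e 0) c \<in> elts M p)"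
      by (intro S1_ex D1_S1 D1_code_intros D1_cnt_graph F1_intros assms)
  qed (use cnt_graph_zero cnt_graph_Suc in blast)+
  then show ?thesis
    using cnt_eqI by metis
qed

lemma cnt_iff:
  assumes "S \<in> Sets M"
  shows "c = cnt S x \<longleftrightarrow> (\<exists>p. cnt_graph S p \<and> pair M x c \<in> elts M p)"
  using ex_cnt_graph[OF assms] cnt_eqI by metis

lemma F1_cnt:
  assumes "S \<in> Sets M" and "F1 t"
  shows "F1 (\<lambda>e. cnt S (t e))"
proof (rule F1_sub1[OF _ assms(2)], rule F1I[where R="\<lambda>e c. \<exists>p. cnt_graph S p \<and> pair M (e 0) c \<in> elts M p"])
  show "S1 (\<lambda>e. \<exists>p. cnt_graph S p \<and> pair M (e (Suc 0)) (e 0) \<in> elts M p)"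
    by (intro S1_ex D1_S1 D1_code_intros D1_cnt_graph F1_intros assms)
qed (rule cnt_iff[OF assms(1)])

lemma F1_cnt_elts:
  assumes "F1 s" and "F1 t"
  shows "F1 (\<lambda>e. cnt (elts M (s e)) (t e))"
proof (rule F1_sub2[where G="\<lambda>s. cnt (elts M s)", OF _ assms],
    rule F1I[where R="\<lambda>e c. \<exists>p. cnt_graph (elts M (e 0)) p \<and> pair M (e 1) c \<in> elts M p"])
  show "S1 (\<lambda>e. \<exists>p. cnt_graph (elts M (e (Suc 0))) p \<and> pair M (e (Suc 1)) (e 0) \<in> elts M p)"
    by (intro S1_ex D1_S1 D1_code_intros D1_cnt_graph_elts F1_intros)
qed (rule cnt_iff[OF elts_Sets])

lemma cnt_zero: "cnt S \<zero> = \<zero>"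
  using cnt_graph_zero cnt_eqI by blast

lemma cnt_Suc: "S \<in> Sets M \<Longrightarrow> cnt S (x \<oplus> \<one>) = (if x \<in> S then cnt S x \<oplus> \<one> else cnt S x)"
proof -
  assume "S \<in> Sets M"
  then obtain p where "cnt_graph S p" "pair M x (cnt S x) \<in> elts M p"
    using ex_cnt_graph by blast
  then obtain q where "cnt_graph S q" "pair M (x \<oplus> \<one>) (cnt_step S x (cnt S x)) \<in> elts M q"
    using cnt_graph_Suc by blast
  then show ?thesis
    unfolding cnt_step_def[symmetric] by (rule cnt_eqI)
qed

lemma cnt_le:
  assumes "S \<in> Sets M"
  shows "cnt S x \<preceq> x"
proof (rule induct_D1[where P="\<lambda>x. cnt S x \<preceq> x"])
  show "D1 (\<lambda>e. cnt S (e 0) \<preceq> e 0)"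
    by (intro D1_intros F1_cnt F1_intros assms)
  show "cnt S (n \<oplus> \<one>) \<preceq> n \<oplus> \<one>" if "cnt S n \<preceq> n" for n
    using N.add_right_mono[OF that] N.order_trans[OF that le_plus1] by (simp add: cnt_Suc[OF assms])
qed (simp add: cnt_zero)

lemma cnt_mono:
  assumes "S \<in> Sets M" and "x \<preceq> y"
  shows "cnt S x \<preceq> cnt S y"
proof -
  obtain z where z: "y = x \<oplus> z"
    using assms(2) nle_iff plus_commute by metis
  have "cnt S x \<preceq> cnt S (x \<oplus> z)"
  proof (rule induct_D1[where P="\<lambda>z. cnt S x \<preceq> cnt S (x \<oplus> z)"])
    show "D1 (\<lambda>e. cnt S x \<preceq> cnt S (x \<oplus> e 0))"
      by (intro D1_intros F1_cnt F1_intros assms)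
    show "cnt S x \<preceq> cnt S (x \<oplus> (n \<oplus> \<one>))" if "cnt S x \<preceq> cnt S (x \<oplus> n)" for n
      using that N.order_trans[OF that le_plus1] by (simp add: plus_Suc cnt_Suc[OF assms(1)])
  qed simp
  then show ?thesis
    unfolding z .
qed

lemma cnt_less:
  assumes "S \<in> Sets M" and "z \<in> S" and "z \<prec> x"
  shows "cnt S z \<prec> cnt S x"
proof -
  have "z \<oplus> \<one> \<preceq> x"
    using assms(3) by (metis less_iff nle_iff N.add.assoc N.add.commute)
  from cnt_mono[OF assms(1) this] show ?thesis
    using assms(2) cnt_Suc[OF assms(1)] less_Suc N.less_le_trans by metis
qed

lemma cnt_subset:
  assumes "S \<in> Sets M" and "T \<in> Sets M" and "\<And>z. z \<prec> x \<Longrightarrow> z \<in> S \<Longrightarrow> z \<in> T"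
  shows "cnt S x \<preceq> cnt T x"
proof -
  \<comment> \<open>The trivial premise is the guard of the induction at its last step; it is there
    because inclusion is assumed below \<open>x\<close> only.\<close>
  have "x \<preceq> x \<longrightarrow> cnt S x \<preceq> cnt T x"
  proof (rule induct_D1[where P="\<lambda>y. y \<preceq> x \<longrightarrow> cnt S y \<preceq> cnt T y"])
    show "D1 (\<lambda>e. e 0 \<preceq> x \<longrightarrow> cnt S (e 0) \<preceq> cnt T (e 0))"
      by (intro D1_intros F1_cnt F1_intros assms)
    show "n \<oplus> \<one> \<preceq> x \<longrightarrow> cnt S (n \<oplus> \<one>) \<preceq> cnt T (n \<oplus> \<one>)" if "n \<preceq> x \<longrightarrow> cnt S n \<preceq> cnt T n" for n
    proof
      assume "n \<oplus> \<one> \<preceq> x"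
      then have "n \<prec> x"
        using less_Suc[of n n] N.less_le_trans by blast
      with that assms(3) have "cnt S n \<preceq> cnt T n" "n \<in> S \<Longrightarrow> n \<in> T"
        by (auto simp: nle_def)
      then show "cnt S (n \<oplus> \<one>) \<preceq> cnt T (n \<oplus> \<one>)"
        using N.add_right_mono[of "cnt S n"] N.order_trans[OF _ le_plus1, of "cnt S n"]
        by (simp add: cnt_Suc[OF assms(1)] cnt_Suc[OF assms(2)])
    qed
  qed (simp add: cnt_zero)
  then show ?thesis
    by (simp add: nle_refl)
qed

lemma cnt_cong:
  assumes "S \<in> Sets M" and "T \<in> Sets M" and "\<And>z. z \<prec> x \<Longrightarrow> z \<in> S \<longleftrightarrow> z \<in> T"
  shows "cnt S x = cnt T x"
  using cnt_subset[OF assms(1,2)] cnt_subset[OF assms(2,1)] assms(3) by (metis nle_antisym)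

lemma cnt_psubset:
  assumes "S \<in> Sets M" and "T \<in> Sets M" and "S \<subseteq> T" and "w \<in> T" and "w \<notin> S" and "w \<prec> x"
  shows "cnt S x \<prec> cnt T x"
proof -
  have "w \<prec> x \<longrightarrow> cnt S x \<prec> cnt T x"
  proof (rule induct_D1[where P="\<lambda>x. w \<prec> x \<longrightarrow> cnt S x \<prec> cnt T x"])
    show "D1 (\<lambda>e. w \<prec> e 0 \<longrightarrow> cnt S (e 0) \<prec> cnt T (e 0))"
      by (intro D1_intros F1_cnt F1_intros assms)
    show "w \<prec> n \<oplus> \<one> \<longrightarrow> cnt S (n \<oplus> \<one>) \<prec> cnt T (n \<oplus> \<one>)" if ih: "w \<prec> n \<longrightarrow> cnt S n \<prec> cnt T n" for n
    proof
      assume "w \<prec> n \<oplus> \<one>"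
      then consider "w \<prec> n" | "w = n"
        unfolding less_Suc by blast
      then show "cnt S (n \<oplus> \<one>) \<prec> cnt T (n \<oplus> \<one>)"
      proof cases
        case 1
        with ih have "cnt S n \<prec> cnt T n"
          by blast
        moreover have "n \<in> T" if "n \<in> S"
          using that assms(3) by blast
        ultimately show ?thesis
          using N.add_strict_right_mono[of "cnt S n" "cnt T n" \<one>]
          by (simp add: cnt_Suc[OF assms(1)] cnt_Suc[OF assms(2)] less_Suc)
      next
        case 2
        then show ?thesis
          using assms(3-5) cnt_subset[OF assms(1,2), of n]
          by (auto simp add: cnt_Suc[OF assms(1)] cnt_Suc[OF assms(2)] nle_Suc)
      qed
    qed
  qed (simp add: not_less_zero)
  with assms(6) show ?thesis
    by blast
qed

text \<open>The index of an element is the number of smaller elements, so indices start at zero. The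
  step that raises the count above \<open>j\<close> supplies the element.\<close>

lemma ex_index:
  assumes "S \<in> Sets M" and "j \<prec> cnt S x"
  shows "\<exists>z. z \<prec> x \<and> z \<in> S \<and> cnt S z = j"
proof -
  have "j \<prec> cnt S x \<longrightarrow> (\<exists>z. z \<prec> x \<and> z \<in> S \<and> cnt S z = j)"
  proof (rule induct_D1[where P="\<lambda>x. j \<prec> cnt S x \<longrightarrow> (\<exists>z. z \<prec> x \<and> z \<in> S \<and> cnt S z = j)"])
    show "D1 (\<lambda>e. j \<prec> cnt S (e 0) \<longrightarrow> (\<exists>z. z \<prec> e 0 \<and> z \<in> S \<and> cnt S z = j))"
      by (intro D1_intros F1_cnt F1_intros assms)
    show "j \<prec> cnt S (n \<oplus> \<one>) \<longrightarrow> (\<exists>z. z \<prec> n \<oplus> \<one> \<and> z \<in> S \<and> cnt S z = j)"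
      if "j \<prec> cnt S n \<longrightarrow> (\<exists>z. z \<prec> n \<and> z \<in> S \<and> cnt S z = j)" for n
      using that unfolding cnt_Suc[OF assms(1)] less_Suc by (auto simp: less_Suc split: if_splits)
  qed (simp add: cnt_zero not_less_zero)
  with assms(2) show ?thesis
    by blast
qed

section \<open>Consecutive elements\<close>

definition consec :: "'a set \<Rightarrow> 'a \<Rightarrow> 'a \<Rightarrow> bool" where
  "consec S x y \<longleftrightarrow> x \<in> S \<and> y \<in> S \<and> x \<prec> y \<and> (\<forall>w. w \<prec> y \<longrightarrow> x \<prec> w \<longrightarrow> w \<notin> S)"

lemma cnt_consec:
  assumes "S \<in> Sets M" and "consec S x y"
  shows "cnt S y = cnt S x \<oplus> \<one>"
proof (rule nle_antisym)
  have "cnt S x \<prec> cnt S y"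
    using assms cnt_less unfolding consec_def by blast
  then show "cnt S x \<oplus> \<one> \<preceq> cnt S y"
    by (metis less_iff nle_iff N.add.assoc N.add.commute)
  show "cnt S y \<preceq> cnt S x \<oplus> \<one>"
  proof (rule ccontr)
    assume "\<not> ?thesis"
    then have "cnt S x \<oplus> \<one> \<prec> cnt S y"
      using N.not_less by blast
    then obtain z where z: "z \<prec> y" "z \<in> S" "cnt S z = cnt S x \<oplus> \<one>"
      using ex_index[OF assms(1)] by blast
    then have "\<not> z \<preceq> x"
      using cnt_mono[OF assms(1), of z x] less_Suc[of "cnt S x" "cnt S x"] N.not_less by metis
    with z assms(2) show False
      unfolding consec_def using N.not_less by blast
  qed
qed

lemma ex_consec:
  assumes "S \<in> Sets M" and "x \<in> S" and "w \<in> S" and "x \<prec> w"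
  obtains y where "consec S x y" "y \<preceq> w"
proof -
  have "D1 (\<lambda>e. e 0 \<in> S \<and> x \<prec> e 0)"
    by (intro D1_intros F1_intros assms)
  then obtain y where "y \<in> S \<and> x \<prec> y" "\<And>k. k \<prec> y \<Longrightarrow> \<not> (k \<in> S \<and> x \<prec> k)"
    using assms(3,4) by (rule_tac least_D1[of "\<lambda>y. y \<in> S \<and> x \<prec> y" w]) blast+
  then show ?thesis
    using that[of y] assms N.not_less unfolding consec_def by blast
qed

lemma ex_cnt_infin:
  assumes "S \<in> Sets M" and "infin M S"
  shows "\<exists>x\<in>S. cnt S x = n"
proof -
  have "\<exists>x. x \<in> S \<and> cnt S x = n"
  proof (rule induct_S1[where P="\<lambda>n. \<exists>x. x \<in> S \<and> cnt S x = n"])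
    show "S1 (\<lambda>e. \<exists>x. x \<in> S \<and> cnt S x = e 0)"
      by (intro S1_ex D1_S1 D1_intros F1_cnt F1_intros assms)
    obtain x where "x \<in> S"
      using assms(2) unfolding infin_def by blast
    then have "\<zero> \<prec> cnt S (x \<oplus> \<one>)"
      using cnt_Suc[OF assms(1)] Suc_not_zero pos_iff by simp
    from ex_index[OF assms(1) this] show "\<exists>x. x \<in> S \<and> cnt S x = \<zero>"
      by blast
    show "\<exists>x. x \<in> S \<and> cnt S x = k \<oplus> \<one>" if ih: "\<exists>x. x \<in> S \<and> cnt S x = k" for k
    proof -
      obtain x where x: "x \<in> S" "cnt S x = k"
        using ih by blast
      moreover obtain w where "w \<in> S" "x \<prec> w"
        using assms(2) unfolding infin_def by blast
      ultimately obtain y where "consec S x y"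
        using ex_consec[OF assms(1)] by blast
      with x(2) cnt_consec[OF assms(1)] show ?thesis
        unfolding consec_def by blast
    qed
  qed
  then show ?thesis
    by blast
qed

lemma cnt_inj:
  assumes "S \<in> Sets M" and "x \<in> S" and "y \<in> S" and "cnt S x = cnt S y"
  shows "x = y"
  using assms cnt_less N.less_irrefl N.less_linear by metis

section \<open>From an independent set of intervals to a bad colouring\<close>

definition tail :: "'a \<Rightarrow> 'a set \<Rightarrow> 'a set" where
  "tail z X = {x \<in> X. z \<preceq> x}"

definition occ :: "'a set \<Rightarrow> 'a set \<Rightarrow> 'a \<Rightarrow> bool" where
  "occ I Y z \<longleftrightarrow> (\<exists>u\<in>I. init_seg M (elts M u) (tail z Y))"

text \<open>
  The condition on \<open>cnt\<close> says that, below \<open>b\<close>, the \<open>n\<close>-th element of \<open>y\<close> is at most the \<open>n\<close>-th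
  element of \<open>X\<close>.
\<close>

definition node :: "'a set \<Rightarrow> 'a set \<Rightarrow> 'a set \<Rightarrow> 'a \<Rightarrow> 'a \<Rightarrow> bool" where
  "node D I X b y \<longleftrightarrow> is_fincode M y \<and> (\<forall>x\<in>elts M y. x \<prec> b) \<and>
     (\<forall>x\<in>elts M y. x \<in> D) \<and> (\<forall>z\<in>elts M y. \<not> occ I (elts M y) z) \<and>
     (\<forall>v. v \<preceq> b \<longrightarrow> cnt X v \<preceq> cnt (elts M y) v)"

text \<open>The failure of this at \<open>b\<close> is the stopping condition: every finite subset
  of \<open>D\<close> below \<open>b\<close> that keeps pace with \<open>X\<close> contains a place
  where \<open>I\<close> occurs. Finite witnesses keep the condition Delta01.\<close>

definition dominated :: "'a set \<Rightarrow> 'a set \<Rightarrow> 'a set \<Rightarrow> 'a \<Rightarrow> bool" where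
  "dominated D I X b \<longleftrightarrow> (\<exists>y. node D I X b y)"

lemmas dominated_iff = dominated_def[unfolded node_def]

section \<open>Initial segments and monotonicity of domination\<close>

lemma init_seg_linear: "init_seg M S X \<Longrightarrow> init_seg M T X \<Longrightarrow> S \<subseteq> T \<or> T \<subseteq> S"
  unfolding init_seg_def using N.less_linear by blast

lemma init_seg_trans: "init_seg M S T \<Longrightarrow> init_seg M T X \<Longrightarrow> init_seg M S X"
  unfolding init_seg_def by blast

lemma init_seg_tail: "init_seg M S X \<Longrightarrow> init_seg M (tail z S) (tail z X)"
  unfolding init_seg_def tail_def by blast

lemma init_seg_between: "init_seg M S X \<Longrightarrow> S \<subseteq> T \<Longrightarrow> T \<subseteq> X \<Longrightarrow> init_seg M S T"
  unfolding init_seg_def by blast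

lemma Sets_below: "X \<in> Sets M \<Longrightarrow> {x \<in> X. x \<prec> b} \<in> Sets M"
  by (rule comprehension[where P="\<lambda>x. x \<in> X \<and> x \<prec> b"]) (intro D1_intros F1_intros)

lemma Fin_below: "X \<in> Sets M \<Longrightarrow> Fin {x \<in> X. x \<prec> b}"
  unfolding Fin_def using Sets_below by blast

lemma ex_least:
  assumes "S \<in> Sets M" and "S \<noteq> {}"
  obtains a where "a \<in> S" "\<And>x. x \<in> S \<Longrightarrow> a \<preceq> x"
proof -
  obtain b where "b \<in> S"
    using assms(2) by blast
  moreover have "D1 (\<lambda>e. e 0 \<in> S)"
    by (intro D1_intros F1_intros assms)
  ultimately show ?thesis
    using least_D1[of "\<lambda>x. x \<in> S" b] that N.not_less by metis
qed

text \<open>A member of \<open>I\<close> that occurs in \<open>elts M y\<close> has all its elements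
  below \<open>y\<close>, which turns the search for it into a bounded one.\<close>

lemma occ_elts_iff:
  assumes "\<forall>u\<in>I. is_fincode M u"
  shows "occ I (elts M y) z \<longleftrightarrow> (\<exists>u. is_fincode M u \<and> (\<forall>x\<in>elts M u. x \<prec> y) \<and> u \<in> I \<and>
    (\<forall>x\<in>elts M u. x \<in> elts M y \<and> z \<preceq> x) \<and>
    (\<forall>x\<in>elts M y. z \<preceq> x \<longrightarrow> (\<forall>w\<in>elts M u. x \<prec> w \<longrightarrow> x \<in> elts M u)))"
proof -
  have seg: "init_seg M (elts M u) (tail z (elts M y)) \<longleftrightarrow> (\<forall>x\<in>elts M u. x \<in> elts M y \<and> z \<preceq> x) \<and>
      (\<forall>x\<in>elts M y. z \<preceq> x \<longrightarrow> (\<forall>w\<in>elts M u. x \<prec> w \<longrightarrow> x \<in> elts M u))" for u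
    unfolding init_seg_def tail_def by auto
  have "\<forall>x\<in>elts M u. x \<prec> y" if "\<forall>x\<in>elts M u. x \<in> elts M y \<and> z \<preceq> x" for u
    using that elts_less by simp
  then show ?thesis
    unfolding occ_def seg Bex_def using assms by blast
qed

lemma D1_occ:
  assumes "I \<in> Sets M" and "\<forall>u\<in>I. is_fincode M u" and "F1 s" and "F1 t"
  shows "D1 (\<lambda>e. occ I (elts M (s e)) (t e))"
proof (rule D1_sub2[where R="\<lambda>s. occ I (elts M s)", OF _ assms(3,4)])
  show "D1 (\<lambda>e. occ I (elts M (e 0)) (e 1))"
    unfolding occ_elts_iff[OF assms(2)] by (intro D1_code_intros F1_intros assms(1))
qed

lemma D1_dominated:
  assumes "D \<in> Sets M" and "I \<in> Sets M" and "\<forall>u\<in>I. is_fincode M u" and "X \<in> Sets M" and "F1 t"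
  shows "D1 (\<lambda>e. dominated D I X (t e))"
proof (rule D1_sub1[OF _ assms(5)])
  show "D1 (\<lambda>e. dominated D I X (e 0))"
    unfolding dominated_iff by (intro D1_code_intros D1_occ F1_cnt F1_cnt_elts F1_intros assms)
qed

lemma D1_dominated_elts:
  assumes "D \<in> Sets M" and "I \<in> Sets M" and "\<forall>u\<in>I. is_fincode M u" and "F1 s" and "F1 t"
  shows "D1 (\<lambda>e. dominated D I (elts M (s e)) (t e))"
proof (rule D1_sub2[where R="\<lambda>s. dominated D I (elts M s)", OF _ assms(4,5)])
  show "D1 (\<lambda>e. dominated D I (elts M (e 0)) (e 1))"
    unfolding dominated_iff by (intro D1_code_intros D1_occ F1_cnt_elts F1_intros assms)
qed

lemma occ_below: "occ I {x \<in> Y. x \<prec> c} z \<Longrightarrow> occ I Y z"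
  unfolding occ_def init_seg_def tail_def using N.less_trans by blast

text \<open>Cutting off at \<open>c\<close> cannot create an occurrence of \<open>I\<close> and
  leaves the counts up to \<open>c\<close> unchanged; thinning \<open>X\<close> only weakens the
  comparison.\<close>

lemma node_below:
  assumes "X \<in> Sets M" and "X' \<in> Sets M" and "node D I X b y" and "c \<preceq> b"
    and "\<And>z. z \<prec> c \<Longrightarrow> z \<in> X' \<Longrightarrow> z \<in> X"
  shows "node D I X' c (code {x \<in> elts M y. x \<prec> c})"
proof -
  have y: "\<forall>x\<in>elts M y. x \<in> D" "\<forall>z\<in>elts M y. \<not> occ I (elts M y) z"
    "\<forall>v. v \<preceq> b \<longrightarrow> cnt X v \<preceq> cnt (elts M y) v"
    using assms(3) unfolding node_def by blast+
  let ?Y = "{x \<in> elts M y. x \<prec> c}"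
  have Y: "is_fincode M (code ?Y)" "elts M (code ?Y) = ?Y"
    using code_props[OF Fin_below[OF elts_Sets]] by blast+
  have "cnt X' v \<preceq> cnt ?Y v" if "v \<preceq> c" for v
  proof -
    have "cnt X' v \<preceq> cnt X v"
      using that assms(5) N.less_le_trans by (intro cnt_subset assms) blast
    also have "cnt X v \<preceq> cnt (elts M y) v"
      using y(3) that assms(4) N.order_trans by blast
    also have "cnt (elts M y) v = cnt ?Y v"
      using that N.less_le_trans by (intro cnt_cong elts_Sets Sets_below) blast
    finally show ?thesis .
  qed
  then show ?thesis
    using y(1,2) occ_below[of I "elts M y" c] unfolding node_def by (auto simp: Y)
qed

lemma dominated_mono:
  assumes "X \<in> Sets M" and "X' \<in> Sets M" and "dominated D I X b" and "c \<preceq> b"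
    and "\<And>z. z \<prec> c \<Longrightarrow> z \<in> X' \<Longrightarrow> z \<in> X"
  shows "dominated D I X' c"
  using node_below[OF assms(1,2) _ assms(4,5)] assms(3) unfolding dominated_def by blast

lemma dominated_zero: "dominated D I X \<zero>"
proof -
  have "v \<preceq> \<zero> \<Longrightarrow> v = \<zero>" for v
    using zero_le nle_antisym by blast
  then show ?thesis
    unfolding dominated_iff is_fincode_def
    by (intro exI[of _ \<zero>]) (simp add: elts_zero not_less_zero, metis cnt_zero nle_refl)
qed

text \<open>The old witness survives the next bound if \<open>X'\<close> has no more elements below
  \<open>m \<oplus> \<one>\<close> than \<open>X\<close> has below \<open>m\<close>. The antichain
  property of the barrier rests on this gain.\<close>

lemma dominated_Suc:
  assumes "dominated D I X m" and "cnt X' (m \<oplus> \<one>) \<preceq> cnt X m" and "\<And>v. v \<preceq> m \<Longrightarrow> cnt X' v \<preceq> cnt X v"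
  shows "dominated D I X' (m \<oplus> \<one>)"
proof -
  obtain y where y: "is_fincode M y" "\<forall>x\<in>elts M y. x \<prec> m" "\<forall>x\<in>elts M y. x \<in> D"
    "\<forall>z\<in>elts M y. \<not> occ I (elts M y) z" "\<forall>v. v \<preceq> m \<longrightarrow> cnt X v \<preceq> cnt (elts M y) v"
    using assms(1) unfolding dominated_iff by blast
  have "cnt X' v \<preceq> cnt (elts M y) v" if "v \<preceq> m \<oplus> \<one>" for v
  proof (cases "v \<preceq> m")
    case True
    then show ?thesis
      using assms(3) y(5) N.order_trans by blast
  next
    case False
    then have v: "v = m \<oplus> \<one>"
      using that unfolding nle_Suc[of v m] by (auto simp: nle_def)
    have "cnt X' v \<preceq> cnt X m"
      using assms(2) v by simp
    also have "cnt X m \<preceq> cnt (elts M y) m"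
      using y(5) nle_refl by blast
    also have "cnt (elts M y) m \<preceq> cnt (elts M y) v"
      unfolding v by (intro cnt_mono elts_Sets le_plus1)
    finally show ?thesis .
  qed
  moreover have "\<forall>x\<in>elts M y. x \<prec> m \<oplus> \<one>"
    using y(2) by (simp add: less_Suc)
  ultimately show ?thesis
    using y unfolding dominated_iff by blast
qed

section \<open>Parity and auxiliary facts\<close>

definition even_num :: "'a \<Rightarrow> bool" where
  "even_num c \<longleftrightarrow> (\<exists>h. h \<preceq> c \<and> c = h \<oplus> h)"

lemma even_num_iff: "even_num c \<longleftrightarrow> (\<exists>h. c = h \<oplus> h)"
  unfolding even_num_def using le_plus1 by blast

lemma D1_even: "F1 t \<Longrightarrow> D1 (\<lambda>e. even_num (t e))"
proof (rule D1_sub1)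
  show "D1 (\<lambda>e. even_num (e 0))"
    unfolding even_num_def by (intro D1_intros F1_intros)
qed

lemma Suc_double: "h \<oplus> \<one> \<oplus> (h \<oplus> \<one>) = h \<oplus> h \<oplus> \<one> \<oplus> \<one>"
  unfolding plus_Suc[of "h \<oplus> \<one>"] Suc_plus[of h h] ..

lemma double_neq: "k \<oplus> k \<oplus> \<one> \<noteq> h \<oplus> h"
proof
  assume eq: "k \<oplus> k \<oplus> \<one> = h \<oplus> h"
  show False
  proof (cases "h \<preceq> k")
    case True
    then have "h \<oplus> h \<preceq> k \<oplus> k"
      by (intro N.add_mono)
    then show False
      unfolding nle_Suc eq using less_irrefl by blast
  next
    case False
    then obtain z where "h = k \<oplus> (z \<oplus> \<one>)"
      using N.not_le less_iff by metis
    then have "k \<oplus> \<one> \<preceq> h"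
      unfolding nle_iff by (intro exI[of _ z]) (simp only: N.add.commute N.add.left_commute)
    then have "(k \<oplus> \<one>) \<oplus> (k \<oplus> \<one>) \<preceq> h \<oplus> h"
      by (intro N.add_mono)
    then have "h \<oplus> h \<oplus> \<one> \<preceq> h \<oplus> h"
      unfolding Suc_double eq .
    then show False
      using less_Suc[of "h \<oplus> h" "h \<oplus> h"] N.not_less by blast
  qed
qed

lemma even_num_Suc: "even_num (c \<oplus> \<one>) \<longleftrightarrow> \<not> even_num c"
proof -
  have "\<exists>h. c = h \<oplus> h \<or> c = h \<oplus> h \<oplus> \<one>"
  proof (rule induct_S1[where P="\<lambda>c. \<exists>h. c = h \<oplus> h \<or> c = h \<oplus> h \<oplus> \<one>"])
    show "S1 (\<lambda>e. \<exists>h. e 0 = h \<oplus> h \<or> e 0 = h \<oplus> h \<oplus> \<one>)"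
      by (rule S1_ex, rule D1_S1) (intro D1_intros F1_intros)
    show "\<exists>h. \<zero> = h \<oplus> h \<or> \<zero> = h \<oplus> h \<oplus> \<one>"
      by (rule exI[of _ \<zero>]) (simp add: plus_zero)
    fix n assume "\<exists>h. n = h \<oplus> h \<or> n = h \<oplus> h \<oplus> \<one>"
    then obtain h where "n = h \<oplus> h \<or> n = h \<oplus> h \<oplus> \<one>"
      by blast
    then show "\<exists>h. n \<oplus> \<one> = h \<oplus> h \<or> n \<oplus> \<one> = h \<oplus> h \<oplus> \<one>"
      using Suc_double[of h] by metis
  qed
  then obtain h where "c = h \<oplus> h \<or> c = h \<oplus> h \<oplus> \<one>"
    by blast
  then show ?thesis
  proof
    assume "c = h \<oplus> h"
    then show ?thesis
      unfolding even_num_iff using double_neq by blast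
  next
    assume c: "c = h \<oplus> h \<oplus> \<one>"
    then have "c \<oplus> \<one> = (h \<oplus> \<one>) \<oplus> (h \<oplus> \<one>)"
      unfolding Suc_double by simp
    with c show ?thesis
      unfolding even_num_iff using double_neq by blast
  qed
qed

lemma cnt_insert:
  assumes "S \<in> Sets M" and "T \<in> Sets M" and "a \<in> S" and "a \<notin> T" and "a \<prec> x"
    and "\<And>z. z \<prec> x \<Longrightarrow> z \<noteq> a \<Longrightarrow> z \<in> S \<longleftrightarrow> z \<in> T"
  shows "cnt S x = cnt T x \<oplus> \<one>"
proof -
  have "x \<preceq> x \<longrightarrow> a \<prec> x \<longrightarrow> cnt S x = cnt T x \<oplus> \<one>"
  proof (rule induct_D1[where P="\<lambda>y. y \<preceq> x \<longrightarrow> a \<prec> y \<longrightarrow> cnt S y = cnt T y \<oplus> \<one>"])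
    show "D1 (\<lambda>e. e 0 \<preceq> x \<longrightarrow> a \<prec> e 0 \<longrightarrow> cnt S (e 0) = cnt T (e 0) \<oplus> \<one>)"
      by (intro D1_intros F1_cnt F1_intros assms)
    show "n \<oplus> \<one> \<preceq> x \<longrightarrow> a \<prec> n \<oplus> \<one> \<longrightarrow> cnt S (n \<oplus> \<one>) = cnt T (n \<oplus> \<one>) \<oplus> \<one>"
      if ih: "n \<preceq> x \<longrightarrow> a \<prec> n \<longrightarrow> cnt S n = cnt T n \<oplus> \<one>" for n
    proof (intro impI)
      assume n: "n \<oplus> \<one> \<preceq> x" and "a \<prec> n \<oplus> \<one>"
      have "n \<prec> x"
        using n less_Suc[of n n] N.less_le_trans by blast
      from \<open>a \<prec> n \<oplus> \<one>\<close> consider "a \<prec> n" | "a = n"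
        unfolding less_Suc by blast
      then show "cnt S (n \<oplus> \<one>) = cnt T (n \<oplus> \<one>) \<oplus> \<one>"
      proof cases
        case 1
        with ih \<open>n \<prec> x\<close> assms(6)[of n] show ?thesis
          by (auto simp: cnt_Suc[OF assms(1)] cnt_Suc[OF assms(2)] nle_def less_irrefl)
      next
        case 2
        have "cnt S n = cnt T n"
          using \<open>n \<prec> x\<close> 2 N.less_trans less_irrefl by (intro cnt_cong assms) blast+
        with 2 assms(3,4) show ?thesis
          by (simp add: cnt_Suc[OF assms(1)] cnt_Suc[OF assms(2)])
      qed
    qed
  qed (simp add: not_less_zero)
  with assms(5) show ?thesis
    by (simp add: nle_refl)
qed

lemma Suc_le: "x \<prec> y \<longleftrightarrow> x \<oplus> \<one> \<preceq> y"
  unfolding less_iff nle_iff plus_left_commute[of x] ..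

lemma less_Suc_self: "x \<prec> x \<oplus> \<one>"
  by (simp add: less_Suc)

lemma UNIV_Sets: "UNIV \<in> Sets M"
  using comprehension[of "\<lambda>x. True"] D1_const by simp

lemma infin_UNIV: "infin M UNIV"
  unfolding infin_def using less_Suc_self by blast

lemma Fin_insertI: "Fin S \<Longrightarrow> Fin (insert a S)"
  using ex_fincode Fin_insert by metis

lemma Fin_empty: "Fin {}"
  using Fin_elts[of \<zero>] unfolding elts_zero .

lemma ex_pred:
  assumes "S \<in> Sets M" and "v \<in> S" and "w \<in> S" and "v \<prec> w"
  obtains p where "consec S p w" "v \<preceq> p"
proof -
  have "D1 (\<lambda>e. e 0 \<in> S \<and> e 0 \<prec> w)"
    by (intro D1_intros F1_intros assms)
  moreover have "v \<in> S \<and> v \<prec> w"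
    using assms by blast
  ultimately obtain p where "p \<in> S \<and> p \<prec> w" "\<And>k. k \<in> S \<and> k \<prec> w \<Longrightarrow> k \<preceq> p"
    by (rule greatest_D1) blast+
  then show ?thesis
    using that[of p] assms N.not_less unfolding consec_def by blast
qed

lemma init_seg_consec4:
  assumes "consec Y z0 z1" and "consec Y z1 z2" and "consec Y z2 z3"
  shows "init_seg M {z0, z1, z2, z3} (tail z0 Y)"
proof -
  have less: "z0 \<prec> z1" "z1 \<prec> z2" "z2 \<prec> z3"
    using assms unfolding consec_def by blast+
  have gap: "w = p \<or> q \<preceq> w" if "consec Y p q" "w \<in> Y" "p \<preceq> w" for p q w
  proof (rule disjCI)
    assume "\<not> q \<preceq> w"
    then have "w \<prec> q"
      using N.not_less by blast
    with that show "w = p"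
      unfolding consec_def nle_def by blast
  qed
  have "x \<in> {z0, z1, z2, z3}" if x: "x \<in> Y" "z0 \<preceq> x" and w: "w \<in> {z0, z1, z2, z3}" "x \<prec> w" for x w
  proof -
    have "z0 \<prec> z3" "z1 \<prec> z3"
      using less N.less_trans by blast+
    with w(1) less(3) have "w \<preceq> z3"
      unfolding nle_def by blast
    with w(2) have "\<not> z3 \<preceq> x"
      using N.less_le_trans N.not_less by blast
    then show ?thesis
      using gap[OF assms(1) x] gap[OF assms(2) x(1)] gap[OF assms(3) x(1)] by blast
  qed
  moreover have "{z0, z1, z2, z3} \<subseteq> tail z0 Y"
  proof -
    have "z0 \<prec> z2" "z0 \<prec> z3"
      using less N.less_trans by blast+
    then show ?thesis
      using assms less(1) unfolding tail_def consec_def nle_def by blast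
  qed
  ultimately show ?thesis
    unfolding init_seg_def tail_def by blast
qed

lemma consec_D: "consec S x y \<Longrightarrow> x \<in> S" "consec S x y \<Longrightarrow> y \<in> S" "consec S x y \<Longrightarrow> x \<prec> y"
  unfolding consec_def by blast+

lemma D1_consec:
  assumes "Y \<in> Sets M" and "F1 s" and "F1 t"
  shows "D1 (\<lambda>e. consec Y (s e) (t e))"
proof (rule D1_sub2[OF _ assms(2,3)])
  show "D1 (\<lambda>e. consec Y (e 0) (e 1))"
    unfolding consec_def by (intro D1_intros F1_intros assms(1))
qed

end

text \<open>\<open>compactness\<close> is phrased with finite free sets, since the model may lack an
  infinite free set although finite ones exist up to every bound. \<open>I_indep\<close> prevents
  the count from being zero twice in a row.\<close>

locale spread = rca +
  fixes D I :: "'a set"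
  assumes D_Sets: "D \<in> Sets M" and D_infin: "infin M D" and I_Sets: "I \<in> Sets M"
    and I_fincode: "\<forall>u\<in>I. is_fincode M u"
    and I_antichain: "\<And>u v. u \<in> I \<Longrightarrow> v \<in> I \<Longrightarrow> \<not> elts M u \<subset> elts M v"
    and I_indep: "\<And>u v X. u \<in> I \<Longrightarrow> v \<in> I \<Longrightarrow> init_seg M (elts M u) X \<Longrightarrow>
      \<not> init_seg M (elts M v) (minus_least M X)"
    and compactness: "\<And>X. X \<in> Sets M \<Longrightarrow> infin M X \<Longrightarrow> X \<subseteq> D \<Longrightarrow> \<exists>b. \<not> dominated D I X b"
begin

section \<open>The barrier of shortest stopping segments\<close>

abbreviation dom :: "'a set \<Rightarrow> 'a \<Rightarrow> bool" where
  "dom \<equiv> dominated D I"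

text \<open>The greatest element \<open>m\<close> is taken into account by the bound
  \<open>m \<oplus> \<one>\<close>, at which the stopping condition holds; at the elements
  themselves, \<open>m\<close> included, it still fails.\<close>

definition C :: "'a set" where
  "C = {t. is_fincode M t \<and> (\<forall>x\<in>elts M t. x \<in> D) \<and> (\<exists>m\<in>elts M t. (\<forall>x\<in>elts M t. x \<preceq> m) \<and>
     \<not> dom (elts M t) (m \<oplus> \<one>) \<and> (\<forall>x\<in>elts M t. dom (elts M t) x))}"

lemma C_Sets: "C \<in> Sets M"
  unfolding C_def
  by (rule comprehension) (intro D1_code_intros D1_dominated_elts F1_intros D_Sets I_Sets I_fincode)

text \<open>Let \<open>m\<close> and \<open>n\<close> be the greatest elements of \<open>t\<close>
  and \<open>u\<close>. If \<open>m\<close> is smaller, the witness for \<open>u\<close> at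
  \<open>n\<close> yields one for \<open>t\<close> at \<open>m \<oplus> \<one>\<close> by
  monotonicity. If they agree, \<open>t\<close> lacks an element of \<open>u\<close>, so the witness
  for \<open>u\<close> at \<open>m\<close> keeps pace with \<open>t\<close> even up to
  \<open>m \<oplus> \<one>\<close>. Both contradict the stopping condition for
  \<open>t\<close>.\<close>

lemma C_antichain:
  assumes "t \<in> C" and "u \<in> C"
  shows "\<not> elts M t \<subset> elts M u"
proof
  assume sub: "elts M t \<subset> elts M u"
  obtain m where m: "m \<in> elts M t" "\<not> dom (elts M t) (m \<oplus> \<one>)"
    using assms(1) unfolding C_def by blast
  obtain n where n: "n \<in> elts M u" "\<forall>x\<in>elts M u. x \<preceq> n" "dom (elts M u) n"
    using assms(2) unfolding C_def by blast
  have "m \<preceq> n"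
    using m n sub by blast
  have "m = n"
  proof (rule ccontr)
    assume "m \<noteq> n"
    with \<open>m \<preceq> n\<close> have "m \<oplus> \<one> \<preceq> n"
      by (metis less_iff nle_iff nle_def N.add.assoc N.add.commute)
    with dominated_mono[OF elts_Sets elts_Sets n(3)] sub m(2) show False
      by blast
  qed
  obtain w where w: "w \<in> elts M u" "w \<notin> elts M t"
    using sub by blast
  have "dom (elts M t) (m \<oplus> \<one>)"
  proof (rule dominated_Suc)
    show "dom (elts M u) m"
      using n(3) \<open>m = n\<close> by simp
    have "w \<prec> m \<oplus> \<one>"
      using w n(2) \<open>m = n\<close> nle_Suc by blast
    then have "cnt (elts M t) (m \<oplus> \<one>) \<prec> cnt (elts M u) (m \<oplus> \<one>)"
      using sub w by (intro cnt_psubset[where w=w] elts_Sets) blast+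
    also have "cnt (elts M u) (m \<oplus> \<one>) \<preceq> cnt (elts M u) m \<oplus> \<one>"
      by (simp add: cnt_Suc[OF elts_Sets] nle_refl le_plus1)
    finally show "cnt (elts M t) (m \<oplus> \<one>) \<preceq> cnt (elts M u) m"
      unfolding nle_Suc .
    show "cnt (elts M t) v \<preceq> cnt (elts M u) v" for v
      using sub by (intro cnt_subset elts_Sets) blast
  qed
  with m(2) show False
    by blast
qed

text \<open>The least bound at which domination fails is a successor, and its predecessor belongs to
  \<open>X\<close>: otherwise the count does not grow and the old witness still works. That the
  segment is nonempty later makes the base infinite.\<close>

lemma ex_init_seg_C:
  assumes "X \<in> Sets M" and "infin M X" and "X \<subseteq> D"
  shows "\<exists>t\<in>C. init_seg M (elts M t) X \<and> elts M t \<noteq> {}"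
proof -
  have "D1 (\<lambda>e. \<not> dom X (e 0))"
    by (intro D1_not D1_dominated F1_intros D_Sets I_Sets I_fincode assms)
  moreover obtain b' where "\<not> dom X b'"
    using compactness[OF assms] by blast
  ultimately obtain b where b: "\<not> dom X b" "\<And>c. c \<prec> b \<Longrightarrow> dom X c"
    by (rule least_D1) blast
  then have "b \<noteq> \<zero>"
    using dominated_zero by blast
  then obtain m where m: "b = m \<oplus> \<one>"
    using zero_or_Suc by blast
  have "dom X m"
    using b(2) less_Suc m by simp
  have "m \<in> X"
  proof (rule ccontr)
    assume "m \<notin> X"
    with dominated_Suc[OF \<open>dom X m\<close>, of X] b(1) show False
      unfolding m by (simp add: cnt_Suc[OF assms(1)] nle_refl)
  qed
  let ?T = "{x \<in> X. x \<prec> m \<oplus> \<one>}"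
  have T: "is_fincode M (code ?T)" "elts M (code ?T) = ?T"
    using code_props[OF Fin_below[OF assms(1)]] by blast+
  have T_Sets: "?T \<in> Sets M"
    by (rule Sets_below[OF assms(1)])
  have "\<not> dom ?T (m \<oplus> \<one>)"
  proof
    assume "dom ?T (m \<oplus> \<one>)"
    from dominated_mono[OF T_Sets assms(1) this nle_refl] have "dom X b"
      unfolding m by simp
    with b(1) show False ..
  qed
  moreover have le: "x \<preceq> m" if "x \<in> ?T" for x
    using that by (simp add: nle_Suc)
  moreover have "dom ?T x" if "x \<in> ?T" for x
    using dominated_mono[OF assms(1) T_Sets \<open>dom X m\<close> le[OF that]] by simp
  moreover have "m \<in> ?T"
    using \<open>m \<in> X\<close> less_Suc by simp
  moreover have "x \<in> D" if "x \<in> ?T" for x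
    using that assms(3) by blast
  ultimately have "code ?T \<in> C"
    unfolding C_def mem_Collect_eq T(2) using T(1) by (intro conjI ballI bexI[of _ m]) simp_all
  moreover have "init_seg M ?T X"
    unfolding init_seg_def using N.less_trans by blast
  ultimately show ?thesis
    using T(2) \<open>m \<in> ?T\<close> by (intro bexI[of _ "code ?T"]) auto
qed

lemma C_barrier: "is_barrier M C"
proof -
  have "infin M (base M C)"
    unfolding infin_def
  proof
    fix n
    \<comment> \<open>A nonempty initial segment of this part of \<open>D\<close> reaches beyond
      \<open>n\<close>.\<close>
    let ?X = "{x. x \<in> D \<and> n \<prec> x}"
    have "?X \<in> Sets M"
      by (intro comprehension D1_intros F1_intros D_Sets)
    moreover have "infin M ?X"
      unfolding infin_def
    proof
      fix k
      obtain m where "m \<in> D" "k \<oplus> n \<oplus> \<one> \<prec> m"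
        using D_infin unfolding infin_def by blast
      then show "\<exists>m\<in>?X. k \<prec> m"
        using less_plus1[of k n] less_plus2[of n k] N.less_trans by blast
    qed
    ultimately obtain t x where "t \<in> C" "x \<in> elts M t" "x \<in> ?X"
      using ex_init_seg_C[of ?X] unfolding init_seg_def by blast
    then show "\<exists>m\<in>base M C. n \<prec> m"
      unfolding base_def by blast
  qed
  moreover have base: "base M C \<subseteq> D"
    unfolding base_def C_def by blast
  moreover have "\<forall>s\<in>C. is_fincode M s"
    unfolding C_def by blast
  moreover have "\<not> (init_seg M (elts M s) (elts M t) \<and> elts M s \<noteq> elts M t)" if "s \<in> C" "t \<in> C" for s t
    using C_antichain[OF that] unfolding init_seg_def by blast
  moreover have "\<exists>s\<in>C. init_seg M (elts M s) X" 
    if "X \<in> Sets M" "infin M X" "X \<subseteq> base M C" for X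
    using ex_init_seg_C[OF that(1,2)] that(3) base by blast
  ultimately have "is_block M C"
    unfolding is_block_def using C_Sets by simp
  then show ?thesis
    unfolding is_barrier_def using C_antichain by blast
qed

section \<open>The colouring of the barrier\<close>

definition first :: "'a \<Rightarrow> 'a \<Rightarrow> bool" where
  "first t z \<longleftrightarrow> z \<in> elts M t \<and> occ I (elts M t) z \<and>
     (\<forall>z'\<in>elts M t. z' \<prec> z \<longrightarrow> \<not> occ I (elts M t) z')"

lemma first_unique: "first t z \<Longrightarrow> first t w \<Longrightarrow> z = w"
  unfolding first_def using N.less_linear by blast

text \<open>A member of \<open>C\<close> keeps pace with itself, so it is among the finite sets that
  must contain an occurrence of \<open>I\<close>.\<close>

lemma ex_first:
  assumes "t \<in> C"
  shows "\<exists>z. first t z"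
proof -
  obtain m where m: "is_fincode M t" "\<forall>x\<in>elts M t. x \<in> D" "\<forall>x\<in>elts M t. x \<preceq> m"
    "\<not> dom (elts M t) (m \<oplus> \<one>)"
    using assms unfolding C_def by blast
  then obtain z where z: "z \<in> elts M t" "occ I (elts M t) z"
    unfolding dominated_iff nle_Suc using nle_refl nle_Suc by blast
  moreover have "D1 (\<lambda>e. e 0 \<in> elts M t \<and> occ I (elts M t) (e 0))"
    by (intro D1_code_intros D1_occ F1_intros I_Sets I_fincode)
  ultimately obtain w where "w \<in> elts M t \<and> occ I (elts M t) w"
    "\<And>k. k \<prec> w \<Longrightarrow> \<not> (k \<in> elts M t \<and> occ I (elts M t) k)"
    using least_D1[of "\<lambda>z. z \<in> elts M t \<and> occ I (elts M t) z" z] by metis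
  then show ?thesis
    unfolding first_def by blast
qed

text \<open>Removing the least element lowers a positive count by one and so flips its parity. After
  count zero the next count can be any nonzero number, which is what the third colour is
  for.\<close>

definition colour :: "'a \<Rightarrow> 'a" where
  "colour c = (if c = \<zero> then \<one> \<oplus> \<one> else if even_num c then \<zero> else \<one>)"

lemma colour_zero: "colour c = colour \<zero> \<Longrightarrow> c = \<zero>"
proof -
  have "\<one> \<oplus> \<one> \<noteq> \<one>"
    using Suc_inject[of \<one> \<zero>] N.zero_neq_one by (auto simp: zero_plus)
  then show "colour c = colour \<zero> \<Longrightarrow> c = \<zero>"
    using Suc_not_zero[of \<one>] unfolding colour_def by (auto split: if_splits)
qed

lemma colour_Suc: "colour (c \<oplus> \<one>) \<noteq> colour c"
proof (cases "c = \<zero>")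
  case True
  then show ?thesis
    using colour_zero[of "c \<oplus> \<one>"] Suc_not_zero by metis
next
  case False
  then show ?thesis
    unfolding colour_def even_num_Suc using Suc_not_zero[of c] N.zero_neq_one by auto
qed

definition g :: "'a set" where
  "g = {p. \<exists>t. t \<preceq> p \<and> (\<exists>z\<in>elts M t. p = pair M t (colour (cnt (elts M t) z)) \<and> t \<in> C \<and> first t z)}"

lemma g_iff: "pair M t q \<in> g \<longleftrightarrow> t \<in> C \<and> (\<exists>z. first t z \<and> q = colour (cnt (elts M t) z))"
  unfolding g_def by (auto simp: pair_inject le_pair1 first_def)

lemma g_Sets: "g \<in> Sets M"
  unfolding g_def colour_def first_def
  by (intro comprehension D1_code_intros D1_occ D1_even F1_cnt_elts F1_intros I_Sets I_fincode C_Sets)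

lemma g_fun: "is_fun M g C (fst (discrete3 M))"
proof -
  have "g \<subseteq> {pair M x y | x y. x \<in> C \<and> y \<in> fst (discrete3 M)}"
    unfolding g_def discrete3_def Let_def colour_def by auto
  moreover have "\<exists>!y. pair M t y \<in> g" if "t \<in> C" for t
    using that ex_first[OF that] first_unique unfolding g_iff by metis
  ultimately show ?thesis
    unfolding is_fun_def using g_Sets by blast
qed

text \<open>Passing from \<open>s\<close> to \<open>t\<close> removes the least element
  \<open>a\<close>. If the first occurrence in \<open>s\<close> is at \<open>a\<close>, independence
  forbids an occurrence at the next element, so exactly one count is zero. Otherwise both first
  occurrences are at the same place, and the counts differ by one because of
  \<open>a\<close>.\<close>

lemma colours_differ:
  assumes "s \<in> C" and "t \<in> C" and "tri M s t" and "first s x" and "first t y"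
  shows "colour (cnt (elts M s) x) \<noteq> colour (cnt (elts M t) y)"
proof -
  define S T where "S = elts M s" and "T = elts M t"
  have ST: "S \<in> Sets M" "T \<in> Sets M"
    unfolding S_def T_def by (rule elts_Sets)+
  obtain X where X: "init_seg M S X" "init_seg M T (minus_least M X)"
    using assms(3) unfolding tri_def S_def T_def by blast
  have "x \<in> S" "y \<in> T"
    using assms(4,5) unfolding first_def S_def T_def by blast+
  obtain a where a: "a \<in> S" "\<And>z. z \<in> S \<Longrightarrow> a \<preceq> z"
    using ex_least[OF ST(1)] \<open>x \<in> S\<close> by blast
  have aX: "a \<in> X" "\<And>z. z \<in> X \<Longrightarrow> a \<preceq> z"
    using a X(1) N.not_less unfolding init_seg_def by blast+
  have ml: "minus_least M X = {z \<in> X. a \<prec> z}"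
    unfolding minus_least_def using aX N.le_less_trans by blast
  have "a \<notin> T"
    using X(2) unfolding ml init_seg_def by (auto simp: less_irrefl)
  \<comment> \<open>\<open>T\<close> cannot end earlier, since it would then be a proper subset of
    \<open>S\<close>.\<close>
  have "S - {a} \<subseteq> T"
  proof -
    have "init_seg M (S - {a}) (minus_least M X)"
      using X(1) a(2) unfolding ml init_seg_def nle_def by (auto simp: less_irrefl)
    then have "S - {a} \<subseteq> T \<or> T \<subseteq> S - {a}"
      using X(2) init_seg_linear by blast
    moreover have "\<not> T \<subset> S"
      using C_antichain assms(1,2) unfolding S_def T_def by blast
    ultimately show ?thesis
      using a(1) by blast
  qed
  have "T \<subseteq> X"
    using X(2) unfolding init_seg_def ml by blast
  obtain u where u: "u \<in> I" "init_seg M (elts M u) (tail x S)"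
    using assms(4) unfolding first_def occ_def S_def by blast
  then have uX: "init_seg M (elts M u) (tail x X)"
    using init_seg_trans init_seg_tail X(1) by blast
  obtain v where v: "v \<in> I" "init_seg M (elts M v) (tail y T)"
    using assms(5) unfolding first_def occ_def T_def by blast
  then have vX: "init_seg M (elts M v) (tail y (minus_least M X))"
    using init_seg_trans init_seg_tail X(2) by blast
  have "a \<prec> y" "y \<in> X"
    using \<open>y \<in> T\<close> X(2) unfolding init_seg_def ml by blast+
  have tail_y: "tail y (minus_least M X) = tail y X"
    unfolding tail_def ml using \<open>a \<prec> y\<close> N.less_le_trans by blast
  show ?thesis
  proof (cases "x = a")
    case True
    then have "tail x X = X"
      unfolding tail_def using aX by blast
    have "cnt S x = \<zero>"
    proof (rule ccontr)
      assume "cnt S x \<noteq> \<zero>"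
      then show False
        using ex_index[OF ST(1), of \<zero> x] a(2) True N.not_less unfolding pos_iff by blast
    qed
    moreover have "cnt T y \<noteq> \<zero>"
    proof
      \<comment> \<open>Then \<open>y\<close> is the least element of
        \<open>minus_least M X\<close>, so \<open>u\<close> and \<open>v\<close> occur at two
        consecutive places.\<close>
      assume "cnt T y = \<zero>"
      then have "y \<preceq> z" if "z \<in> minus_least M X" for z
        using that X(2) \<open>y \<in> T\<close> cnt_less[OF ST(2), of z y] not_less_zero N.not_less
        unfolding init_seg_def by metis
      then have "tail y (minus_least M X) = minus_least M X"
        unfolding tail_def by blast
      with I_indep[OF u(1) v(1), of X] uX vX \<open>tail x X = X\<close> show False
        by simp
    qed
    ultimately show ?thesis
      using colour_zero unfolding S_def T_def by metis
  next
    case False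
    have "x \<in> T"
      using \<open>S - {a} \<subseteq> T\<close> \<open>x \<in> S\<close> False by blast
    have "a \<prec> x"
      using a(2)[OF \<open>x \<in> S\<close>] False unfolding nle_def by blast
    have "tail x S \<subseteq> tail x T"
      using \<open>S - {a} \<subseteq> T\<close> \<open>a \<prec> x\<close> N.not_less unfolding tail_def by blast
    then have "init_seg M (elts M u) (tail x T)"
      using u(2) \<open>T \<subseteq> X\<close> by (intro init_seg_between[OF uX]) (auto simp: init_seg_def tail_def)
    then have "\<not> x \<prec> y"
      using assms(5) u(1) \<open>x \<in> T\<close> unfolding first_def occ_def T_def by blast
    \<comment> \<open>An occurrence in \<open>T\<close> before \<open>x\<close> would already be
      visible in \<open>S\<close>.\<close>
    have "x = y"
    proof (rule ccontr)
      assume "x \<noteq> y"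
      with \<open>\<not> x \<prec> y\<close> have "y \<prec> x"
        using N.less_linear by blast
      then have "y \<in> S"
        using X(1) \<open>x \<in> S\<close> \<open>y \<in> X\<close> unfolding init_seg_def by blast
      \<comment> \<open>If \<open>v\<close> reached beyond \<open>S\<close>, it would properly
        contain \<open>u\<close>, against the antichain property of \<open>I\<close>.\<close>
      have "elts M v \<subseteq> S"
      proof
        fix w assume w: "w \<in> elts M v"
        show "w \<in> S"
        proof (rule ccontr)
          assume "w \<notin> S"
          have wX: "w \<in> X"
            using w vX[unfolded tail_y] unfolding init_seg_def tail_def by blast
          have "z \<in> elts M v" if z: "z \<in> elts M u" for z
          proof -
            have "z \<in> S" "x \<preceq> z"
              using z u(2) unfolding init_seg_def tail_def by blast+
            then have "z \<prec> w"
              using X(1) \<open>w \<notin> S\<close> wX N.less_linear unfolding init_seg_def by blast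
            moreover have "z \<in> tail y X"
              using \<open>z \<in> S\<close> \<open>x \<preceq> z\<close> \<open>y \<prec> x\<close> X(1) N.less_le_trans N.less_imp_le
              unfolding tail_def init_seg_def by blast
            ultimately show ?thesis
              using vX w unfolding tail_y init_seg_def by blast
          qed
          moreover have "w \<notin> elts M u"
            using u(2) \<open>w \<notin> S\<close> unfolding init_seg_def tail_def by blast
          ultimately show False
            using I_antichain u(1) v(1) w by blast
        qed
      qed
      then have "init_seg M (elts M v) (tail y S)"
        using v(2) X(1) vX unfolding tail_y by (intro init_seg_between[OF vX[unfolded tail_y]])
          (auto simp: init_seg_def tail_def)
      then have "occ I S y"
        using v(1) unfolding occ_def by blast
      then show False
        using assms(4) \<open>y \<in> S\<close> \<open>y \<prec> x\<close> unfolding first_def S_def by blast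
    qed
    have "cnt S x = cnt T x \<oplus> \<one>"
    proof (rule cnt_insert[OF ST a(1) \<open>a \<notin> T\<close> \<open>a \<prec> x\<close>])
      show "z \<in> S \<longleftrightarrow> z \<in> T" if "z \<prec> x" "z \<noteq> a" for z
        using that \<open>S - {a} \<subseteq> T\<close> \<open>T \<subseteq> X\<close> X(1) \<open>x \<in> S\<close> unfolding init_seg_def by blast
    qed
    then show ?thesis
      using colour_Suc \<open>x = y\<close> unfolding S_def T_def by metis
  qed
qed

lemma not_bqo_discrete3: "\<not> is_bqo M (discrete3 M)"
proof
  assume "is_bqo M (discrete3 M)"
  then obtain s t p q where st: "s \<in> C" "t \<in> C" "tri M s t"
    and pq: "pair M s p \<in> g" "pair M t q \<in> g" "ord_le M (discrete3 M) p q"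
    unfolding is_bqo_def using C_barrier g_fun by blast
  have "p = q"
    using pq(3) unfolding ord_le_def discrete3_def Let_def by (auto simp: pair_inject)
  with pq(1,2) st show False
    unfolding g_iff using colours_differ by blast
qed

end

section \<open>Arithmetical comprehension\<close>

locale enumeration = rca +
  fixes Z :: "'a set"
  assumes Z_Sets: "Z \<in> Sets M"
begin

definition enum_by :: "'a \<Rightarrow> 'a \<Rightarrow> bool" where
  "enum_by k m \<longleftrightarrow> (\<exists>n. n \<preceq> m \<and> pair M k n \<in> Z)"

text \<open>The alternative \<open>k = y\<close> guarantees that some number enters and that the
  least one is at most \<open>y\<close>.\<close>

definition enters :: "'a \<Rightarrow> 'a \<Rightarrow> 'a \<Rightarrow> bool" where
  "enters x y k \<longleftrightarrow> k = y \<or> enum_by k y \<and> \<not> enum_by k x"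

definition least_new :: "'a \<Rightarrow> 'a \<Rightarrow> 'a" where
  "least_new x y = (THE k. enters x y k \<and> (\<forall>j. j \<prec> k \<longrightarrow> \<not> enters x y j))"

lemma enum_by_mono: "enum_by k m \<Longrightarrow> m \<preceq> n \<Longrightarrow> enum_by k n"
  unfolding enum_by_def using N.order_trans by blast

lemma D1_enum_by: "F1 s \<Longrightarrow> F1 t \<Longrightarrow> D1 (\<lambda>e. enum_by (s e) (t e))"
proof (rule D1_sub2)
  show "D1 (\<lambda>e. enum_by (e 0) (e 1))"
    unfolding enum_by_def by (intro D1_intros F1_intros Z_Sets)
qed

lemma least_new_iff: "k = least_new x y \<longleftrightarrow> enters x y k \<and> (\<forall>j. j \<prec> k \<longrightarrow> \<not> enters x y j)"
proof -
  have "D1 (\<lambda>e. enters x y (e 0))"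
    unfolding enters_def by (intro D1_intros D1_enum_by F1_intros)
  moreover have "enters x y y"
    unfolding enters_def by blast
  ultimately obtain k where "enters x y k" "\<And>j. j \<prec> k \<Longrightarrow> \<not> enters x y j"
    by (rule least_D1) blast
  then have "\<exists>!k. enters x y k \<and> (\<forall>j. j \<prec> k \<longrightarrow> \<not> enters x y j)"
    using N.less_linear by metis
  from theI'[OF this] this show ?thesis
    unfolding least_new_def by blast
qed

lemma F1_least_new:
  assumes "F1 s" and "F1 t"
  shows "F1 (\<lambda>e. least_new (s e) (t e))"
proof (rule F1_sub2[OF _ assms],
    rule F1I[where R="\<lambda>e k. enters (e 0) (e 1) k \<and> (\<forall>j. j \<prec> k \<longrightarrow> \<not> enters (e 0) (e 1) j)"])
  show "S1 (\<lambda>e. enters (e (Suc 0)) (e (Suc 1)) (e 0) \<and>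
      (\<forall>j. j \<prec> e 0 \<longrightarrow> \<not> enters (e (Suc 0)) (e (Suc 1)) j))"
    unfolding enters_def by (rule D1_S1) (intro D1_intros D1_enum_by F1_intros)
qed (rule least_new_iff)

lemma least_new_enters: "enters x y (least_new x y)"
  using least_new_iff by blast

lemma least_new_le: "enters x y k \<Longrightarrow> least_new x y \<preceq> k"
  using least_new_iff[of "least_new x y"] N.not_less by blast

lemma least_new_le_right: "least_new x y \<preceq> y"
  using least_new_le unfolding enters_def by blast

text \<open>Four points carry three successive values of \<open>least_new\<close>, and the middle
  one is a local maximum. The inequality on the left is weak, so that without peaks a sequence never
  decreases again once it has failed to decrease.\<close>

definition peaks :: "'a set" where
  "peaks = {u. is_fincode M u \<and> (\<exists>x0\<in>elts M u. \<exists>x1\<in>elts M u. \<exists>x2\<in>elts M u. \<exists>x3\<in>elts M u.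
     x0 \<prec> x1 \<and> x1 \<prec> x2 \<and> x2 \<prec> x3 \<and> (\<forall>z\<in>elts M u. z = x0 \<or> z = x1 \<or> z = x2 \<or> z = x3) \<and>
     least_new x0 x1 \<preceq> least_new x1 x2 \<and> least_new x2 x3 \<prec> least_new x1 x2)}"

lemma peaks_Sets: "peaks \<in> Sets M"
  unfolding peaks_def
  by (rule comprehension) (intro D1_code_intros F1_least_new F1_intros)

lemma peaksE:
  assumes "u \<in> peaks"
  obtains x0 x1 x2 x3 where "elts M u = {x0, x1, x2, x3}" "x0 \<prec> x1" "x1 \<prec> x2" "x2 \<prec> x3"
    "least_new x0 x1 \<preceq> least_new x1 x2" "least_new x2 x3 \<prec> least_new x1 x2"
proof -
  obtain x0 x1 x2 x3 where x: "x0 \<in> elts M u" "x1 \<in> elts M u" "x2 \<in> elts M u" "x3 \<in> elts M u"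
    "x0 \<prec> x1" "x1 \<prec> x2" "x2 \<prec> x3" "\<forall>z\<in>elts M u. z = x0 \<or> z = x1 \<or> z = x2 \<or> z = x3"
    "least_new x0 x1 \<preceq> least_new x1 x2" "least_new x2 x3 \<prec> least_new x1 x2"
    using assms unfolding peaks_def by blast
  moreover then have "elts M u = {x0, x1, x2, x3}"
    by blast
  ultimately show ?thesis
    using that by blast
qed

lemma card_increasing4:
  assumes "x0 \<prec> x1" and "x1 \<prec> x2" and "x2 \<prec> x3"
  shows "card {x0, x1, x2, x3} = 4"
proof -
  have "x0 \<prec> x2" "x0 \<prec> x3" "x1 \<prec> x3"
    using assms N.less_trans by blast+
  with assms have "x0 \<notin> {x1, x2, x3}" "x1 \<notin> {x2, x3}" "x2 \<noteq> x3"
    using less_irrefl by blast+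
  then show ?thesis
    by simp
qed

lemma peaks_antichain:
  assumes "u \<in> peaks" and "v \<in> peaks"
  shows "\<not> elts M u \<subset> elts M v"
proof
  assume sub: "elts M u \<subset> elts M v"
  have "card (elts M u) = 4" "card (elts M v) = 4" "finite (elts M v)"
    using assms by (auto elim!: peaksE simp: card_increasing4)
  with psubset_card_mono[OF _ sub] show False
    by simp
qed

text \<open>Two peaks at consecutive places would share the values at \<open>x1, x2\<close> and at
  \<open>x2, x3\<close>. The first peak makes the value drop there, the second forbids it.\<close>

lemma peaks_indep:
  assumes "u \<in> peaks" and "v \<in> peaks" and "init_seg M (elts M u) X"
  shows "\<not> init_seg M (elts M v) (minus_least M X)"
proof
  let ?X' = "minus_least M X"
  assume seg_v: "init_seg M (elts M v) ?X'"
  obtain x0 x1 x2 x3 where x: "elts M u = {x0, x1, x2, x3}" "x0 \<prec> x1" "x1 \<prec> x2" "x2 \<prec> x3"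
    "least_new x0 x1 \<preceq> least_new x1 x2" "least_new x2 x3 \<prec> least_new x1 x2"
    using peaksE[OF assms(1)] .
  obtain y0 y1 y2 y3 where y: "elts M v = {y0, y1, y2, y3}" "y0 \<prec> y1" "y1 \<prec> y2" "y2 \<prec> y3"
    "least_new y0 y1 \<preceq> least_new y1 y2" "least_new y2 y3 \<prec> least_new y1 y2"
    using peaksE[OF assms(2)] .
  have x': "x0 \<prec> x2" "x0 \<prec> x3" "x1 \<prec> x3"
    using x N.less_trans by blast+
  have y': "y0 \<prec> y2" "y0 \<prec> y3" "y1 \<prec> y3"
    using y N.less_trans by blast+
  have in_X: "x0 \<in> X" "x1 \<in> X" "x2 \<in> X" "x3 \<in> X"
    using assms(3) unfolding x(1) init_seg_def by blast+
  have X': "{x1, x2, x3} \<subseteq> ?X'"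
    using in_X x(2) x' unfolding minus_least_def by blast
  have x0: "x0 \<notin> ?X'"
  proof
    assume "x0 \<in> ?X'"
    then obtain z where "z \<in> X" "z \<prec> x0"
      unfolding minus_least_def by blast
    then have "z \<in> {x0, x1, x2, x3}"
      using assms(3) unfolding x(1) init_seg_def by blast
    with \<open>z \<prec> x0\<close> x(2) x' show False
      using N.less_asym less_irrefl by blast
  qed
  have sub: "?X' \<subseteq> X"
    unfolding minus_least_def by blast
  have seg_x: "init_seg M {x1, x2, x3} ?X'"
    using assms(3) X' x0 sub unfolding x(1) init_seg_def by blast
  \<comment> \<open>Four elements do not fit into three, so \<open>v\<close> extends the last three
    elements of \<open>u\<close>.\<close>
  have "\<not> {y0, y1, y2, y3} \<subseteq> {x1, x2, x3}"
  proof
    assume "{y0, y1, y2, y3} \<subseteq> {x1, x2, x3}"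
    then have "card {y0, y1, y2, y3} \<le> card {x1, x2, x3}"
      by (intro card_mono) auto
    moreover have "card {x1, x2, x3} \<le> 3"
      by (simp add: card_insert_if)
    ultimately show False
      using card_increasing4[OF y(2-4)] by simp
  qed
  then have xy: "{x1, x2, x3} \<subseteq> {y0, y1, y2, y3}"
    using init_seg_linear[OF seg_x seg_v[unfolded y(1)]] by blast
  have yX: "y0 \<in> ?X'" "y1 \<in> ?X'" "y2 \<in> ?X'"
    using seg_v unfolding y(1) init_seg_def by blast+
  have down: "p \<in> {x1, x2, x3}" if "p \<in> ?X'" "q \<in> {x1, x2, x3}" "p \<prec> q" for p q
    using seg_x that unfolding init_seg_def by blast
  have y0: "y0 = x1"
  proof (rule ccontr)
    assume "y0 \<noteq> x1"
    then have "y0 \<prec> x1"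
      using xy y(2) y' by blast
    then show False
      using down[OF yX(1), of x1] x(3) x' N.less_asym less_irrefl by blast
  qed
  have y1: "y1 = x2"
  proof (rule ccontr)
    assume "y1 \<noteq> x2"
    then have "y1 \<prec> x2"
      using xy y(3) y' y0 x(3) less_irrefl by blast
    then show False
      using down[OF yX(2), of x2] x(4) y0 y(2) N.less_asym less_irrefl by blast
  qed
  have y2: "y2 = x3"
  proof (rule ccontr)
    assume "y2 \<noteq> x3"
    then have "y2 \<prec> x3"
      using xy y(4) y0 y1 x(4) x' less_irrefl by blast
    then show False
      using down[OF yX(3), of x3] y0 y1 y(3) y' less_irrefl by blast
  qed
  show False
    using x(6) y(5) unfolding y0 y1 y2 using N.not_less by blast
qed

section \<open>Sequences without peaks bound the stages of the enumeration\<close>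

lemma no_peak:
  assumes "\<forall>z\<in>Y. \<not> occ peaks Y z" and "consec Y z0 z1" and "consec Y z1 z2" and "consec Y z2 z3"
    and "least_new z0 z1 \<preceq> least_new z1 z2"
  shows "least_new z1 z2 \<preceq> least_new z2 z3"
proof (rule ccontr)
  assume "\<not> ?thesis"
  then have peak: "least_new z2 z3 \<prec> least_new z1 z2"
    using N.not_less by blast
  let ?U = "{z0, z1, z2, z3}"
  have "Fin ?U"
    by (intro Fin_insertI Fin_empty)
  then have U: "is_fincode M (code ?U)" "elts M (code ?U) = ?U"
    using code_props by blast+
  have "z0 \<prec> z1" "z1 \<prec> z2" "z2 \<prec> z3" "z0 \<in> Y"
    using assms unfolding consec_def by blast+
  with peak assms(5) have "code ?U \<in> peaks"
    unfolding peaks_def mem_Collect_eq U(2) using U(1) by blast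
  then have "occ peaks Y z0"
    unfolding occ_def using init_seg_consec4[OF assms(2-4)] U(2) by (intro bexI[of _ "code ?U"]) simp_all
  with assms(1) \<open>z0 \<in> Y\<close> show False
    by blast
qed

text \<open>Without peaks, a descent at \<open>z\<close> means that the values have strictly
  decreased from the start of \<open>Y\<close>, so value plus index never grows. The first value is
  at most the second element of \<open>Y\<close>, and this element is at most \<open>x\<close> by
  the assumption on the count. In particular no descent has an index above \<open>x\<close>.\<close>

lemma descent_bound:
  assumes "Y \<in> Sets M" and "\<forall>z\<in>Y. \<not> occ peaks Y z" and "\<one> \<oplus> \<one> \<preceq> cnt Y x"
    and "consec Y z z'" and "consec Y z' z''" and "least_new z' z'' \<prec> least_new z z'" and "z'' \<prec> b"
  shows "least_new z z' \<oplus> cnt Y z \<preceq> x"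
proof -
  \<comment> \<open>\<open>b\<close> bounds the elements under consideration and so keeps the
    induction on the index Delta01.\<close>
  define P where "P j \<longleftrightarrow> (\<forall>z. z \<prec> b \<longrightarrow> (\<forall>z'. z' \<prec> b \<longrightarrow> (\<forall>z''. z'' \<prec> b \<longrightarrow>
    consec Y z z' \<longrightarrow> consec Y z' z'' \<longrightarrow> least_new z' z'' \<prec> least_new z z' \<longrightarrow>
    cnt Y z = j \<longrightarrow> least_new z z' \<oplus> j \<preceq> x)))" for j
  have "P j" for j
  proof (rule induct_D1[where P=P])
    show "D1 (\<lambda>e. P (e 0))"
      unfolding P_def by (intro D1_intros D1_consec F1_least_new F1_cnt F1_var F1_const F1_plus assms(1))
    show "P \<zero>"
      unfolding P_def
    proof (intro allI impI)
      fix z z' z''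
      assume "consec Y z z'" "cnt Y z = \<zero>"
      then have one: "cnt Y z' = \<one>"
        using cnt_consec[OF assms(1), of z z'] by (simp add: zero_plus)
      have "\<not> x \<preceq> z'"
      proof
        assume "x \<preceq> z'"
        then have "\<one> \<oplus> \<one> \<preceq> \<one>"
          using N.order_trans[OF assms(3) cnt_mono[OF assms(1)]] unfolding one[symmetric] by blast
        then show False
          unfolding Suc_le[symmetric] by (simp add: less_irrefl)
      qed
      then have "z' \<preceq> x"
        using nle_linear by blast
      then show "least_new z z' \<oplus> \<zero> \<preceq> x"
        using N.order_trans[OF least_new_le_right] by (simp only: plus_zero)
    qed
    fix j
    assume ih: "P j"
    show "P (j \<oplus> \<one>)"
      unfolding P_def
    proof (intro allI impI)
      fix z z' z''
      assume b: "z \<prec> b" "z' \<prec> b" and z: "consec Y z z'" "consec Y z' z''"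
        and desc: "least_new z' z'' \<prec> least_new z z'" and j: "cnt Y z = j \<oplus> \<one>"
      have "j \<prec> cnt Y z"
        unfolding j by (rule less_Suc_self)
      then obtain w where w: "w \<prec> z" "w \<in> Y"
        using ex_index[OF assms(1)] by blast
      obtain p where p: "consec Y p z"
        using ex_pred[OF assms(1) w(2) consec_D(1) w(1)] z(1) by blast
      have cp: "cnt Y p = j"
        using cnt_consec[OF assms(1) p] unfolding j by (rule Suc_inject[OF sym])
      have "\<not> least_new p z \<preceq> least_new z z'"
      proof
        assume "least_new p z \<preceq> least_new z z'"
        from no_peak[OF assms(2) p z this] desc show False
          using N.not_less by blast
      qed
      then have less: "least_new z z' \<prec> least_new p z"
        using N.not_less by blast
      have "p \<prec> b"
        using consec_D(3)[OF p] b(1) by (rule N.less_trans)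
      have "least_new z z' \<oplus> (j \<oplus> \<one>) = least_new z z' \<oplus> \<one> \<oplus> j"
        unfolding Suc_plus plus_Suc ..
      also have "\<dots> \<preceq> least_new p z \<oplus> j"
        using less unfolding Suc_le by (rule N.add_right_mono)
      also have "\<dots> \<preceq> x"
        using ih[unfolded P_def, rule_format, OF \<open>p \<prec> b\<close> b p z(1) less cp] .
      finally show "least_new z z' \<oplus> (j \<oplus> \<one>) \<preceq> x" .
    qed
  qed
  moreover have "z' \<prec> b"
    using consec_D(3)[OF assms(5)] assms(7) by (rule N.less_trans)
  moreover have "z \<prec> b"
    using consec_D(3)[OF assms(4)] \<open>z' \<prec> b\<close> by (rule N.less_trans)
  ultimately show ?thesis
    using assms(4-7) unfolding P_def by blast
qed

text \<open>Past index \<open>x\<close> there is no descent, so the values weakly increase. A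
  repeated value cannot be a number that enters twice; it is the default \<open>z\<close>, which is
  at least its own index. Either way the value is at least \<open>i\<close>.\<close>

lemma ascent_bound:
  assumes "Y \<in> Sets M" and "\<forall>z\<in>Y. \<not> occ peaks Y z" and "\<one> \<oplus> \<one> \<preceq> cnt Y x"
    and "consec Y z z'" and "cnt Y z = x \<oplus> \<one> \<oplus> i" and "z' \<prec> b"
  shows "i \<preceq> least_new z z'"
proof -
  let ?P = "\<lambda>i z z'. consec Y z z' \<longrightarrow> cnt Y z = x \<oplus> \<one> \<oplus> i \<longrightarrow> i \<preceq> least_new z z'"
  have "\<forall>z. z \<prec> b \<longrightarrow> (\<forall>z'. z' \<prec> b \<longrightarrow> ?P i z z')"
  proof (rule induct_D1[where P="\<lambda>i. \<forall>z. z \<prec> b \<longrightarrow> (\<forall>z'. z' \<prec> b \<longrightarrow> ?P i z z')"])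
    show "D1 (\<lambda>e. \<forall>z. z \<prec> b \<longrightarrow> (\<forall>z'. z' \<prec> b \<longrightarrow> ?P (e 0) z z'))"
      by (intro D1_intros D1_consec F1_least_new F1_cnt F1_var F1_const F1_plus assms(1))
    show "\<forall>z. z \<prec> b \<longrightarrow> (\<forall>z'. z' \<prec> b \<longrightarrow> ?P \<zero> z z')"
      by (simp add: zero_le)
    fix i
    assume ih: "\<forall>z. z \<prec> b \<longrightarrow> (\<forall>z'. z' \<prec> b \<longrightarrow> ?P i z z')"
    show "\<forall>z. z \<prec> b \<longrightarrow> (\<forall>z'. z' \<prec> b \<longrightarrow> ?P (i \<oplus> \<one>) z z')"
    proof (intro allI impI)
      fix z z'
      assume b: "z \<prec> b" "z' \<prec> b" and z: "consec Y z z'" and i: "cnt Y z = x \<oplus> \<one> \<oplus> (i \<oplus> \<one>)"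
      have i': "cnt Y z = x \<oplus> \<one> \<oplus> i \<oplus> \<one>"
        unfolding i by (rule plus_Suc)
      obtain w where w: "w \<prec> z" "w \<in> Y"
        using ex_index[OF assms(1), of "x \<oplus> \<one> \<oplus> i" z] i' less_Suc_self by metis
      obtain p where p: "consec Y p z"
        using ex_pred[OF assms(1) w(2) consec_D(1) w(1)] z(1) by blast
      have cp: "cnt Y p = x \<oplus> \<one> \<oplus> i"
        using cnt_consec[OF assms(1) p] i' Suc_inject by metis
      have "p \<prec> b"
        using consec_D(3)[OF p] b(1) by (rule N.less_trans)
      then have "i \<preceq> least_new p z"
        using ih b(1) p cp by blast
      have asc: "least_new p z \<preceq> least_new z z'"
      proof (rule ccontr)
        assume "\<not> ?thesis"
        then have "least_new z z' \<prec> least_new p z"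
          using N.not_less by blast
        from descent_bound[OF assms(1-3) p z this b(2)] have "least_new p z \<oplus> (x \<oplus> \<one> \<oplus> i) \<preceq> x"
          unfolding cp .
        moreover have "x \<prec> x \<oplus> \<one> \<oplus> i"
          using le_plus1 unfolding Suc_le .
        moreover have "x \<oplus> \<one> \<oplus> i \<preceq> least_new p z \<oplus> (x \<oplus> \<one> \<oplus> i)"
          by (rule le_plus2)
        ultimately show False
          using N.not_less N.order_trans by blast
      qed
      have "i \<oplus> \<one> \<preceq> least_new z z'"
      proof (cases "least_new p z = least_new z z'")
        case False
        with asc have "least_new p z \<prec> least_new z z'"
          unfolding nle_def by blast
        with \<open>i \<preceq> least_new p z\<close> show ?thesis
          unfolding Suc_le[symmetric] by (rule N.le_less_trans)
      next
        case True
        let ?k = "least_new p z"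
        have "?k \<prec> z'"
          using least_new_le_right consec_D(3)[OF z] by (rule N.le_less_trans)
        then have "\<not> enum_by ?k z"
          using least_new_enters[of z z'] less_irrefl unfolding enters_def True by metis
        then have "?k = z"
          using least_new_enters[of p z] unfolding enters_def by blast
        have "i \<oplus> \<one> \<preceq> cnt Y z"
          unfolding i by (rule le_plus2)
        also have "\<dots> \<preceq> z"
          by (rule cnt_le[OF assms(1)])
        finally show ?thesis
          using True \<open>?k = z\<close> by simp
      qed
      then show "i \<oplus> \<one> \<preceq> least_new z z'" .
    qed
  qed
  moreover have "z \<prec> b"
    using consec_D(3)[OF assms(4)] assms(6) by (rule N.less_trans)
  ultimately show ?thesis
    using assms by blast
qed

text \<open>A long enough finite free set that keeps pace with \<open>X\<close> has an element past
  stage \<open>m\<close>, so \<open>k\<close> is enumerated along it. From index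
  \<open>x1 \<oplus> \<one> \<oplus> (k \<oplus> \<one>)\<close> on all its values exceed
  \<open>k\<close>, so \<open>k\<close> cannot enter there. Hence \<open>k\<close> is enumerated by
  the element with this index, which lies below \<open>x\<close>.\<close>

lemma dominated_enum_by:
  assumes "X \<in> Sets M" and "infin M X" and "\<And>b. dominated UNIV peaks X b"
    and "cnt X x1 = \<one> \<oplus> \<one>" and "cnt X x = x1 \<oplus> \<one> \<oplus> (k \<oplus> \<one>) \<oplus> \<one>" and "pair M k m \<in> Z"
  shows "enum_by k x"
proof (rule ccontr)
  assume not: "\<not> enum_by k x"
  \<comment> \<open>Large enough for the free set to reach stage \<open>m\<close> and for counts to
    be compared at \<open>x\<close> and at \<open>x1\<close>.\<close>
  define n where "n = m \<oplus> (x \<oplus> x1) \<oplus> \<one>"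
  obtain b where b: "cnt X b = n"
    using ex_cnt_infin[OF assms(1,2)] by blast
  have "n \<preceq> b"
    using cnt_le[OF assms(1), of b] b by simp
  have "m \<prec> n" "x \<oplus> x1 \<prec> n"
    unfolding n_def by (rule less_plus1, rule less_plus2)
  then have "x \<preceq> b" "x1 \<preceq> b"
    using \<open>n \<preceq> b\<close> le_plus1[of x x1] le_plus2[of x1 x] N.order_trans N.less_imp_le by blast+
  obtain y where y: "\<forall>z\<in>elts M y. z \<prec> b" "\<forall>z\<in>elts M y. \<not> occ peaks (elts M y) z"
    "\<forall>v. v \<preceq> b \<longrightarrow> cnt X v \<preceq> cnt (elts M y) v"
    using assms(3) unfolding dominated_iff by blast
  define Y where "Y = elts M y"
  note y = y[folded Y_def]
  have Y: "Y \<in> Sets M"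
    unfolding Y_def by (rule elts_Sets)
  have "m \<prec> cnt Y b"
    using y(3) b nle_refl \<open>m \<prec> n\<close> N.less_le_trans by metis
  then obtain l where l: "l \<in> Y" "cnt Y l = m"
    using ex_index[OF Y] by blast
  then have "enum_by k l"
    using cnt_le[OF Y, of l] assms(6) unfolding enum_by_def by blast
  \<comment> \<open>The last \<open>\<one>\<close> in the count at \<open>x\<close> is the step from
    an index to a count.\<close>
  have "x1 \<oplus> \<one> \<oplus> (k \<oplus> \<one>) \<prec> cnt Y x"
    using y(3) \<open>x \<preceq> b\<close> assms(5) unfolding Suc_le by metis
  then obtain v where v: "v \<prec> x" "v \<in> Y" "cnt Y v = x1 \<oplus> \<one> \<oplus> (k \<oplus> \<one>)"
    using ex_index[OF Y] by blast
  have "\<not> enum_by k v"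
    using not v(1) enum_by_mono N.less_imp_le by blast
  have "D1 (\<lambda>e. e 0 \<in> Y \<and> enum_by k (e 0))"
    by (intro D1_intros D1_enum_by F1_intros Y)
  moreover have "l \<in> Y \<and> enum_by k l"
    using l \<open>enum_by k l\<close> by blast
  ultimately obtain w where w: "w \<in> Y \<and> enum_by k w" "\<And>j. j \<prec> w \<Longrightarrow> \<not> (j \<in> Y \<and> enum_by k j)"
    by (rule least_D1) blast
  then have "v \<prec> w"
    using \<open>\<not> enum_by k v\<close> enum_by_mono N.not_less by blast
  then obtain p where p: "consec Y p w" "v \<preceq> p"
    using ex_pred[OF Y v(2)] w(1) by blast
  then have "\<not> enum_by k p"
    using w(2) unfolding consec_def by blast
  then have "least_new p w \<preceq> k"
    using w(1) by (intro least_new_le) (simp add: enters_def)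
  obtain i where i: "cnt Y p = i \<oplus> (x1 \<oplus> \<one> \<oplus> (k \<oplus> \<one>))"
    using cnt_mono[OF Y p(2)] unfolding v(3) nle_iff by metis
  then have "cnt Y p = x1 \<oplus> \<one> \<oplus> (i \<oplus> (k \<oplus> \<one>))"
    by (simp only: plus_left_commute)
  moreover have "\<one> \<oplus> \<one> \<preceq> cnt Y x1"
    using y(3) \<open>x1 \<preceq> b\<close> assms(4) by metis
  moreover have "w \<prec> b"
    using w(1) y(1) by blast
  ultimately have "i \<oplus> (k \<oplus> \<one>) \<preceq> least_new p w"
    using ascent_bound[OF Y y(2) _ p(1)] by blast
  then have "k \<oplus> \<one> \<preceq> k"
    using le_plus2 \<open>least_new p w \<preceq> k\<close> N.order_trans by blast
  then show False
    unfolding Suc_le[symmetric] by (simp add: less_irrefl)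
qed

text \<open>If compactness fails at \<open>X\<close>, then \<open>X\<close> serves as a parameter
  that bounds the stage of \<open>k\<close>: it suffices to inspect a number \<open>x\<close> whose
  count is the one in \<open>dominated_enum_by\<close>. So non-membership is Sigma01 too. If
  compactness never fails, the peaks give a spread.\<close>

lemma projection_or_spread: "{k. \<exists>m. pair M k m \<in> Z} \<in> Sets M \<or> spread M UNIV peaks"
proof (cases "\<exists>X. X \<in> Sets M \<and> infin M X \<and> (\<forall>b. dominated UNIV peaks X b)")
  case True
  then obtain X where X: "X \<in> Sets M" "infin M X" "\<And>b. dominated UNIV peaks X b"
    by blast
  obtain x1 where x1: "cnt X x1 = \<one> \<oplus> \<one>"
    using ex_cnt_infin[OF X(1,2)] by blast
  let ?N = "\<lambda>k. x1 \<oplus> \<one> \<oplus> (k \<oplus> \<one>) \<oplus> \<one>"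
  have "S1 (\<lambda>e. \<exists>m. pair M (e 0) m \<in> Z)"
    by (rule S1_ex, rule D1_S1) (intro D1_intros F1_intros Z_Sets)
  moreover have "S1 (\<lambda>e. \<not> (\<exists>m. pair M (e 0) m \<in> Z))"
  proof -
    have "S1 (\<lambda>e. \<exists>x. cnt X x = ?N (e 0) \<and> \<not> enum_by (e 0) x)"
      by (rule S1_ex, rule D1_S1) (intro D1_intros D1_enum_by F1_cnt F1_intros X)
    moreover have "(\<exists>x. cnt X x = ?N k \<and> \<not> enum_by k x) \<longleftrightarrow> \<not> (\<exists>m. pair M k m \<in> Z)" for k
    proof -
      obtain x where "cnt X x = ?N k"
        using ex_cnt_infin[OF X(1,2)] by blast
      moreover have "enum_by k x \<Longrightarrow> \<exists>m. pair M k m \<in> Z" for x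
        unfolding enum_by_def by blast
      ultimately show ?thesis
        using dominated_enum_by[OF X x1] by blast
    qed
    ultimately show ?thesis
      by simp
  qed
  ultimately have "D1 (\<lambda>e. \<exists>m. pair M (e 0) m \<in> Z)"
    by (rule D1I)
  then have "{k. \<exists>m. pair M k m \<in> Z} \<in> Sets M"
    by (rule comprehension)
  then show ?thesis ..
next
  case False
  have "spread M UNIV peaks"
  proof (unfold_locales)
    show "\<forall>u\<in>peaks. is_fincode M u"
      unfolding peaks_def by blast
    show "\<exists>b. \<not> dominated UNIV peaks X b" if "X \<in> Sets M" "infin M X" for X
      using False that by blast
  qed (use UNIV_Sets infin_UNIV peaks_Sets peaks_antichain peaks_indep in blast)+
  then show ?thesis ..
qed

end

lemma (in rca) bqo3_projection:
  assumes "is_bqo M (discrete3 M)" and "Z \<in> Sets M"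
  shows "{k. \<exists>m. pair M k m \<in> Z} \<in> Sets M"
proof -
  interpret enumeration M Z
    by unfold_locales (rule assms(2))
  show ?thesis
    using projection_or_spread spread.not_bqo_discrete3 assms(1) by blast
qed

section \<open>Paths through bounded trees\<close>

locale aca = rca +
  assumes projection: "\<And>Z. Z \<in> Sets M \<Longrightarrow> {k. \<exists>m. pair M k m \<in> Z} \<in> Sets M"
begin

text \<open>The argument and the witness of the normal form are coded as a pair, so the relation
  becomes the projection of a set of the model. Iterating this handles quantifiers one at a
  time.\<close>

lemma S1_D1_1:
  assumes "S1 (\<lambda>e. R (e 0))"
  shows "D1 (\<lambda>e. R (e 0))"
proof -
  obtain Q where Q: "D0 (\<lambda>e. Q (\<lambda>i. e (Suc i)) (e 0))" "(\<lambda>e. R (e 0)) = (\<lambda>e. \<exists>a. Q e a)"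
    using S1E[OF assms] .
  have R: "R x \<longleftrightarrow> (\<exists>a. Q (x ## undefined) a)" for x
    using fun_cong[OF Q(2), of "x ## undefined"] by simp
  have "D0 (\<lambda>e. Q (e 0 ## undefined) (e (Suc 0)))"
    using D0_subst[where \<sigma>="\<lambda>i e. (e (Suc 0) ## e 0 ## undefined) i", OF Q(1)
      T0_cons[OF T0_var T0_cons[OF T0_var T0_const]]]
    by simp
  then have Q': "D1 (\<lambda>e. Q (e 0 ## undefined) (e 1))"
    using D1_D0 by simp
  let ?Z = "{p. \<exists>x. x \<preceq> p \<and> (\<exists>a. a \<preceq> p \<and> p = pair M x a \<and> Q (x ## undefined) a)}"
  have "?Z \<in> Sets M"
    by (rule comprehension) (intro D1_intros F1_var F1_pair D1_sub2[where R="\<lambda>x. Q (x ## undefined)", OF Q'])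
  then have "{k. \<exists>m. pair M k m \<in> ?Z} \<in> Sets M"
    by (rule projection)
  moreover have "{k. \<exists>m. pair M k m \<in> ?Z} = {k. R k}"
    unfolding R by (auto simp: pair_inject le_pair1 le_pair2)
  ultimately have "D1 (\<lambda>e. e 0 \<in> {k. R k})"
    by (intro D1_mem F1_var) simp
  then show ?thesis
    by simp
qed

text \<open>Projection yields sets of numbers, hence the two arguments are first paired into
  one.\<close>

lemma S1_D1_2:
  assumes "S1 (\<lambda>e. R (e 0) (e 1))" and "F1 s" and "F1 t"
  shows "D1 (\<lambda>e. R (s e) (t e))"
proof -
  let ?R = "\<lambda>p. \<exists>x y. p = pair M x y \<and> R x y"
  have "S1 (\<lambda>e. ?R (e 0))"
    by (intro S1_ex S1_and D1_S1[OF D1_eq] F1_var F1_pair S1_sub2[OF assms(1)])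
  from D1_sub1[OF S1_D1_1[OF this] F1_pair[OF assms(2,3)]] show ?thesis
    by (simp add: pair_inject)
qed

lemma S1_D1_3:
  assumes "S1 (\<lambda>e. R (e 0) (e 1) (e 2))" and "F1 s" and "F1 t" and "F1 u"
  shows "D1 (\<lambda>e. R (s e) (t e) (u e))"
proof -
  let ?R = "\<lambda>p z. \<exists>x y. p = pair M x y \<and> R x y z"
  have "S1 (\<lambda>e. ?R (e 0) (e 1))"
    by (intro S1_ex S1_and D1_S1[OF D1_eq] F1_var F1_pair S1_sub3[OF assms(1)])
  from S1_D1_2[OF this F1_pair[OF assms(2,3)] assms(4)] show ?thesis
    by (simp add: pair_inject)
qed

end

text \<open>The nodes of level \<open>b\<close> are sets of numbers below \<open>b\<close>, hence
  0-1 sequences. The tree branches in two, and a path can be found by always taking the preferred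
  extendible branch.\<close>

locale bounded_tree = aca +
  fixes D I X :: "'a set"
  assumes D_Sets: "D \<in> Sets M" and I_Sets: "I \<in> Sets M" and I_fincode: "\<forall>u\<in>I. is_fincode M u"
    and X_Sets: "X \<in> Sets M" and X_infin: "infin M X"
    and dominated: "\<And>b. dominated D I X b"
begin

section \<open>Extendible nodes and the leftmost branch\<close>

abbreviation nd :: "'a \<Rightarrow> 'a \<Rightarrow> bool" where
  "nd \<equiv> node D I X"

lemma D1_node: "F1 s \<Longrightarrow> F1 t \<Longrightarrow> D1 (\<lambda>e. nd (s e) (t e))"
proof (rule D1_sub2)
  show "D1 (\<lambda>e. nd (e 0) (e 1))"
    unfolding node_def
    by (intro D1_code_intros D1_occ F1_cnt F1_cnt_elts F1_intros D_Sets I_Sets I_fincode X_Sets)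
qed

definition extendible :: "'a \<Rightarrow> 'a \<Rightarrow> bool" where
  "extendible y b \<longleftrightarrow> (\<forall>c. b \<preceq> c \<longrightarrow> (\<exists>z. nd c z \<and> (\<forall>x. x \<prec> b \<longrightarrow> (x \<in> elts M z \<longleftrightarrow> x \<in> elts M y))))"

text \<open>The preferred branch takes \<open>x\<close> in whenever nodes of arbitrary height remain
  above that choice. The resulting path has the lexicographically greatest characteristic
  function.\<close>

definition turns :: "'a \<Rightarrow> 'a \<Rightarrow> bool" where
  "turns y x \<longleftrightarrow> (\<exists>z. x \<in> elts M z \<and> (\<forall>w. w \<prec> x \<longrightarrow> (w \<in> elts M z \<longleftrightarrow> w \<in> elts M y)) \<and> extendible z (x \<oplus> \<one>))"

definition leftmost :: "'a \<Rightarrow> 'a \<Rightarrow> bool" where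
  "leftmost y b \<longleftrightarrow> (\<forall>x. x \<prec> b \<longrightarrow> (x \<in> elts M y \<longleftrightarrow> turns y x))"

lemma D1_extendible:
  assumes "F1 s" and "F1 t"
  shows "D1 (\<lambda>e. extendible (s e) (t e))"
proof -
  have 1: "D1 (\<lambda>e. \<exists>z. nd (r e) z \<and> (\<forall>x. x \<prec> t e \<longrightarrow> (x \<in> elts M z \<longleftrightarrow> x \<in> elts M (s e))))"
    if "F1 r" "F1 s" "F1 t" for r s t
    by (rule S1_D1_3[where R="\<lambda>c y b. \<exists>z. nd c z \<and> (\<forall>x. x \<prec> b \<longrightarrow> (x \<in> elts M z \<longleftrightarrow> x \<in> elts M y))", OF _ that])
      (rule S1_ex, rule D1_S1, intro D1_code_intros D1_node F1_var)
  have "D1 (\<lambda>e. \<exists>c. t e \<preceq> c \<and> \<not> (\<exists>z. nd c z \<and> (\<forall>x. x \<prec> t e \<longrightarrow> (x \<in> elts M z \<longleftrightarrow> x \<in> elts M (s e)))))"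
    by (rule S1_D1_2[where R="\<lambda>y b. \<exists>c. b \<preceq> c \<and> \<not> (\<exists>z. nd c z \<and> (\<forall>x. x \<prec> b \<longrightarrow> (x \<in> elts M z \<longleftrightarrow> x \<in> elts M y)))", OF _ assms])
      (rule S1_ex, rule D1_S1, rule D1_and, rule D1_le, (rule F1_var)+, rule D1_not, rule 1, (rule F1_var)+)
  then have "D1 (\<lambda>e. \<not> (\<exists>c. t e \<preceq> c \<and> \<not> (\<exists>z. nd c z \<and> (\<forall>x. x \<prec> t e \<longrightarrow> (x \<in> elts M z \<longleftrightarrow> x \<in> elts M (s e))))))"
    by (rule D1_not)
  then show ?thesis
    unfolding extendible_def by simp
qed

lemma D1_turns:
  assumes "F1 s" and "F1 t"
  shows "D1 (\<lambda>e. turns (s e) (t e))"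
proof (rule S1_D1_2[OF _ assms])
  show "S1 (\<lambda>e. turns (e 0) (e 1))"
    unfolding turns_def
    by (rule S1_ex, rule D1_S1) (intro D1_code_intros D1_extendible F1_var F1_const F1_plus)
qed

lemma D1_leftmost:
  assumes "F1 s" and "F1 t"
  shows "D1 (\<lambda>e. leftmost (s e) (t e))"
proof (rule D1_sub2[OF _ assms])
  show "D1 (\<lambda>e. leftmost (e 0) (e 1))"
    unfolding leftmost_def by (intro D1_code_intros D1_turns F1_var)
qed

lemma turns_cong:
  assumes "\<And>w. w \<prec> x \<Longrightarrow> w \<in> elts M y \<longleftrightarrow> w \<in> elts M y'"
  shows "turns y x \<longleftrightarrow> turns y' x"
  unfolding turns_def using assms by simp

lemma leftmost_unique:
  assumes "leftmost y b" and "leftmost y' b" and "x \<prec> b"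
  shows "x \<in> elts M y \<longleftrightarrow> x \<in> elts M y'"
proof (rule ccontr)
  assume no: "\<not> ?thesis"
  have "D1 (\<lambda>e. \<not> (e 0 \<in> elts M y \<longleftrightarrow> e 0 \<in> elts M y'))"
    by (intro D1_code_intros F1_var F1_const)
  then obtain w where w: "\<not> (w \<in> elts M y \<longleftrightarrow> w \<in> elts M y')"
    "\<And>k. k \<prec> w \<Longrightarrow> \<not> \<not> (k \<in> elts M y \<longleftrightarrow> k \<in> elts M y')"
    using no by (rule least_D1) blast
  have "w \<preceq> x"
    using w(2)[of x] no N.not_less by blast
  then have "w \<prec> b"
    using assms(3) by (rule N.le_less_trans)
  then show False
    using w turns_cong[of w y y'] assms(1,2) unfolding leftmost_def by blast
qed

text \<open>If taking \<open>b\<close> in is not extendible, that choice dies at some level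
  \<open>d\<close>. An extension of \<open>y\<close> at a level above both \<open>c\<close> and
  \<open>d\<close> then omits \<open>b\<close>, and its truncation to \<open>c\<close> shows that
  omitting \<open>b\<close> is extendible.\<close>

lemma ex_leftmost: "\<exists>y. leftmost y b \<and> extendible y b"
proof (rule induct_S1[where P="\<lambda>b. \<exists>y. leftmost y b \<and> extendible y b"])
  show "S1 (\<lambda>e. \<exists>y. leftmost y (e 0) \<and> extendible y (e 0))"
    by (rule S1_ex, rule D1_S1) (intro D1_and D1_leftmost D1_extendible F1_var)
  show "\<exists>y. leftmost y \<zero> \<and> extendible y \<zero>"
    using dominated unfolding leftmost_def extendible_def dominated_def by (simp add: not_less_zero)
  fix b
  assume "\<exists>y. leftmost y b \<and> extendible y b"
  then obtain y where y: "leftmost y b" "extendible y b"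
    by blast
  have leftmost_Suc: "leftmost z (b \<oplus> \<one>)"
    if agree: "\<And>w. w \<prec> b \<Longrightarrow> w \<in> elts M z \<longleftrightarrow> w \<in> elts M y" and b: "b \<in> elts M z \<longleftrightarrow> turns y b" for z
    unfolding leftmost_def less_Suc
  proof (intro allI impI)
    fix x assume x: "x \<prec> b \<or> x = b"
    have "w \<in> elts M z \<longleftrightarrow> w \<in> elts M y" if "w \<prec> x" for w
      using agree x N.less_trans[OF that] that by blast
    then have "turns z x \<longleftrightarrow> turns y x"
      by (rule turns_cong)
    then show "x \<in> elts M z \<longleftrightarrow> turns z x"
      using x agree b y(1) unfolding leftmost_def by blast
  qed
  show "\<exists>z. leftmost z (b \<oplus> \<one>) \<and> extendible z (b \<oplus> \<one>)"
  proof (cases "turns y b")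
    case True
    then obtain z where "b \<in> elts M z" "\<And>w. w \<prec> b \<Longrightarrow> w \<in> elts M z \<longleftrightarrow> w \<in> elts M y"
      "extendible z (b \<oplus> \<one>)"
      unfolding turns_def by blast
    then show ?thesis
      using leftmost_Suc[of z] True by blast
  next
    case False
    let ?Z = "{x \<in> elts M y. x \<prec> b}"
    have Fin: "Fin ?Z"
      by (intro Fin_below elts_Sets)
    have Z: "elts M (code ?Z) = ?Z"
      by (rule code_props(2)[OF Fin])
    have Z1: "elts M (code (insert b ?Z)) = insert b ?Z"
      by (rule code_props(2)[OF Fin_insertI[OF Fin]])
    have "leftmost (code ?Z) (b \<oplus> \<one>)"
      using False by (intro leftmost_Suc) (simp_all add: Z less_irrefl)
    moreover have "extendible (code ?Z) (b \<oplus> \<one>)"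
      unfolding extendible_def
    proof (intro allI impI)
      fix c assume c: "b \<oplus> \<one> \<preceq> c"
      have "\<not> extendible (code (insert b ?Z)) (b \<oplus> \<one>)"
        using False unfolding turns_def
        by (auto simp: Z1 dest!: spec[of _ "code (insert b ?Z)"] less_irrefl[THEN notE])
      then obtain d where d: "b \<oplus> \<one> \<preceq> d"
        "\<And>z. nd d z \<Longrightarrow> \<not> (\<forall>x. x \<prec> b \<oplus> \<one> \<longrightarrow> (x \<in> elts M z \<longleftrightarrow> x \<in> insert b ?Z))"
        unfolding extendible_def Z1 by blast
      have "b \<preceq> c \<oplus> d" "c \<preceq> c \<oplus> d" "d \<preceq> c \<oplus> d"
        using N.order_trans[OF N.order_trans[OF le_plus1[of b \<one>] c] le_plus1] le_plus1 le_plus2 by blast+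
      then obtain z where z: "nd (c \<oplus> d) z" "\<And>x. x \<prec> b \<Longrightarrow> x \<in> elts M z \<longleftrightarrow> x \<in> elts M y"
        using y(2) unfolding extendible_def by blast
      let ?R = "\<lambda>c. {x \<in> elts M z. x \<prec> c}"
      have R: "nd c' (code (?R c'))" "elts M (code (?R c')) = ?R c'" if "c' \<preceq> c \<oplus> d" for c'
        using node_below[OF X_Sets X_Sets z(1) that] code_props(2)[OF Fin_below[OF elts_Sets]] by blast+
      have "b \<notin> elts M z"
      proof
        assume b: "b \<in> elts M z"
        have "x \<in> ?R d \<longleftrightarrow> x \<in> insert b ?Z" if "x \<prec> b \<oplus> \<one>" for x
        proof -
          have "x \<prec> d"
            using that d(1) by (rule N.less_le_trans)
          then show ?thesis
            using that z(2) b unfolding less_Suc by blast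
        qed
        then show False
          using d(2)[OF R(1)[OF \<open>d \<preceq> c \<oplus> d\<close>]] R(2)[OF \<open>d \<preceq> c \<oplus> d\<close>] by simp
      qed
      have "x \<in> ?R c \<longleftrightarrow> x \<in> ?Z" if "x \<prec> b \<oplus> \<one>" for x
      proof -
        have "x \<prec> c"
          using that c by (rule N.less_le_trans)
        then show ?thesis
          using that z(2) \<open>b \<notin> elts M z\<close> less_irrefl unfolding less_Suc by blast
      qed
      then show "\<exists>z. nd c z \<and> (\<forall>x. x \<prec> b \<oplus> \<one> \<longrightarrow> (x \<in> elts M z \<longleftrightarrow> x \<in> elts M (code ?Z)))"
        unfolding Z using R[OF \<open>c \<preceq> c \<oplus> d\<close>] by (intro exI[of _ "code (?R c)"]) simp
    qed
    ultimately show ?thesis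
      by blast
  qed
qed

section \<open>The infinite free set given by the path\<close>

definition path :: "'a set" where
  "path = {x. \<exists>y. leftmost y (x \<oplus> \<one>) \<and> x \<in> elts M y}"

lemma path_Sets: "path \<in> Sets M"
proof -
  have "S1 (\<lambda>e. \<exists>y. leftmost y (e 0 \<oplus> \<one>) \<and> e 0 \<in> elts M y)"
    by (rule S1_ex, rule D1_S1) (intro D1_and D1_leftmost D1_elts F1_var F1_plus F1_const)
  from comprehension[OF S1_D1_1[where R="\<lambda>x. \<exists>y. leftmost y (x \<oplus> \<one>) \<and> x \<in> elts M y", OF this]]
  show ?thesis
    unfolding path_def .
qed

lemma path_node: "\<exists>y. nd b y \<and> (\<forall>x. x \<prec> b \<longrightarrow> (x \<in> path \<longleftrightarrow> x \<in> elts M y))"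
proof -
  obtain y where y: "leftmost y b" "extendible y b"
    using ex_leftmost by blast
  have "x \<in> path \<longleftrightarrow> x \<in> elts M y" if "x \<prec> b" for x
  proof -
    have "w \<prec> b" if "w \<prec> x \<oplus> \<one>" for w
      using that \<open>x \<prec> b\<close> N.le_less_trans unfolding nle_Suc by blast
    then have "leftmost y (x \<oplus> \<one>)"
      using y(1) unfolding leftmost_def by blast
    then show ?thesis
      unfolding path_def mem_Collect_eq using leftmost_unique[OF _ _ less_Suc_self] by blast
  qed
  then show ?thesis
    using y(2) nle_refl unfolding extendible_def by blast
qed

lemma path_subset: "path \<subseteq> D"
proof
  fix x assume "x \<in> path"
  then show "x \<in> D"
    using path_node[of "x \<oplus> \<one>"] less_Suc_self unfolding node_def by blast
qed

text \<open>An occurrence involves only the elements of \<open>u\<close>, which are below the code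
  \<open>u\<close>. It would therefore appear already in a node of level
  \<open>z \<oplus> u \<oplus> \<one>\<close>.\<close>

lemma path_free:
  assumes "z \<in> path"
  shows "\<not> occ I path z"
proof
  assume "occ I path z"
  then obtain u where u: "u \<in> I" "init_seg M (elts M u) (tail z path)"
    unfolding occ_def by blast
  obtain y where y: "nd (z \<oplus> u \<oplus> \<one>) y" "\<And>x. x \<prec> z \<oplus> u \<oplus> \<one> \<Longrightarrow> x \<in> path \<longleftrightarrow> x \<in> elts M y"
    using path_node by blast
  have less: "x \<prec> z \<oplus> u \<oplus> \<one>" if "x \<in> elts M u" for x
    using elts_less[OF that] less_plus2 by (rule N.less_trans)
  have "elts M y \<subseteq> path"
    using y unfolding node_def by blast
  then have "init_seg M (elts M u) (tail z (elts M y))"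
    using u(2) y(2) less by (intro init_seg_between[OF u(2)]) (auto simp: init_seg_def tail_def)
  then have occ: "occ I (elts M y) z"
    using u(1) unfolding occ_def by blast
  then show False
    using assms y less_plus1[of z u] unfolding node_def by blast
qed

text \<open>Nodes keep pace with the infinite \<open>X\<close>, so the path has an element of index
  \<open>n \<oplus> \<one>\<close>, and an element is at least its index.\<close>

lemma path_infin: "infin M path"
  unfolding infin_def
proof
  fix n
  obtain x where x: "cnt X x = n \<oplus> \<one> \<oplus> \<one>"
    using ex_cnt_infin[OF X_Sets X_infin] by blast
  obtain y where y: "nd x y" "\<And>z. z \<prec> x \<Longrightarrow> z \<in> path \<longleftrightarrow> z \<in> elts M y"
    using path_node by blast
  have "cnt X x \<preceq> cnt (elts M y) x"
    using y(1) nle_refl unfolding node_def by blast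
  then have "n \<oplus> \<one> \<prec> cnt (elts M y) x"
    unfolding x Suc_le .
  then obtain z where z: "z \<prec> x" "z \<in> elts M y" "cnt (elts M y) z = n \<oplus> \<one>"
    using ex_index[OF elts_Sets] by blast
  then have "n \<prec> z"
    using cnt_le[OF elts_Sets, of y z] unfolding Suc_le by simp
  then show "\<exists>m\<in>path. n \<prec> m"
    using y(2)[OF z(1)] z(2) by blast
qed

end

section \<open>Bad functions into a sum of two well orders\<close>

context aca
begin

section \<open>The sum of a quasi order with itself\<close>

lemma S1_Sets:
  assumes "S1 (\<lambda>e. R (e 0))"
  shows "{x. R x} \<in> Sets M"
  by (rule comprehension) (rule S1_D1_1[OF assms])

lemma ord_sum_le:
  "ord_le M (ord_sum M W W) (pair M i p) (pair M j q) \<longleftrightarrow>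
     i = j \<and> (i = \<zero> \<or> i = \<one>) \<and> p \<in> fst W \<and> q \<in> fst W \<and> ord_le M W p q"
  unfolding ord_le_def ord_sum_def by (auto simp: pair_inject)

lemma in_ord_sum: "pair M i p \<in> fst (ord_sum M W W) \<longleftrightarrow> (i = \<zero> \<or> i = \<one>) \<and> p \<in> fst W"
  unfolding ord_sum_def by (auto simp: pair_inject)

lemma ord_sumE:
  assumes "x \<in> fst (ord_sum M W W)"
  obtains i p where "x = pair M i p" "i = \<zero> \<or> i = \<one>" "p \<in> fst W"
  using assms unfolding ord_sum_def by auto

lemma quasi_order_ord_sum:
  assumes "is_quasi_order M W"
  shows "is_quasi_order M (ord_sum M W W)"
proof -
  have W: "fst W \<in> Sets M" "snd W \<in> Sets M"
    using assms unfolding is_quasi_order_def by blast+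
  have "{x. \<exists>i p. (i = \<zero> \<or> i = \<one>) \<and> p \<in> fst W \<and> x = pair M i p} \<in> Sets M"
    by (rule S1_Sets, rule S1_ex, rule S1_ex, rule D1_S1) (intro D1_intros F1_var F1_const F1_pair W)
  moreover have "{x. \<exists>i p. (i = \<zero> \<or> i = \<one>) \<and> p \<in> fst W \<and> x = pair M i p} = fst (ord_sum M W W)"
    unfolding ord_sum_def fst_conv by blast
  ultimately have 1: "fst (ord_sum M W W) \<in> Sets M"
    by simp
  have "{x. \<exists>i p q. (i = \<zero> \<or> i = \<one>) \<and> p \<in> fst W \<and> q \<in> fst W \<and> pair M p q \<in> snd W \<and>
      x = pair M (pair M i p) (pair M i q)} \<in> Sets M"
    by (rule S1_Sets, rule S1_ex, rule S1_ex, rule S1_ex, rule D1_S1)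
      (intro D1_intros F1_var F1_const F1_pair W)
  moreover have "{x. \<exists>i p q. (i = \<zero> \<or> i = \<one>) \<and> p \<in> fst W \<and> q \<in> fst W \<and> pair M p q \<in> snd W \<and>
      x = pair M (pair M i p) (pair M i q)} = snd (ord_sum M W W)"
    unfolding ord_sum_def ord_le_def snd_conv by blast
  ultimately have 2: "snd (ord_sum M W W) \<in> Sets M"
    by simp
  have 3: "snd (ord_sum M W W) \<subseteq>
      {pair M p q | p q. p \<in> fst (ord_sum M W W) \<and> q \<in> fst (ord_sum M W W)}"
    unfolding ord_sum_def fst_conv snd_conv by blast
  have 4: "ord_le M (ord_sum M W W) p p" if p: "p \<in> fst (ord_sum M W W)" for p
  proof -
    obtain i a where a: "p = pair M i a" "i = \<zero> \<or> i = \<one>" "a \<in> fst W"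
      using ord_sumE[OF p] .
    moreover have "ord_le M W a a"
      using assms a(3) unfolding is_quasi_order_def by blast
    ultimately show ?thesis
      unfolding a(1) ord_sum_le by blast
  qed
  have 5: "ord_le M (ord_sum M W W) p r"
    if p: "p \<in> fst (ord_sum M W W)" and q: "q \<in> fst (ord_sum M W W)" and r: "r \<in> fst (ord_sum M W W)"
      and le: "ord_le M (ord_sum M W W) p q \<and> ord_le M (ord_sum M W W) q r" for p q r
  proof -
    obtain i a where a: "p = pair M i a" "a \<in> fst W"
      using ord_sumE[OF p] by blast
    obtain j b where b: "q = pair M j b" "b \<in> fst W"
      using ord_sumE[OF q] by blast
    obtain k c where c: "r = pair M k c" "c \<in> fst W"
      using ord_sumE[OF r] by blast
    have "ord_le M W a b" "ord_le M W b c"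
      using le unfolding a(1) b(1) c(1) ord_sum_le by blast+
    then have "ord_le M W a c"
      using assms a(2) b(2) c(2) unfolding is_quasi_order_def by blast
    then show ?thesis
      using le unfolding a(1) b(1) c(1) ord_sum_le by blast
  qed
  show ?thesis
    unfolding is_quasi_order_def
    by (intro conjI, rule 1, rule 2, rule 3, intro ballI, erule 4, intro ballI impI, rule 5)
qed

end

locale bad_function = aca +
  fixes B f :: "'a set" and W :: "'a ord"
  assumes barrier: "is_barrier M B" and f_fun: "is_fun M f B (fst (ord_sum M W W))"
    and well_order: "is_well_order M W"
    and bad: "\<And>s t p q. s \<in> B \<Longrightarrow> t \<in> B \<Longrightarrow> tri M s t \<Longrightarrow> pair M s p \<in> f \<Longrightarrow> pair M t q \<in> f \<Longrightarrow>
      \<not> ord_le M (ord_sum M W W) p q"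
begin

section \<open>Basic facts on the barrier and the two sides of the bad function\<close>

lemma B_block: "is_block M B"
  using barrier unfolding is_barrier_def by (rule conjunct1)

lemma B_Sets: "B \<in> Sets M"
  using B_block unfolding is_block_def by (elim conjE)

lemma B_fincode: "s \<in> B \<Longrightarrow> is_fincode M s"
  using B_block unfolding is_block_def by (elim conjE) (erule bspec)

lemma base_infin: "infin M (base M B)"
  using B_block unfolding is_block_def by (elim conjE)

lemma block:
  assumes "X \<in> Sets M" and "infin M X" and "X \<subseteq> base M B"
  shows "\<exists>s\<in>B. init_seg M (elts M s) X"
  using B_block assms unfolding is_block_def by simp

lemma B_antichain:
  assumes "s \<in> B" and "t \<in> B" and "elts M s \<subseteq> elts M t"
  shows "s = t"
proof -
  have "\<not> elts M s \<subset> elts M t"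
    using barrier assms(1,2) unfolding is_barrier_def by simp
  with assms(3) have "elts M s = elts M t"
    by blast
  then show ?thesis
    by (rule fincode_unique[OF B_fincode[OF assms(1)] B_fincode[OF assms(2)]])
qed

lemma B_init_seg_unique:
  assumes "s \<in> B" and "t \<in> B" and "init_seg M (elts M s) X" and "init_seg M (elts M t) X"
  shows "s = t"
  using init_seg_linear[OF assms(3,4)] B_antichain[OF assms(1,2)] B_antichain[OF assms(2,1)] by blast

lemma f_Sets: "f \<in> Sets M"
  using f_fun unfolding is_fun_def by blast

text \<open>The locale \<open>spread\<close> asks for a set of the model; the base is one by
  projection.\<close>

lemma base_Sets: "base M B \<in> Sets M"
proof -
  have "{x. \<exists>s. s \<in> B \<and> x \<in> elts M s} \<in> Sets M"
    by (rule S1_Sets, rule S1_ex, rule D1_S1) (intro D1_intros D1_elts F1_var B_Sets)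
  moreover have "{x. \<exists>s. s \<in> B \<and> x \<in> elts M s} = base M B"
    unfolding base_def by blast
  ultimately show ?thesis
    by simp
qed

definition side :: "'a \<Rightarrow> 'a \<Rightarrow> bool" where
  "side i s \<longleftrightarrow> (\<exists>p. pair M s (pair M i p) \<in> f)"

lemma D1_side:
  assumes "F1 t"
  shows "D1 (\<lambda>e. side i (t e))"
proof (rule D1_sub1[OF S1_D1_1 assms])
  show "S1 (\<lambda>e. side i (e 0))"
    unfolding side_def by (rule S1_ex, rule D1_S1) (intro D1_intros F1_var F1_const F1_pair f_Sets)
qed

lemma f_range: "pair M s y \<in> f \<Longrightarrow> y \<in> fst (ord_sum M W W)"
  using f_fun unfolding is_fun_def by (auto simp: pair_inject)

lemma f_value:
  assumes "s \<in> B"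
  obtains i p where "pair M s (pair M i p) \<in> f" "i = \<zero> \<or> i = \<one>" "p \<in> fst W"
proof -
  obtain y where y: "pair M s y \<in> f"
    using f_fun assms unfolding is_fun_def by blast
  then show ?thesis
    using that by (auto elim: ord_sumE[OF f_range])
qed

lemma f_unique: "s \<in> B \<Longrightarrow> pair M s y \<in> f \<Longrightarrow> pair M s z \<in> f \<Longrightarrow> y = z"
  using f_fun unfolding is_fun_def by blast

lemma side_cases: "s \<in> B \<Longrightarrow> side \<zero> s \<or> side \<one> s"
  unfolding side_def by (metis f_value)

lemma side_disjoint: "s \<in> B \<Longrightarrow> side \<zero> s \<Longrightarrow> \<not> side \<one> s"
  unfolding side_def using f_unique pair_inject N.zero_neq_one by metis

text \<open>
  A member of \<open>I\<close> codes \<open>s \<union> t\<close> for some \<open>s \<triangleleft> t\<close> in \<open>B\<close> whose values lie in the first and in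
  the second summand, respectively; here \<open>s \<union> t\<close> is \<open>t\<close> together with one smaller number.
\<close>

definition I :: "'a set" where
  "I = {u. is_fincode M u \<and> (\<exists>a t s. a \<in> elts M u \<and> (\<forall>x\<in>elts M u. a \<preceq> x) \<and>
     t \<in> B \<and> side \<one> t \<and> (\<forall>x\<in>elts M t. x \<in> elts M u \<and> x \<noteq> a) \<and>
     (\<forall>x\<in>elts M u. x \<noteq> a \<longrightarrow> x \<in> elts M t) \<and>
     s \<in> B \<and> side \<zero> s \<and> (\<forall>x\<in>elts M s. x \<in> elts M u) \<and>
     (\<forall>x\<in>elts M u. \<forall>w\<in>elts M s. x \<prec> w \<longrightarrow> x \<in> elts M s))}"

lemma I_Sets: "I \<in> Sets M"
  unfolding I_def
  by (rule S1_Sets, rule S1_and, rule D1_S1, rule D1_fincode, rule F1_var, rule S1_ex, rule S1_ex,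
      rule S1_ex, rule D1_S1) (intro D1_code_intros D1_side F1_var B_Sets)

lemma IE:
  assumes "u \<in> I"
  obtains a t s where "elts M u = insert a (elts M t)" "\<And>x. x \<in> elts M t \<Longrightarrow> a \<prec> x"
    "t \<in> B" "side \<one> t" "s \<in> B" "side \<zero> s" "init_seg M (elts M s) (elts M u)"
proof -
  obtain a t s where u: "a \<in> elts M u" "\<forall>x\<in>elts M u. a \<preceq> x"
     "t \<in> B" "side \<one> t" "\<forall>x\<in>elts M t. x \<in> elts M u \<and> x \<noteq> a"
     "\<forall>x\<in>elts M u. x \<noteq> a \<longrightarrow> x \<in> elts M t"
     "s \<in> B" "side \<zero> s" "\<forall>x\<in>elts M s. x \<in> elts M u"
     "\<forall>x\<in>elts M u. \<forall>w\<in>elts M s. x \<prec> w \<longrightarrow> x \<in> elts M s"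
    using assms unfolding I_def by blast
  have "elts M u = insert a (elts M t)"
    using u(1,5,6) by blast
  moreover have "a \<prec> x" if "x \<in> elts M t" for x
    using u(2,5) that unfolding nle_def by metis
  moreover have "init_seg M (elts M s) (elts M u)"
    using u(9,10) unfolding init_seg_def by blast
  ultimately show ?thesis
    using that u(3,4,7,8) by blast
qed

lemma II:
  assumes "s \<in> B" and "t \<in> B" and "side \<zero> s" and "side \<one> t" and "\<And>x. x \<in> elts M t \<Longrightarrow> a \<prec> x"
    and "init_seg M (elts M s) (insert a (elts M t))"
  shows "code (insert a (elts M t)) \<in> I"
proof -
  have u: "is_fincode M (code (insert a (elts M t)))" "elts M (code (insert a (elts M t))) = insert a (elts M t)"
    using code_props[OF Fin_insert] by blast+
  have a: "\<forall>x\<in>insert a (elts M t). a \<preceq> x" "\<forall>x\<in>elts M t. x \<noteq> a"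
    using assms(5) less_irrefl unfolding nle_def by blast+
  have s: "\<forall>x\<in>elts M s. x \<in> insert a (elts M t)"
    "\<forall>x\<in>insert a (elts M t). \<forall>w\<in>elts M s. x \<prec> w \<longrightarrow> x \<in> elts M s"
    using assms(6) unfolding init_seg_def by blast+
  show ?thesis
    unfolding I_def mem_Collect_eq u(2)
    by (rule conjI[OF u(1)], rule exI[of _ a], rule exI[of _ t], rule exI[of _ s])
      (use assms(1-4) a s in simp)
qed

lemma I_fincode: "\<forall>u\<in>I. is_fincode M u"
  unfolding I_def by blast

text \<open>If the least element \<open>b\<close> of \<open>v\<close> is missing from
  \<open>u\<close>, then \<open>u\<close> lies within \<open>t'\<close>, so \<open>s\<close> is
  contained in \<open>t'\<close> and equals it, although their sides differ. Otherwise
  \<open>a = b\<close>, so \<open>t\<close> is contained in \<open>t'\<close> and equals it, and the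
  two unions coincide.\<close>

lemma I_antichain:
  assumes "u \<in> I" and "v \<in> I"
  shows "\<not> elts M u \<subset> elts M v"
proof
  assume sub: "elts M u \<subset> elts M v"
  obtain a t s where u: "elts M u = insert a (elts M t)" "\<And>x. x \<in> elts M t \<Longrightarrow> a \<prec> x"
    "t \<in> B" "side \<one> t" "s \<in> B" "side \<zero> s" "init_seg M (elts M s) (elts M u)"
    by (rule IE[OF assms(1)]) blast
  obtain b t' s' where v: "elts M v = insert b (elts M t')" "\<And>x. x \<in> elts M t' \<Longrightarrow> b \<prec> x"
    "t' \<in> B" "side \<one> t'"
    by (rule IE[OF assms(2)]) blast
  have sub': "insert a (elts M t) \<subseteq> insert b (elts M t')"
    using sub unfolding u(1) v(1) by (rule psubset_imp_subset)
  show False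
  proof (cases "b \<in> insert a (elts M t)")
    case False
    then have "elts M u \<subseteq> elts M t'"
      using sub' unfolding u(1) by blast
    then have "elts M s \<subseteq> elts M t'"
      using u(7) unfolding init_seg_def by (elim conjE) (rule subset_trans)
    then have "s = t'"
      by (rule B_antichain[OF u(5) v(3)])
    then show False
      using side_disjoint u(5,6) v(4) by blast
  next
    case True
    then have "a \<preceq> b"
      using u(2) unfolding nle_def by blast
    moreover have "b \<preceq> a"
      using sub' v(2) unfolding nle_def by blast
    ultimately have "a = b"
      by (rule nle_antisym)
    then have "elts M t \<subseteq> elts M t'"
      using sub' u(2) less_irrefl by blast
    then have "t = t'"
      by (rule B_antichain[OF u(3) v(3)])
    then show False
      using sub unfolding u(1) v(1) \<open>a = b\<close> by simp
  qed
qed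

text \<open>The second part \<open>t\<close> of \<open>u\<close> and the first part
  \<open>s'\<close> of \<open>v\<close> are both initial segments of \<open>X\<close> without its
  least element. They coincide, yet lie on different sides.\<close>

lemma I_indep:
  assumes "u \<in> I" and "v \<in> I" and "init_seg M (elts M u) X"
  shows "\<not> init_seg M (elts M v) (minus_least M X)"
proof
  assume seg: "init_seg M (elts M v) (minus_least M X)"
  obtain a t s where u: "elts M u = insert a (elts M t)" "\<And>x. x \<in> elts M t \<Longrightarrow> a \<prec> x"
    "t \<in> B" "side \<one> t"
    by (rule IE[OF assms(1)]) blast
  obtain s' where v: "s' \<in> B" "side \<zero> s'" "init_seg M (elts M s') (elts M v)"
    by (rule IE[OF assms(2)]) blast
  have a: "a \<in> X" "\<And>x. x \<in> X \<Longrightarrow> a \<preceq> x"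
  proof -
    show "a \<in> X"
      using assms(3) u(1) unfolding init_seg_def by blast
    show "a \<preceq> x" if "x \<in> X" for x
    proof (rule ccontr)
      assume "\<not> a \<preceq> x"
      then have "x \<prec> a"
        using N.not_less by blast
      then have "x \<in> insert a (elts M t)"
        using assms(3) that unfolding u(1) init_seg_def by blast
      with \<open>x \<prec> a\<close> u(2) show False
        using N.less_asym less_irrefl by blast
    qed
  qed
  have ml: "minus_least M X = {x \<in> X. a \<prec> x}"
    unfolding minus_least_def using a N.le_less_trans by blast
  have "init_seg M (elts M t) (minus_least M X)"
    using assms(3) u(2) less_irrefl unfolding u(1) ml init_seg_def by blast
  moreover have "init_seg M (elts M s') (minus_least M X)"
    using init_seg_trans[OF v(3) seg] .
  ultimately have "t = s'"
    by (rule B_init_seg_unique[OF u(3) v(1)])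
  then show False
    using side_disjoint u(4) v(1,2) by blast
qed

section \<open>Values along the final segments of a set\<close>

definition seg :: "'a set \<Rightarrow> 'a \<Rightarrow> 'a \<Rightarrow> bool" where
  "seg Y z s \<longleftrightarrow> s \<in> B \<and> init_seg M (elts M s) (tail z Y)"

lemma D1_seg:
  assumes "Y \<in> Sets M" and "F1 t" and "F1 u"
  shows "D1 (\<lambda>e. seg Y (t e) (u e))"
proof (rule D1_sub2[OF _ assms(2,3)])
  have "seg Y z s \<longleftrightarrow> s \<in> B \<and> (\<forall>x\<in>elts M s. x \<in> Y \<and> z \<preceq> x) \<and>
      (\<forall>w\<in>elts M s. \<forall>x. x \<prec> w \<longrightarrow> x \<in> Y \<longrightarrow> z \<preceq> x \<longrightarrow> x \<in> elts M s)" for z s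
    unfolding seg_def init_seg_def tail_def by auto
  moreover have "D1 (\<lambda>e. e 1 \<in> B \<and> (\<forall>x\<in>elts M (e 1). x \<in> Y \<and> e 0 \<preceq> x) \<and>
      (\<forall>w\<in>elts M (e 1). \<forall>x. x \<prec> w \<longrightarrow> x \<in> Y \<longrightarrow> e 0 \<preceq> x \<longrightarrow> x \<in> elts M (e 1)))"
    by (intro D1_code_intros F1_var assms B_Sets)
  ultimately show "D1 (\<lambda>e. seg Y (e 0) (e 1))"
    by simp
qed

lemma seg_unique: "seg Y z s \<Longrightarrow> seg Y z t \<Longrightarrow> s = t"
  unfolding seg_def using B_init_seg_unique by blast

lemma tail_Sets: "Y \<in> Sets M \<Longrightarrow> tail z Y \<in> Sets M"
  unfolding tail_def by (rule comprehension[where P="\<lambda>x. x \<in> Y \<and> z \<preceq> x"]) (intro D1_intros F1_var F1_const)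

lemma infin_tail:
  assumes "infin M Y"
  shows "infin M (tail z Y)"
  unfolding infin_def
proof
  fix n
  obtain m where m: "m \<in> Y" "n \<oplus> z \<oplus> \<one> \<prec> m"
    using assms unfolding infin_def by blast
  have "n \<prec> m" "z \<prec> m"
    using N.less_trans[OF less_plus1 m(2)] N.less_trans[OF less_plus2 m(2)] .
  then show "\<exists>m\<in>tail z Y. n \<prec> m"
    using m(1) unfolding tail_def nle_def by blast
qed

lemma ex_seg:
  assumes "Y \<in> Sets M" and "infin M Y" and "Y \<subseteq> base M B"
  shows "\<exists>s. seg Y z s"
  using block[OF tail_Sets[OF assms(1)] infin_tail[OF assms(2)]] assms(3)
  unfolding seg_def tail_def by blast

lemma minus_least_tail:
  assumes "consec Y z z'"
  shows "minus_least M (tail z Y) = tail z' Y"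
proof
  have z: "z \<in> Y" "z' \<in> Y" "z \<prec> z'" "\<And>w. w \<in> Y \<Longrightarrow> z \<prec> w \<Longrightarrow> z' \<preceq> w"
    using assms N.not_less unfolding consec_def by blast+
  show "minus_least M (tail z Y) \<subseteq> tail z' Y"
  proof
    fix x assume "x \<in> minus_least M (tail z Y)"
    then obtain y where "x \<in> Y" "z \<preceq> y" "y \<prec> x"
      unfolding minus_least_def tail_def by blast
    then show "x \<in> tail z' Y"
      using z(4) N.le_less_trans unfolding tail_def by blast
  qed
  show "tail z' Y \<subseteq> minus_least M (tail z Y)"
  proof
    fix x assume "x \<in> tail z' Y"
    then have "x \<in> Y" "z \<prec> x"
      using N.less_le_trans[OF z(3)] unfolding tail_def by blast+
    then show "x \<in> minus_least M (tail z Y)"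
      using z(1) nle_refl unfolding minus_least_def tail_def nle_def by blast
  qed
qed

lemma seg_tri:
  assumes "Y \<in> Sets M" and "infin M Y" and "consec Y z z'" and "seg Y z s" and "seg Y z' t"
  shows "tri M s t"
  unfolding tri_def using assms(4,5) tail_Sets[OF assms(1)] infin_tail[OF assms(2)]
  by (intro bexI[of _ "tail z Y"]) (simp_all add: minus_least_tail[OF assms(3)] seg_def)

text \<open>Without \<open>z\<close>, the set coded by \<open>s\<close> is comparable with the one
  coded by \<open>t\<close> as an initial segment; since \<open>t\<close> is not contained in
  \<open>s\<close>, the union is \<open>t\<close> together with \<open>z\<close>. A change from the
  first to the second side would make this union a member of \<open>I\<close> that occurs at
  \<open>z\<close>.\<close>

lemma no_change:
  assumes "\<And>z. z \<in> Y \<Longrightarrow> \<not> occ I Y z" and "consec Y z z'" and "seg Y z s" and "seg Y z' t"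
    and "side \<zero> s"
  shows "\<not> side \<one> t"
proof
  assume t: "side \<one> t"
  let ?u = "insert z (elts M t)"
  have z: "z \<in> Y" "z' \<in> Y" "z \<prec> z'" "\<And>w. w \<in> Y \<Longrightarrow> z \<prec> w \<Longrightarrow> z' \<preceq> w"
    using assms(2) N.not_less unfolding consec_def by blast+
  have B: "s \<in> B" "t \<in> B"
    using assms(3,4) unfolding seg_def by blast+
  have s_seg: "init_seg M (elts M s) (tail z Y)" and t_seg: "init_seg M (elts M t) (tail z' Y)"
    using assms(3,4) unfolding seg_def by blast+
  have less: "z \<prec> x" if "x \<in> elts M t" for x
    using t_seg that N.less_le_trans[OF z(3)] unfolding init_seg_def tail_def by blast
  have cases: "x = z \<or> x \<in> tail z' Y" if "x \<in> tail z Y" for x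
    using that z(4) unfolding tail_def nle_def by blast
  have "init_seg M (elts M s - {z}) (tail z' Y)"
  proof -
    have "tail z' Y \<subseteq> tail z Y"
      using z(3) N.order_trans[OF N.less_imp_le[OF z(3)]] unfolding tail_def by blast
    moreover have "z \<notin> tail z' Y"
      using z(3) N.not_less unfolding tail_def by blast
    ultimately show ?thesis
      using s_seg cases unfolding init_seg_def by blast
  qed
  then have "elts M s - {z} \<subseteq> elts M t \<or> elts M t \<subseteq> elts M s - {z}"
    using t_seg by (rule init_seg_linear)
  moreover have "\<not> elts M t \<subseteq> elts M s"
    using B_antichain[OF B(2,1)] side_disjoint B(1) assms(5) t by blast
  ultimately have sub: "elts M s \<subseteq> ?u"
    by blast
  have u: "init_seg M ?u (tail z Y)"
    unfolding init_seg_def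
  proof (intro conjI ballI impI)
    show "?u \<subseteq> tail z Y"
      using z(1) nle_refl less t_seg unfolding init_seg_def tail_def nle_def by blast
    fix x w assume x: "x \<in> tail z Y" and w: "w \<in> ?u" "x \<prec> w"
    have "w \<noteq> z"
      using x w(2) N.not_less unfolding tail_def by blast
    then show "x \<in> ?u"
      using cases[OF x] t_seg w unfolding init_seg_def by blast
  qed
  have "init_seg M (elts M s) ?u"
    using s_seg sub by (rule init_seg_between) (use u in \<open>simp add: init_seg_def\<close>)
  then have "code ?u \<in> I"
    using II B assms(5) t less by blast
  moreover have "elts M (code ?u) = ?u"
    by (rule code_props(2)[OF Fin_insert])
  ultimately have "occ I Y z"
    using u unfolding occ_def by (intro bexI[of _ "code ?u"]) simp_all
  then show False
    using assms(1) z(1) by blast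
qed

text \<open>Only changes from the second side to the first are possible. So either the first side is
  never met, or it is kept from the first time on.\<close>

lemma eventually_constant:
  assumes Y: "Y \<in> Sets M" "infin M Y" "Y \<subseteq> base M B" and free: "\<And>z. z \<in> Y \<Longrightarrow> \<not> occ I Y z"
  shows "\<exists>i. \<exists>z0\<in>Y. \<forall>z\<in>Y. z0 \<preceq> z \<longrightarrow> (\<forall>s. seg Y z s \<longrightarrow> side i s)"
proof (cases "\<exists>z0\<in>Y. \<exists>s. seg Y z0 s \<and> side \<zero> s")
  case False
  obtain z0 where "z0 \<in> Y"
    using Y(2) unfolding infin_def by blast
  moreover have "side \<one> s" if "z \<in> Y" "seg Y z s" for z s
    using False that side_cases[of s] unfolding seg_def by blast
  ultimately show ?thesis
    by blast
next
  case True
  then obtain z0 s0 where z0: "z0 \<in> Y" "seg Y z0 s0" "side \<zero> s0"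
    by blast
  have "side \<zero> s" if z: "z \<in> Y" "z0 \<preceq> z" "seg Y z s" for z s
  proof (rule ccontr)
    assume no: "\<not> side \<zero> s"
    let ?P = "\<lambda>z. z \<in> Y \<and> z0 \<preceq> z \<and> (\<exists>s. seg Y z s \<and> \<not> side \<zero> s)"
    have "D1 (\<lambda>e. ?P (e 0))"
      by (rule S1_D1_1, rule S1_and, rule D1_S1, rule D1_mem, rule Y(1), rule F1_var, rule S1_and,
          rule D1_S1, rule D1_le, rule F1_const, rule F1_var, rule S1_ex, rule D1_S1)
        (intro D1_and D1_not D1_seg D1_side F1_var Y(1))
    moreover have "?P z"
      using z no by blast
    ultimately obtain w where w: "?P w" and least: "\<And>k. k \<prec> w \<Longrightarrow> \<not> ?P k"
      by (rule least_D1) blast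
    obtain t where t: "seg Y w t" "\<not> side \<zero> t"
      using w by blast
    have "z0 \<noteq> w"
      using z0 t seg_unique by blast
    then have "z0 \<prec> w"
      using w unfolding nle_def by blast
    then obtain p where p: "consec Y p w" "z0 \<preceq> p"
      using ex_pred[OF Y(1) z0(1)] w by blast
    obtain r where r: "seg Y p r"
      using ex_seg[OF Y] by blast
    then have "side \<zero> r"
      using least[OF consec_D(3)[OF p(1)]] consec_D(1)[OF p(1)] p(2) by blast
    from no_change[OF free p(1) r t(1) this] show False
      using t side_cases[of t] unfolding seg_def by blast
  qed
  then show ?thesis
    using z0(1) by blast
qed

text \<open>From \<open>z0\<close> on all values lie in one summand, and consecutive elements of
  \<open>Y\<close> give segments related by \<open>tri\<close>. Badness excludes that the value
  weakly increases, so by linearity it strictly decreases, contrary to well-foundedness.\<close>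

lemma no_free_set:
  assumes Y: "Y \<in> Sets M" "infin M Y" "Y \<subseteq> base M B" and free: "\<And>z. z \<in> Y \<Longrightarrow> \<not> occ I Y z"
  shows False
proof -
  obtain i z0 where z0: "z0 \<in> Y" "\<And>z s. z \<in> Y \<Longrightarrow> z0 \<preceq> z \<Longrightarrow> seg Y z s \<Longrightarrow> side i s"
    using eventually_constant[OF Y free] by blast
  \<comment> \<open>\<open>n\<close> counts the elements of \<open>Y\<close> from \<open>z0\<close>
    on, starting with zero at \<open>z0\<close>; \<open>q\<close> is the value there.\<close>
  let ?R = "\<lambda>n q z s. z \<in> Y \<and> z0 \<preceq> z \<and> cnt Y z = cnt Y z0 \<oplus> n \<and> seg Y z s \<and> pair M s (pair M i q) \<in> f"
  let ?h = "{x. \<exists>n q z s. x = pair M n q \<and> ?R n q z s}"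
  have h_iff: "pair M n q \<in> ?h \<longleftrightarrow> (\<exists>z s. ?R n q z s)" for n q
    by (auto simp: pair_inject)
  have "?h \<in> Sets M"
    by (rule S1_Sets, rule S1_ex, rule S1_ex, rule S1_ex, rule S1_ex, rule D1_S1)
      (intro D1_intros D1_seg F1_var F1_const F1_pair F1_plus F1_cnt Y(1) f_Sets)
  have vals: "i = \<zero> \<or> i = \<one>" "q \<in> fst W" if "?R n q z s" for n q z s
  proof -
    have "pair M i q \<in> fst (ord_sum M W W)"
      using that by (intro f_range) (elim conjE)
    then show "i = \<zero> \<or> i = \<one>" "q \<in> fst W"
      unfolding in_ord_sum by blast+
  qed
  have total: "\<exists>q z s. ?R n q z s" for n
  proof -
    obtain z where z: "z \<in> Y" "cnt Y z = cnt Y z0 \<oplus> n"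
      using ex_cnt_infin[OF Y(1,2)] by blast
    have "z0 \<preceq> z"
    proof (rule ccontr)
      assume "\<not> z0 \<preceq> z"
      then have "cnt Y z \<prec> cnt Y z0"
        using N.not_less by (intro cnt_less[OF Y(1) z(1)]) blast
      moreover have "cnt Y z0 \<preceq> cnt Y z"
        unfolding z(2) by (rule le_plus1)
      ultimately show False
        using N.not_less by blast
    qed
    obtain s where s: "seg Y z s"
      using ex_seg[OF Y] by blast
    with z(1) \<open>z0 \<preceq> z\<close> have "side i s"
      by (rule z0(2))
    then obtain q where "pair M s (pair M i q) \<in> f"
      unfolding side_def by blast
    with z s \<open>z0 \<preceq> z\<close> have "?R n q z s"
      by simp
    then show ?thesis
      by (intro exI)
  qed
  have unique: "q = q'" if r: "?R n q z s" "?R n q' z' s'" for n q q' z z' s s'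
  proof -
    have R: "z \<in> Y" "cnt Y z = cnt Y z0 \<oplus> n" "seg Y z s" "pair M s (pair M i q) \<in> f"
      using r(1) by blast+
    have R': "z' \<in> Y" "cnt Y z' = cnt Y z0 \<oplus> n" "seg Y z' s'" "pair M s' (pair M i q') \<in> f"
      using r(2) by blast+
    have "z = z'"
      by (rule cnt_inj[OF Y(1) R(1) R'(1) trans[OF R(2) sym[OF R'(2)]]])
    have "s = s'"
      using R(3) R'(3) unfolding \<open>z = z'\<close> by (rule seg_unique)
    have "s \<in> B"
      using R(3) unfolding seg_def by (rule conjunct1)
    from f_unique[OF this R(4)] R'(4) have "pair M i q = pair M i q'"
      unfolding \<open>s = s'\<close> .
    then show ?thesis
      unfolding pair_inject by (rule conjunct2)
  qed
  have "is_fun M ?h UNIV (fst W)"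
  proof -
    have "?h \<subseteq> {pair M x y | x y. x \<in> UNIV \<and> y \<in> fst W}"
    proof
      fix x assume "x \<in> ?h"
      then obtain n q z s where "x = pair M n q" and R: "?R n q z s"
        by (elim CollectE exE conjE) blast
      then show "x \<in> {pair M x y | x y. x \<in> UNIV \<and> y \<in> fst W}"
        using vals(2)[OF R] by blast
    qed
    moreover have "\<exists>!q. pair M n q \<in> ?h" for n
    proof (rule ex_ex1I)
      show "\<exists>q. pair M n q \<in> ?h"
        unfolding h_iff by (rule total)
      fix q q' assume "pair M n q \<in> ?h" and "pair M n q' \<in> ?h"
      then obtain z s z' s' where R: "?R n q z s" and R': "?R n q' z' s'"
        unfolding h_iff by (elim exE)
      from unique[OF R R'] show "q = q'" .
    qed
    ultimately show ?thesis
      unfolding is_fun_def using \<open>?h \<in> Sets M\<close> by simp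
  qed
  moreover have "ord_le M W q p \<and> q \<noteq> p" if h: "pair M n p \<in> ?h" "pair M (n \<oplus> \<one>) q \<in> ?h" for n p q
  proof -
    obtain z s where z: "?R n p z s"
      using h(1) unfolding h_iff by blast
    obtain z' s' where z': "?R (n \<oplus> \<one>) q z' s'"
      using h(2) unfolding h_iff by blast
    have Suc: "cnt Y z' = cnt Y z \<oplus> \<one>"
      using z z' by (simp add: plus_Suc)
    have "consec Y z z'"
      unfolding consec_def
    proof (intro conjI allI impI notI)
      show "z \<prec> z'"
      proof (rule ccontr)
        assume "\<not> z \<prec> z'"
        then have "z' \<preceq> z"
          using N.not_less by blast
        from cnt_mono[OF Y(1) this] show False
          unfolding Suc Suc_le[symmetric] by (simp add: less_irrefl)
      qed
      fix w assume w: "w \<prec> z'" "z \<prec> w" "w \<in> Y"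
      have "cnt Y w \<preceq> cnt Y z"
        using cnt_less[OF Y(1) w(3,1)] unfolding Suc nle_Suc .
      moreover have "cnt Y z \<prec> cnt Y w"
        by (rule cnt_less[OF Y(1) conjunct1[OF z] w(2)])
      ultimately show False
        using N.not_less by blast
    qed (use z z' in blast)+
    then have "tri M s s'"
      using seg_tri[OF Y(1,2)] z z' by blast
    then have "\<not> ord_le M (ord_sum M W W) (pair M i p) (pair M i q)"
      using bad z z' unfolding seg_def by blast
    moreover have p: "p \<in> fst W" and q: "q \<in> fst W" and "i = \<zero> \<or> i = \<one>"
      using vals[OF z] vals(2)[OF z'] by blast+
    ultimately have "\<not> ord_le M W p q"
      unfolding ord_sum_le by blast
    then show ?thesis
      using well_order p q unfolding is_well_order_def is_linear_order_def by metis
  qed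
  ultimately show False
    using well_order unfolding is_well_order_def by blast
qed

lemma spread_I: "spread M (base M B) I"
proof
  show "base M B \<in> Sets M"
    by (rule base_Sets)
  show "infin M (base M B)"
    by (rule base_infin)
  show "I \<in> Sets M"
    by (rule I_Sets)
  show "\<forall>u\<in>I. is_fincode M u"
    by (rule I_fincode)
  show "\<not> elts M u \<subset> elts M v" if "u \<in> I" "v \<in> I" for u v
    using I_antichain[OF that] .
  show "\<not> init_seg M (elts M v) (minus_least M X)" if "u \<in> I" "v \<in> I" "init_seg M (elts M u) X" for u v X
    using I_indep[OF that] .
  show "\<exists>b. \<not> dominated (base M B) I X b" if X: "X \<in> Sets M" "infin M X" for X
  proof (rule ccontr)
    assume "\<nexists>b. \<not> dominated (base M B) I X b"
    \<comment> \<open>If compactness fails at \<open>X\<close>, the finite free sets form an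
      infinite tree, and its path is an infinite free set.\<close>
    then interpret bounded_tree M "base M B" I X
      using base_Sets I_Sets I_fincode X by unfold_locales blast+
    show False
      using no_free_set[OF path_Sets path_infin path_subset path_free] .
  qed
qed

end

theorem theorem2p12:
  fixes M :: "'a l2_structure"
  assumes "models_RCA0 M"
    and "is_bqo M (discrete3 M)"
  shows "\<forall>W. is_well_order M W \<longrightarrow> is_bqo M (ord_sum M W W)"
proof (intro allI impI)
  fix W assume W: "is_well_order M W"
  interpret rca M
    by unfold_locales (rule assms(1))
  \<comment> \<open>The hypothesis on the discrete order enters twice: here through the
    enumerations, and below against the spread obtained from a bad function.\<close>
  interpret aca M
    by unfold_locales (rule bqo3_projection[OF assms(2)])
  have "\<exists>s\<in>B. \<exists>t\<in>B. tri M s t \<and> (\<exists>p q. pair M s p \<in> f \<and> pair M t q \<in> f \<and> ord_le M (ord_sum M W W) p q)"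
    if B: "is_barrier M B" "is_fun M f B (fst (ord_sum M W W))" for B f
  proof (rule ccontr)
    assume "\<not> ?thesis"
    then interpret bad_function M B f W
      using B W by unfold_locales blast+
    show False
      using spread.not_bqo_discrete3[OF spread_I] assms(2) by blast
  qed
  moreover have "is_quasi_order M (ord_sum M W W)"
    using W unfolding is_well_order_def is_linear_order_def by (blast intro: quasi_order_ord_sum)
  ultimately show "is_bqo M (ord_sum M W W)"
    unfolding is_bqo_def by blast
qed

end
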